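(* Let $k$ be a field of characteristic $\ne 2$ and $d \in k\setminus\{0,1\}$. The rational map $\psi_d: E_d \to L_d$, $$(x,y) \mapsto \left(\frac{1}{x^2}, \frac{y(d-1)}{x(1-y^2)}\right),$$ is a $2$-isogeny (sending the points $(0,\pm1)$ of $E_d$ to the point at infinity of $L_d$), and its dual $\widehat{\psi}_d: L_d \to E_d$ is given by $$(x,y)\mapsto\left(\frac{2y}{d-x^2}, \frac{y^2 - x^2(1-d)}{y^2+x^2(1-d)}\right).$$
   Context: $E_d$ denotes the elliptic curve over $k$ obtained as the desingularization of the projective closure of $x^2+y^2 = 1+dx^2y^2$ (with identity $(0,1)$), and $L_d$ the elliptic curve $y^2 = x(x-1)(x-d)$ (with identity the point at infinity). *)

theory Defs
  imports "HOL-Algebra.Algebraic_Closure_Type"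
begin

text \<open>
  Everything is geometric over \<^typ>\<open>'k alg_closure\<close>, written K below, for a base field
  \<^typ>\<open>'k\<close>, written k. Function fields of curves are realised as subfields of a fixed
  algebraic closure of K(X).
\<close>

type_synonym 'k ambient = "'k alg_closure poly fract alg_closure"

definition const :: "'k::field alg_closure \<Rightarrow> 'k ambient" where
  "const c = to_ac (Fract [:c:] 1)"

definition base_const :: "'k::field \<Rightarrow> 'k ambient" where
  "base_const c = const (to_ac c)"

text \<open>
  A polynomial in two variables is a \<^typ>\<open>'a poly poly\<close>: the outer variable is Y and the
  coefficients are polynomials in X.
\<close>

definition eval2 :: "'k::field alg_closure poly poly \<Rightarrow> 'k ambient \<times> 'k ambient \<Rightarrow> 'k ambient" where
  "eval2 g p = poly (map_poly (\<lambda>q. poly (map_poly const q) (fst p)) g) (snd p)"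

definition lift2 :: "'k::field poly poly \<Rightarrow> 'k alg_closure poly poly" where
  "lift2 = map_poly (map_poly to_ac)"

text \<open>
  A curve over k is given by an affine plane equation over k together with a
  k-rational point (a : b : c) of its projective closure. The notions below are meant for an equation that is
  absolutely irreducible and of positive degree in Y, and for a nonsingular base point.
\<close>

record (overloaded) 'k curve =
  equation :: "'k poly poly"
  base :: "'k \<times> 'k \<times> 'k"

text \<open>
  The generic point (x, y): x is transcendental over K and y is a root of the equation over K(x).
  All choices of the root are conjugate over K(x), because the equation is irreducible there.
\<close>

definition generic_point :: "'k::field curve \<Rightarrow> 'k ambient \<times> 'k ambient" where
  "generic_point C =
    (let x = to_ac (Fract [:0, 1:] 1)
     in (x, SOME y. eval2 (lift2 (equation C)) (x, y) = 0))"

text \<open>The function field K(C), and its subfield k(C) of functions defined over k.\<close>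

definition function_field :: "'k::field curve \<Rightarrow> 'k ambient set" where
  "function_field C =
    {eval2 g (generic_point C) / eval2 h (generic_point C) | g h.
      eval2 h (generic_point C) \<noteq> 0}"

definition base_function_field :: "'k::field curve \<Rightarrow> 'k ambient set" where
  "base_function_field C =
    {eval2 (lift2 g) (generic_point C) / eval2 (lift2 h) (generic_point C) | g h.
      eval2 (lift2 h) (generic_point C) \<noteq> 0}"

text \<open>
  The desingularization of the projective closure of C is the abstract nonsingular curve of the
  function field: its points over K are the valuation rings R of K(C) over K, i.e. the proper
  subrings that contain K and, for each z in K(C), contain z or its inverse.
\<close>

definition points :: "'k::field curve \<Rightarrow> 'k ambient set set" where
  "points C = {R. R \<subset> function_field C \<and> range const \<subseteq> R \<and>
     (\<forall>a\<in>R. \<forall>b\<in>R. a - b \<in> R \<and> a * b \<in> R) \<and>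
     (\<forall>z\<in>function_field C. z \<in> R \<or> inverse z \<in> R)}"

definition max_ideal :: "'k::field ambient set \<Rightarrow> 'k ambient set" where
  "max_ideal R = {z \<in> R. z = 0 \<or> inverse z \<notin> R}"

definition uniformizer :: "'k::field ambient set \<Rightarrow> 'k ambient \<Rightarrow> bool" where
  "uniformizer R t \<longleftrightarrow> t \<noteq> 0 \<and> max_ideal R = (\<lambda>z. t * z) ` R"

definition ord_at :: "'k::field ambient set \<Rightarrow> 'k ambient \<Rightarrow> int" where
  "ord_at R z = (THE n. \<exists>t. uniformizer R t \<and> z / t powi n \<in> R - max_ideal R)"

text \<open>
  The desingularization morphism to the projective closure: R lies over (a : b : c) if some
  representative (s x : s y : s) of the generic point reduces to (a, b, c) modulo the maximal ideal
  of R.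
\<close>

definition lies_over ::
  "'k::field curve \<Rightarrow> 'k ambient set \<Rightarrow>
    'k alg_closure \<times> 'k alg_closure \<times> 'k alg_closure \<Rightarrow> bool" where
  "lies_over C R p \<longleftrightarrow>
    (case (generic_point C, p) of ((x, y), (a, b, c)) \<Rightarrow>
      (a, b, c) \<noteq> (0, 0, 0) \<and>
      (\<exists>s\<in>function_field C. s * x - const a \<in> max_ideal R \<and>
         s * y - const b \<in> max_ideal R \<and> s - const c \<in> max_ideal R))"

text \<open>Only meaningful for nonsingular points of the projective closure.\<close>

definition point_over ::
  "'k::field curve \<Rightarrow> 'k alg_closure \<times> 'k alg_closure \<times> 'k alg_closure \<Rightarrow> 'k ambient set" where
  "point_over C p = (THE R. R \<in> points C \<and> lies_over C R p)"

definition origin :: "'k::field curve \<Rightarrow> 'k ambient set" where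
  "origin C = point_over C (case base C of (a, b, c) \<Rightarrow> (to_ac a, to_ac b, to_ac c))"

text \<open>
  Linear equivalence of divisors and the resulting group law on the points of a pointed curve of
  genus one: P + Q is the point R with (P) + (Q) linearly equivalent to (R) + (O).
\<close>

definition pt_divisor :: "'k::field ambient set \<Rightarrow> 'k ambient set \<Rightarrow> int" where
  "pt_divisor P = (\<lambda>S. of_bool (S = P))"

definition lin_equiv ::
  "'k::field curve \<Rightarrow> ('k ambient set \<Rightarrow> int) \<Rightarrow> ('k ambient set \<Rightarrow> int) \<Rightarrow> bool" where
  "lin_equiv C D D' \<longleftrightarrow>
    (\<exists>z\<in>function_field C. z \<noteq> 0 \<and> (\<forall>S\<in>points C. D S - D' S = ord_at S z))"

definition add_points ::
  "'k::field curve \<Rightarrow> 'k ambient set \<Rightarrow> 'k ambient set \<Rightarrow> 'k ambient set" where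
  "add_points C P Q =
    (THE R. R \<in> points C \<and>
       lin_equiv C (\<lambda>S. pt_divisor P S + pt_divisor Q S)
                   (\<lambda>S. pt_divisor R S + pt_divisor (origin C) S))"

primrec mult_point :: "'k::field curve \<Rightarrow> nat \<Rightarrow> 'k ambient set \<Rightarrow> 'k ambient set" where
  "mult_point C 0 P = origin C"
| "mult_point C (Suc n) P = add_points C P (mult_point C n P)"

text \<open>
  A rational map from C to C', defined over k, is given by a pair of functions in k(C). It is
  dominant if a polynomial vanishes on its image precisely when it vanishes on C'; this includes
  that the image lies on C'.
\<close>

definition dominant_rational_map ::
  "'k::field curve \<Rightarrow> 'k curve \<Rightarrow> 'k ambient \<times> 'k ambient \<Rightarrow> bool" where
  "dominant_rational_map C C' \<phi> \<longleftrightarrow>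
    fst \<phi> \<in> base_function_field C \<and> snd \<phi> \<in> base_function_field C \<and>
    (\<forall>g. eval2 g \<phi> = 0 \<longleftrightarrow> eval2 g (generic_point C') = 0)"

text \<open>The embedding of K(C') into K(C) given by composition with a dominant rational map.\<close>

definition pullback :: "'k::field curve \<Rightarrow> 'k ambient \<times> 'k ambient \<Rightarrow> 'k ambient \<Rightarrow> 'k ambient" where
  "pullback C' \<phi> z =
    (THE w. \<exists>g h. eval2 h (generic_point C') \<noteq> 0 \<and>
       z = eval2 g (generic_point C') / eval2 h (generic_point C') \<and>
       w = eval2 g \<phi> / eval2 h \<phi>)"

text \<open>
  The action on points of the morphism of nonsingular curves that extends a dominant rational map
  to C'.
\<close>

definition image_point ::
  "'k::field curve \<Rightarrow> 'k ambient \<times> 'k ambient \<Rightarrow> 'k ambient set \<Rightarrow> 'k ambient set" where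
  "image_point C' \<phi> P = {z \<in> function_field C'. pullback C' \<phi> z \<in> P}"

text \<open>
  A nonconstant isogeny over k is a nonconstant morphism over k that respects the origins; its
  degree n is the degree of k(C) over the pullback of k(C').
\<close>

definition isogeny_of_degree ::
  "nat \<Rightarrow> 'k::field curve \<Rightarrow> 'k curve \<Rightarrow> 'k ambient \<times> 'k ambient \<Rightarrow> bool" where
  "isogeny_of_degree n C C' \<phi> \<longleftrightarrow>
    dominant_rational_map C C' \<phi> \<and>
    image_point C' \<phi> (origin C) = origin C' \<and>
    ring.dimension ring_of_type_algebra n
      (pullback C' \<phi> ` base_function_field C') (base_function_field C)"

text \<open>
  The dual of an isogeny from C to C' of degree m is the isogeny back from C' to C such that the
  composite on C is multiplication by m.
\<close>

definition dual_isogeny ::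
  "'k::field curve \<Rightarrow> 'k curve \<Rightarrow> 'k ambient \<times> 'k ambient \<Rightarrow> 'k ambient \<times> 'k ambient \<Rightarrow> bool" where
  "dual_isogeny C C' \<phi> \<phi>' \<longleftrightarrow>
    (\<exists>m n. isogeny_of_degree m C C' \<phi> \<and> isogeny_of_degree n C' C \<phi>' \<and>
      (\<forall>P\<in>points C. image_point C \<phi>' (image_point C' \<phi> P) = mult_point C m P))"

text \<open>
  The equations are X^2 + Y^2 - 1 - d X^2 Y^2 with base point (0 : 1 : 1), and
  Y^2 - X (X - 1) (X - d) with base point (0 : 1 : 0) at infinity.
\<close>

definition edwards :: "'k::field \<Rightarrow> 'k curve" where
  "edwards d = \<lparr>equation = [: [:-1, 0, 1:], 0, [:1, 0, -d:] :], base = (0, 1, 1)\<rparr>"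

definition legendre :: "'k::field \<Rightarrow> 'k curve" where
  "legendre d =
    \<lparr>equation = [: - ([:0, 1:] * [:-1, 1:] * [:-d, 1:]), 0, 1 :], base = (0, 1, 0)\<rparr>"

text \<open>As rational maps on curves, these formulas are applied to the generic point.\<close>

definition psi :: "'k::field \<Rightarrow> 'k ambient \<times> 'k ambient" where
  "psi d =
    (case generic_point (edwards d) of (x, y) \<Rightarrow>
      (1 / x^2, y * (base_const d - 1) / (x * (1 - y^2))))"

definition psi_hat :: "'k::field \<Rightarrow> 'k ambient \<times> 'k ambient" where
  "psi_hat d =
    (case generic_point (legendre d) of (x, y) \<Rightarrow>
      (2 * y / (base_const d - x^2),
       (y^2 - x^2 * (1 - base_const d)) / (y^2 + x^2 * (1 - base_const d))))"

end

theory Submission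
  imports Defs
begin

text \<open>
  Setting \<open>s = (1 + y) / (1 - y)\<close> and \<open>t = 2 s / x\<close> identifies the function field of the Edwards curve
  with that of the cubic \<open>t\<^sup>2 = (1 - d) s\<^sup>3 + 2 (1 + d) s\<^sup>2 + (1 - d) s\<close>, and moves the origin
  \<open>(0, 1)\<close> to infinity. On a cubic \<open>t\<^sup>2 = f(s)\<close> with squarefree \<open>f\<close>, a place is either centred at
  an affine point \<open>(a, b)\<close> or lies at infinity; it is discrete with local parameter \<open>s - a\<close>, \<open>t\<close> or
  \<open>s / t\<close>. A function with one simple zero and one simple pole would be rational in \<open>s\<close>, hence
  invariant under \<open>t \<mapsto> - t\<close>, which is impossible; so a sum of two points is determined by any
  function with the right divisor. The composite of the two maps sends \<open>P\<close> to the reflection of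
  the third intersection of the tangent line at \<open>P\<close> with the cubic, and the tangent line divided by
  a vertical line has the divisor that exhibits this point as \<open>2 P\<close>.
  The degrees are read off from the bases \<open>1, x\<close> and \<open>1, u\<close> of the two function fields over the
  pulled back subfields; translation by the nontrivial point of the kernel fixes the subfield but
  moves \<open>x\<close>, respectively \<open>u\<close>.
\<close>

subsection \<open>Function fields and specialization\<close>

text \<open>The pair \<open>(s, t)\<close> is a Montgomery form of the Edwards curve. The passage to
  it avoids singularities: the closure of the Edwards equation has nodes at its two points at
  infinity, where a centre does not determine a place, whereas the cubic is smooth with one place at
  infinity. Since \<open>ord_at\<close>, \<open>point_over\<close>, \<open>add_points\<close> and
  \<open>pullback\<close> are definite descriptions, every value needs a uniqueness proof; for
  \<open>add_points\<close> this is the statement about one simple zero and one simple pole. The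
  group law is never constructed: duality concerns the composite on the Edwards side only, hence
  only P + O and P + P. Places come from Zorn's lemma; that every affine point of the cubic carries
  one is needed to see that a function without affine poles is a polynomial in s and t. Pairs of
  functions stand in for curves: pairs with the same polynomial relations have isomorphic fields,
  which covers pullbacks, the involution of the cubic and translations by points of order
  two.\<close>

lemma const_0 [simp]: "const 0 = 0"
  and const_1 [simp]: "const 1 = 1"
  and const_add [simp]: "const (a + b) = const a + const b"
  and const_mult [simp]: "const (a * b) = const a * const b"
  and const_minus [simp]: "const (- a) = - const a"
  by (simp_all add: const_def Zero_fract_def One_fract_def one_pCons mult.commute
      flip: to_ac_add to_ac_mult to_ac_minus)

lemma const_eq_iff [simp]: "const a = const b \<longleftrightarrow> a = b"
  by (simp add: const_def eq_fract)

lemma const_eq_0_iff [simp]: "const a = 0 \<longleftrightarrow> a = 0"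
  using const_eq_iff[of a 0] by simp

lemma const_diff [simp]: "const (a - b) = const a - const b"
  using const_add[of a "-b"] by simp

lemma const_power [simp]: "const (a ^ n) = const a ^ n"
  by (induction n) simp_all

lemma const_inverse [simp]: "const (inverse a) = inverse (const a)"
proof (cases "a = 0")
  case False
  then have "const a * const (inverse a) = 1"
    by (simp flip: const_mult)
  then show ?thesis
    by (simp add: inverse_unique)
qed simp

lemma const_divide [simp]: "const (a / b) = const a / const b"
  by (simp add: divide_inverse)

lemma const_of_nat [simp]: "const (of_nat n) = of_nat n"
  by (induction n) simp_all

lemma const_numeral [simp]: "const (numeral n) = numeral n"
  using const_of_nat[of "numeral n"] by simp

text \<open>\<open>const\<close>, \<open>to_ac\<close>, one-variable evaluation,
  \<open>eval2\<close> and \<open>lift2\<close> are all instances, so the laws for coefficientwise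
  maps and evaluations come from one place.\<close>

locale type_hom =
  fixes h :: "'a::comm_ring_1 \<Rightarrow> 'b::comm_ring_1"
  assumes hom_0 [simp]: "h 0 = 0" and hom_1 [simp]: "h 1 = 1"
    and hom_add [simp]: "h (a + b) = h a + h b"
    and hom_mult [simp]: "h (a * b) = h a * h b"
begin

lemma hom_minus [simp]: "h (- a) = - h a"
  using hom_add[of a "-a"] by (simp add: add_eq_0_iff)

lemma map_poly_pCons_hom [simp]: "map_poly h (pCons a p) = pCons (h a) (map_poly h p)"
  by (simp add: map_poly_pCons)

lemma map_poly_hom_add [simp]: "map_poly h (p + q) = map_poly h p + map_poly h q"
  by (rule poly_eqI) (simp add: coeff_map_poly)

lemma map_poly_hom_smult [simp]: "map_poly h (smult a p) = smult (h a) (map_poly h p)"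
  by (simp add: map_poly_smult)

lemma map_poly_hom_mult [simp]: "map_poly h (p * q) = map_poly h p * map_poly h q"
  by (induction p) simp_all

lemma type_hom_map_poly: "type_hom (map_poly h)"
  by unfold_locales simp_all

lemma type_hom_eval: "type_hom (\<lambda>p. poly (map_poly h p) x)"
  by unfold_locales simp_all

end

lemma type_hom_const: "type_hom const"
  by unfold_locales simp_all

lemma type_hom_to_ac: "type_hom to_ac"
  by unfold_locales simp_all

section \<open>Evaluation of polynomials over K at ambient elements\<close>

definition pev :: "'k::field alg_closure poly \<Rightarrow> 'k ambient \<Rightarrow> 'k ambient" where
  "pev p x = poly (map_poly const p) x"

lemma eval2_pev: "eval2 g p = poly (map_poly (\<lambda>q. pev q (fst p)) g) (snd p)"
  by (simp add: eval2_def pev_def)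

lemma type_hom_pev: "type_hom (\<lambda>p. pev p x)"
  unfolding pev_def by (rule type_hom.type_hom_eval[OF type_hom_const])

lemma type_hom_eval2: "type_hom (\<lambda>g. eval2 g p)"
  unfolding eval2_pev by (rule type_hom.type_hom_eval[OF type_hom_pev])

lemma type_hom_lift2: "type_hom lift2"
  unfolding lift2_def
  by (intro type_hom.type_hom_map_poly type_hom_to_ac)

lemma pev_0 [simp]: "pev 0 x = 0"
  and pev_1 [simp]: "pev 1 x = 1"
  and pev_add [simp]: "pev (p + q) x = pev p x + pev q x"
  and pev_mult [simp]: "pev (p * q) x = pev p x * pev q x"
  and pev_minus [simp]: "pev (- p) x = - pev p x"
  using type_hom_pev[of x, THEN type_hom.hom_minus] type_hom_pev[of x] by (simp_all add: type_hom_def)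

lemma eval2_0 [simp]: "eval2 0 p = 0"
  and eval2_1 [simp]: "eval2 1 p = 1"
  and eval2_add [simp]: "eval2 (g + h) p = eval2 g p + eval2 h p"
  and eval2_mult [simp]: "eval2 (g * h) p = eval2 g p * eval2 h p"
  and eval2_minus [simp]: "eval2 (- g) p = - eval2 g p"
  using type_hom_eval2[of p, THEN type_hom.hom_minus] type_hom_eval2[of p] by (simp_all add: type_hom_def)

lemma lift2_0 [simp]: "lift2 0 = 0" and lift2_1 [simp]: "lift2 1 = 1"
  by (simp_all add: type_hom.hom_0[OF type_hom_lift2] type_hom.hom_1[OF type_hom_lift2])

lemma pev_diff [simp]: "pev (p - q) x = pev p x - pev q x"
  using pev_add[of p "-q"] by simp

lemma eval2_diff [simp]: "eval2 (g - h) p = eval2 g p - eval2 h p"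
  using eval2_add[of g "-h"] by simp

lemma pev_pCons [simp]: "pev (pCons a p) x = const a + x * pev p x"
  by (simp add: pev_def map_poly_pCons)

lemma pev_power [simp]: "pev (p ^ n) x = pev p x ^ n"
  by (induction n) simp_all

lemma pev_smult [simp]: "pev (smult a p) x = const a * pev p x"
  by (simp add: pev_def map_poly_smult)

lemma eval2_pCons [simp]: "eval2 (pCons a g) p = pev a (fst p) + snd p * eval2 g p"
  by (simp add: eval2_pev map_poly_pCons)

lemma lift2_pCons [simp]: "lift2 (pCons a g) = pCons (map_poly to_ac a) (lift2 g)"
  by (simp add: lift2_def map_poly_pCons)

text \<open>K is algebraically closed: linear factors are split off until one of them vanishes at
  \<open>x\<close>. Contrapositively, nonconstant elements are transcendental over K, which is how
  transcendence is expressed later.\<close>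

lemma pev_eq_0_imp_const:
  assumes "pev p x = 0" "p \<noteq> 0"
  shows "x \<in> range const"
  using assms
proof (induction "degree p" arbitrary: p)
  case 0
  then show ?case by (auto elim!: degree_eq_zeroE)
next
  case (Suc n)
  then obtain a where a: "poly p a = 0"
    using alg_closed_imp_poly_has_root[of p] by auto
  then obtain q where q: "p = [:-a, 1:] * q"
    by (metis dvdE poly_eq_0_iff_dvd)
  have [simp]: "q \<noteq> 0" using Suc.prems q by auto
  have "degree p = Suc (degree q)"
    unfolding q by (subst degree_mult_eq) auto
  moreover have "x = const a \<or> pev q x = 0"
    using Suc.prems(1) unfolding q by (auto simp: algebra_simps)
  ultimately show ?case using Suc by auto
qed

lemma pev_eq_0_iff: "x \<notin> range const \<Longrightarrow> pev p x = 0 \<longleftrightarrow> p = 0"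
  using pev_eq_0_imp_const by auto

section \<open>Subfields of the ambient field generated by a pair\<close>

definition is_subfield :: "'a::field set \<Rightarrow> bool" where
  "is_subfield S \<longleftrightarrow> 1 \<in> S \<and> (\<forall>a\<in>S. \<forall>b\<in>S. a - b \<in> S \<and> a * b \<in> S) \<and> (\<forall>a\<in>S. inverse a \<in> S)"

context
  fixes S :: "'a::field set"
  assumes S: "is_subfield S"
begin

lemma sf_1: "1 \<in> S" and sf_diff: "a \<in> S \<Longrightarrow> b \<in> S \<Longrightarrow> a - b \<in> S"
  and sf_mult: "a \<in> S \<Longrightarrow> b \<in> S \<Longrightarrow> a * b \<in> S"
  and sf_inverse: "a \<in> S \<Longrightarrow> inverse a \<in> S"
  using S by (auto simp: is_subfield_def)

lemma sf_0: "0 \<in> S" using sf_diff[OF sf_1 sf_1] by simp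

lemma sf_minus: "a \<in> S \<Longrightarrow> - a \<in> S" using sf_diff[OF sf_0] by simp

lemma sf_add: "a \<in> S \<Longrightarrow> b \<in> S \<Longrightarrow> a + b \<in> S"
  using sf_diff[OF _ sf_minus] by simp

lemma sf_divide: "a \<in> S \<Longrightarrow> b \<in> S \<Longrightarrow> a / b \<in> S"
  by (simp add: divide_inverse sf_mult sf_inverse)

lemma sf_power: "a \<in> S \<Longrightarrow> a ^ n \<in> S"
  by (induction n) (auto intro: sf_1 sf_mult)

lemma sf_of_nat: "of_nat n \<in> S"
  by (induction n) (auto intro: sf_0 sf_1 sf_add)

lemma sf_numeral: "numeral n \<in> S"
  using sf_of_nat[of "numeral n"] by simp

lemma sf_power_int: "a \<in> S \<Longrightarrow> a powi n \<in> S"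
  by (simp add: power_int_def sf_power sf_inverse)

lemmas sf = sf_0 sf_1 sf_diff sf_mult sf_inverse sf_minus sf_add sf_divide sf_power sf_numeral sf_power_int

end

text \<open>Stated for an arbitrary pair, so that it applies to a generic point, to its image under
  a rational map and to the coordinates of the cubic model alike.\<close>

definition fun_field :: "'k::field ambient \<times> 'k ambient \<Rightarrow> 'k ambient set" where
  "fun_field p = {eval2 g p / eval2 h p | g h. eval2 h p \<noteq> 0}"

definition base_fun_field :: "'k::field ambient \<times> 'k ambient \<Rightarrow> 'k ambient set" where
  "base_fun_field p = {eval2 (lift2 g) p / eval2 (lift2 h) p | g h. eval2 (lift2 h) p \<noteq> 0}"

lemma function_field_eq: "function_field C = fun_field (generic_point C)"
  by (simp add: function_field_def fun_field_def)

lemma base_function_field_eq: "base_function_field C = base_fun_field (generic_point C)"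
  by (simp add: base_function_field_def base_fun_field_def)

text \<open>\<open>e\<close> is \<open>eval2\<close> or its composite with \<open>lift2\<close>;
  K(C) and k(C) are treated together.\<close>

lemma is_subfield_quotients:
  fixes e :: "'a::comm_ring_1 \<Rightarrow> 'b::field"
  assumes "type_hom e"
  shows "is_subfield {e g / e h | g h. e h \<noteq> 0}" (is "is_subfield ?S")
proof -
  interpret type_hom e by fact
  have I: "w \<in> ?S" if "w = e g / e h" "e h \<noteq> 0" for w g h
    using that by blast
  have "1 \<in> ?S" by (rule I[of _ 1 1]) simp_all
  moreover have "a - b \<in> ?S \<and> a * b \<in> ?S" if "a \<in> ?S" "b \<in> ?S" for a b
  proof -
    obtain g h g' h' where "a = e g / e h" "e h \<noteq> 0" "b = e g' / e h'" "e h' \<noteq> 0"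
      using \<open>a \<in> ?S\<close> \<open>b \<in> ?S\<close> by blast
    then have "a - b = e (g * h' + (- g') * h) / e (h * h')" "a * b = e (g * g') / e (h * h')" "e (h * h') \<noteq> 0"
      by (simp_all only: hom_add hom_mult hom_minus) (simp_all add: diff_frac_eq)
    then show ?thesis by blast
  qed
  moreover have "inverse a \<in> ?S" if a: "a \<in> ?S" for a
  proof -
    obtain g h where gh: "a = e g / e h" "e h \<noteq> 0"
      using a by blast
    show ?thesis
    proof (cases "e g = 0")
      case True
      then show ?thesis using gh by (intro I[of _ 0 1]) auto
    next
      case False
      then show ?thesis using gh by (intro I[of _ h g]) auto
    qed
  qed
  ultimately show ?thesis unfolding is_subfield_def by blast
qed

lemma is_subfield_fun_field: "is_subfield (fun_field p)"
  unfolding fun_field_def by (rule is_subfield_quotients[OF type_hom_eval2])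

lemma type_hom_comp: "type_hom f \<Longrightarrow> type_hom g \<Longrightarrow> type_hom (\<lambda>x. f (g x))"
  unfolding type_hom_def by simp

lemma is_subfield_base_fun_field: "is_subfield (base_fun_field p)"
  unfolding base_fun_field_def
  by (rule is_subfield_quotients[OF type_hom_comp[OF type_hom_eval2 type_hom_lift2]])

lemma eval2_in_fun_field: "eval2 g p \<in> fun_field p"
  unfolding fun_field_def by (rule CollectI, rule exI[of _ g], rule exI[of _ 1]) simp

lemma const_in_fun_field: "const c \<in> fun_field p"
  using eval2_in_fun_field[of "[:[:c:]:]" p] by simp

lemma fst_in_fun_field: "fst p \<in> fun_field p"
  using eval2_in_fun_field[of "[:[:0,1:]:]" p] by simp

lemma snd_in_fun_field: "snd p \<in> fun_field p"
  using eval2_in_fun_field[of "[:0,1:]" p] by simp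

lemma eval2_in_base_fun_field: "eval2 (lift2 g) p \<in> base_fun_field p"
  unfolding base_fun_field_def by (rule CollectI, rule exI[of _ g], rule exI[of _ 1]) simp

lemma base_const_in_base_fun_field: "base_const c \<in> base_fun_field p"
  using eval2_in_base_fun_field[of "[:[:c:]:]" p] by (simp add: base_const_def map_poly_pCons)

lemma fst_in_base_fun_field: "fst p \<in> base_fun_field p"
  using eval2_in_base_fun_field[of "[:[:0,1:]:]" p] by (simp add: map_poly_pCons)

lemma snd_in_base_fun_field: "snd p \<in> base_fun_field p"
  using eval2_in_base_fun_field[of "[:0,1:]" p] by simp

lemma pev_in_subfield:
  assumes "is_subfield S" "range const \<subseteq> S" "x \<in> S"
  shows "pev q x \<in> S"
  by (induction q) (use assms in \<open>auto intro!: sf[OF assms(1)]\<close>)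

text \<open>Reduces inclusions between function fields to their generators.\<close>

lemma fun_field_least:
  assumes "is_subfield S" "range const \<subseteq> S" "fst p \<in> S" "snd p \<in> S"
  shows "fun_field p \<subseteq> S"
proof -
  have "eval2 g p \<in> S" for g
    by (induction g) (use assms in \<open>auto intro!: sf[OF assms(1)] pev_in_subfield\<close>)
  then show ?thesis
    by (auto simp: fun_field_def intro: sf[OF assms(1)])
qed

lemma base_fun_field_least:
  assumes "is_subfield S" "range base_const \<subseteq> S" "fst p \<in> S" "snd p \<in> S"
  shows "base_fun_field p \<subseteq> S"
proof -
  have "pev (map_poly to_ac q) (fst p) \<in> S" for q
    by (induction q) (use assms in \<open>auto intro!: sf[OF assms(1)] simp: map_poly_pCons base_const_def\<close>)
  then have "eval2 (lift2 g) p \<in> S" for g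
    by (induction g) (use assms in \<open>auto intro!: sf[OF assms(1)]\<close>)
  then show ?thesis
    by (auto simp: base_fun_field_def intro: sf[OF assms(1)])
qed

section \<open>Field embeddings given by pairs with the same relations\<close>

definition same_relations :: "'k::field ambient \<times> 'k ambient \<Rightarrow> 'k ambient \<times> 'k ambient \<Rightarrow> bool" where
  "same_relations p q \<longleftrightarrow> (\<forall>g. eval2 g q = 0 \<longleftrightarrow> eval2 g p = 0)"

text \<open>This is \<open>pullback\<close> with pairs in place of curves. Under
  \<open>same_relations p q\<close> it is an isomorphism from \<open>fun_field p\<close> onto
  \<open>fun_field q\<close>; if \<open>q\<close> lies in \<open>fun_field p\<close>, it also
  describes involutions and translations of a single curve.\<close>

definition specialize :: "'k::field ambient \<times> 'k ambient \<Rightarrow> 'k ambient \<times> 'k ambient \<Rightarrow> 'k ambient \<Rightarrow> 'k ambient" where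
  "specialize p q z = (THE w. \<exists>g h. eval2 h p \<noteq> 0 \<and> z = eval2 g p / eval2 h p \<and> w = eval2 g q / eval2 h q)"

lemma pullback_eq: "pullback C' \<phi> = specialize (generic_point C') \<phi>"
  by (rule ext) (simp add: pullback_def specialize_def)

context
  fixes p q :: "'k::field ambient \<times> 'k ambient"
  assumes sr: "same_relations p q"
begin

text \<open>Two fractions with the same value at \<open>p\<close> give, by cross multiplication, a
  relation at \<open>p\<close>; it holds at \<open>q\<close> as well, so the description has exactly
  one value.\<close>

lemma specialize_quotient:
  assumes "eval2 h p \<noteq> 0"
  shows "specialize p q (eval2 g p / eval2 h p) = eval2 g q / eval2 h q"
  unfolding specialize_def
proof (rule the_equality)
  fix w
  assume "\<exists>g' h'. eval2 h' p \<noteq> 0 \<and> eval2 g p / eval2 h p = eval2 g' p / eval2 h' p \<and> w = eval2 g' q / eval2 h' q"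
  then obtain g' h' where *: "eval2 h' p \<noteq> 0" "eval2 g p / eval2 h p = eval2 g' p / eval2 h' p"
    "w = eval2 g' q / eval2 h' q" by blast
  then have "eval2 (g * h' - g' * h) p = 0"
    using assms by (simp add: frac_eq_eq)
  then have "eval2 (g * h' - g' * h) q = 0"
    using sr by (simp only: same_relations_def)
  moreover have "eval2 h q \<noteq> 0" "eval2 h' q \<noteq> 0"
    using * assms sr by (simp_all add: same_relations_def)
  ultimately show "w = eval2 g q / eval2 h q"
    using * by (simp add: frac_eq_eq)
qed (use assms in blast)

lemma specialize_eval2: "specialize p q (eval2 g p) = eval2 g q"
  using specialize_quotient[of 1 g] by simp

lemma specialize_const [simp]: "specialize p q (const c) = const c"
  using specialize_eval2[of "[:[:c:]:]"] by simp

lemma specialize_fst: "specialize p q (fst p) = fst q"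
  using specialize_eval2[of "[:[:0,1:]:]"] by simp

lemma specialize_snd: "specialize p q (snd p) = snd q"
  using specialize_eval2[of "[:0,1:]"] by simp

lemma specialize_hom:
  assumes "a \<in> fun_field p" "b \<in> fun_field p"
  shows specialize_diff: "specialize p q (a - b) = specialize p q a - specialize p q b"
    and specialize_mult: "specialize p q (a * b) = specialize p q a * specialize p q b"
proof -
  obtain g h g' h' where *: "eval2 h p \<noteq> 0" "a = eval2 g p / eval2 h p"
    "eval2 h' p \<noteq> 0" "b = eval2 g' p / eval2 h' p"
    using assms by (auto simp: fun_field_def)
  have nz: "eval2 h q \<noteq> 0" "eval2 h' q \<noteq> 0"
    using * sr by (simp_all add: same_relations_def)
  have "a - b = eval2 (g * h' - g' * h) p / eval2 (h * h') p"
    using * by (simp add: diff_frac_eq)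
  then have "specialize p q (a - b) = eval2 (g * h' - g' * h) q / eval2 (h * h') q"
    by (simp only:) (rule specialize_quotient, use * in simp)
  then show "specialize p q (a - b) = specialize p q a - specialize p q b"
    using * nz by (simp add: specialize_quotient diff_frac_eq)
  have "a * b = eval2 (g * g') p / eval2 (h * h') p"
    using * by simp
  then have "specialize p q (a * b) = eval2 (g * g') q / eval2 (h * h') q"
    by (simp only:) (rule specialize_quotient, use * in simp)
  then show "specialize p q (a * b) = specialize p q a * specialize p q b"
    using * nz by (simp add: specialize_quotient)
qed

lemma specialize_0 [simp]: "specialize p q 0 = 0"
  using specialize_const[of 0] by simp

lemma specialize_1 [simp]: "specialize p q 1 = 1"
  using specialize_const[of 1] by simp

lemma specialize_numeral [simp]: "specialize p q (numeral n) = numeral n"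
  using specialize_const[of "numeral n"] by simp

lemma specialize_minus: "a \<in> fun_field p \<Longrightarrow> specialize p q (- a) = - specialize p q a"
  using specialize_diff[of 0 a] by (simp add: sf_0[OF is_subfield_fun_field])

lemma specialize_add:
  assumes "a \<in> fun_field p" "b \<in> fun_field p"
  shows "specialize p q (a + b) = specialize p q a + specialize p q b"
  using specialize_diff[of a "-b"] assms by (simp add: specialize_minus sf_minus[OF is_subfield_fun_field])

lemma specialize_inverse:
  assumes "a \<in> fun_field p"
  shows "specialize p q (inverse a) = inverse (specialize p q a)"
proof (cases "a = 0")
  case False
  have "specialize p q a * specialize p q (inverse a) = 1"
    using specialize_mult[OF assms sf_inverse[OF is_subfield_fun_field assms]] False by simp
  then show ?thesis by (simp add: inverse_unique)
qed simp

lemma specialize_divide: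
  assumes "a \<in> fun_field p" "b \<in> fun_field p"
  shows "specialize p q (a / b) = specialize p q a / specialize p q b"
  using assms by (simp add: divide_inverse specialize_mult specialize_inverse sf_inverse[OF is_subfield_fun_field])

lemma specialize_power:
  assumes "a \<in> fun_field p"
  shows "specialize p q (a ^ n) = specialize p q a ^ n"
  by (induction n) (use assms in \<open>simp_all add: specialize_mult sf_power[OF is_subfield_fun_field]\<close>)

lemmas specialize_simps = specialize_diff specialize_mult specialize_minus specialize_add
  specialize_inverse specialize_divide specialize_power

lemma specialize_eq_0_iff:
  assumes "a \<in> fun_field p"
  shows "specialize p q a = 0 \<longleftrightarrow> a = 0"
proof
  assume *: "specialize p q a = 0"
  show "a = 0"
  proof (rule ccontr)
    assume "a \<noteq> 0"
    then have "specialize p q a * specialize p q (inverse a) = 1"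
      using specialize_mult[OF assms sf_inverse[OF is_subfield_fun_field assms]] by simp
    then show False using * by simp
  qed
qed simp

lemma specialize_image: "specialize p q ` fun_field p = fun_field q"
proof -
  have "eval2 h p = 0 \<longleftrightarrow> eval2 h q = 0" for h
    using sr by (simp add: same_relations_def)
  then show ?thesis
    unfolding fun_field_def by (force simp: specialize_quotient image_iff)
qed

lemma specialize_base_image: "specialize p q ` base_fun_field p = base_fun_field q"
proof -
  have "eval2 h p = 0 \<longleftrightarrow> eval2 h q = 0" for h
    using sr by (simp add: same_relations_def)
  then show ?thesis
    unfolding base_fun_field_def by (force simp: specialize_quotient image_iff)
qed

lemma specialize_pev: "a \<in> fun_field p \<Longrightarrow> specialize p q (pev r a) = pev r (specialize p q a)"
  by (induction r) (auto simp: specialize_simps const_in_fun_field sf[OF is_subfield_fun_field]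
    pev_in_subfield[OF is_subfield_fun_field] image_subset_iff)

lemma specialize_eval2':
  assumes "a \<in> fun_field p" "b \<in> fun_field p"
  shows "specialize p q (eval2 g (a, b)) = eval2 g (specialize p q a, specialize p q b)"
proof -
  have 1: "eval2 g (a, b) \<in> fun_field p" for g
    by (induction g) (use assms in \<open>auto intro!: sf[OF is_subfield_fun_field] const_in_fun_field
        pev_in_subfield[OF is_subfield_fun_field]\<close>)
  show ?thesis
    by (induction g) (use assms 1 in \<open>auto simp: specialize_simps specialize_pev const_in_fun_field
        sf[OF is_subfield_fun_field] pev_in_subfield[OF is_subfield_fun_field] image_subset_iff\<close>)
qed

end

subsection \<open>Places and their valuations\<close>

definition places :: "'k::field ambient set \<Rightarrow> 'k ambient set set" where
  "places F = {R. R \<subset> F \<and> range const \<subseteq> R \<and>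
     (\<forall>a\<in>R. \<forall>b\<in>R. a - b \<in> R \<and> a * b \<in> R) \<and>
     (\<forall>z\<in>F. z \<in> R \<or> inverse z \<in> R)}"

lemma points_eq: "points C = places (fun_field (generic_point C))"
  by (simp add: points_def places_def function_field_eq)

definition reduces_to :: "'k::field ambient set \<Rightarrow> 'k ambient \<Rightarrow> 'k alg_closure \<Rightarrow> bool" where
  "reduces_to R z c \<longleftrightarrow> z - const c \<in> max_ideal R"

text \<open>For a general place the residue field is not yet known to be K. Units with a residue in
  K are therefore a notion of their own, stronger than membership in
  \<open>R - max_ideal R\<close>.\<close>

definition unit_residue :: "'k::field ambient set \<Rightarrow> 'k ambient \<Rightarrow> bool" where
  "unit_residue R z \<longleftrightarrow> (\<exists>c. c \<noteq> 0 \<and> reduces_to R z c)"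

context
  fixes F R :: "'k::field ambient set"
  assumes F: "is_subfield F" and R: "R \<in> places F"
begin

lemma place_subset: "z \<in> R \<Longrightarrow> z \<in> F"
  and place_const: "const c \<in> R"
  and place_diff: "a \<in> R \<Longrightarrow> b \<in> R \<Longrightarrow> a - b \<in> R"
  and place_mult: "a \<in> R \<Longrightarrow> b \<in> R \<Longrightarrow> a * b \<in> R"
  and place_valuation: "z \<in> F \<Longrightarrow> z \<notin> R \<Longrightarrow> inverse z \<in> R"
  using R by (auto simp: places_def)

lemma place_0: "0 \<in> R" and place_1: "1 \<in> R"
  using place_const[of 0] place_const[of 1] by simp_all

lemma place_minus: "a \<in> R \<Longrightarrow> - a \<in> R"
  using place_diff[OF place_0] by simp

lemma place_add: "a \<in> R \<Longrightarrow> b \<in> R \<Longrightarrow> a + b \<in> R"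
  using place_diff[OF _ place_minus, of a b] by simp

lemma place_power: "a \<in> R \<Longrightarrow> a ^ n \<in> R"
  by (induction n) (auto intro: place_1 place_mult)

lemma max_ideal_subset: "z \<in> max_ideal R \<Longrightarrow> z \<in> R"
  by (simp add: max_ideal_def)

lemma max_ideal_0: "0 \<in> max_ideal R"
  by (simp add: max_ideal_def place_0)

lemma max_ideal_1: "1 \<notin> max_ideal R"
  by (simp add: max_ideal_def place_1)

lemma inverse_in_max_ideal: "z \<in> F \<Longrightarrow> z \<notin> R \<Longrightarrow> inverse z \<in> max_ideal R"
  by (simp add: max_ideal_def place_valuation)

lemma max_ideal_mult:
  assumes "m \<in> max_ideal R" "r \<in> R"
  shows "m * r \<in> max_ideal R"
proof (cases "m * r = 0")
  case True
  then have "m * r = 0" .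
  then show ?thesis by (simp only: max_ideal_0)
next
  case False
  then have "inverse m = r * inverse (m * r)" by (simp add: field_simps)
  moreover have "inverse m \<notin> R"
    using False assms(1) by (simp add: max_ideal_def)
  ultimately have "inverse (m * r) \<notin> R"
    using place_mult[OF assms(2), of "inverse (m * r)"] by argo
  then show ?thesis
    using assms place_mult[of m r] max_ideal_subset unfolding max_ideal_def by blast
qed

lemma max_ideal_mult': "r \<in> R \<Longrightarrow> m \<in> max_ideal R \<Longrightarrow> r * m \<in> max_ideal R"
  using max_ideal_mult[of m r] by (simp add: mult.commute)

text \<open>By the valuation property one of \<open>a / b\<close> and \<open>b / a\<close> lies in
  \<open>R\<close>, so the sum is a multiple of one of its terms.\<close>

lemma max_ideal_add:
  assumes a: "a \<in> max_ideal R" and b: "b \<in> max_ideal R"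
  shows "a + b \<in> max_ideal R"
proof (cases "a = 0 \<or> b = 0")
  case True
  then show ?thesis using assms by auto
next
  case False
  have *: "x + y \<in> max_ideal R" if "x / y \<in> R" "y \<in> max_ideal R" "y \<noteq> 0" for x y
  proof -
    have "x + y = y * (x / y + 1)" using that by (simp add: field_simps)
    then show ?thesis using max_ideal_mult[OF that(2)] place_add[OF that(1) place_1] by simp
  qed
  have "a / b \<in> F"
    using assms by (intro sf_divide[OF F]) (auto intro: place_subset max_ideal_subset)
  then have "a / b \<in> R \<or> b / a \<in> R"
    using place_valuation[of "a / b"] by auto
  then show ?thesis
    using *[of a b] *[of b a] assms False by (auto simp: add.commute)
qed

lemma max_ideal_minus: "a \<in> max_ideal R \<Longrightarrow> - a \<in> max_ideal R"
  using max_ideal_mult'[OF place_minus[OF place_1]] by simp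

lemma max_ideal_diff: "a \<in> max_ideal R \<Longrightarrow> b \<in> max_ideal R \<Longrightarrow> a - b \<in> max_ideal R"
  using max_ideal_add[OF _ max_ideal_minus, of a b] by simp

lemma max_ideal_prime:
  assumes "a * b \<in> max_ideal R" "a \<in> R" "b \<in> R"
  shows "a \<in> max_ideal R \<or> b \<in> max_ideal R"
proof (rule ccontr)
  assume "\<not> ?thesis"
  then have "a \<noteq> 0" "b \<noteq> 0" "inverse a \<in> R" "inverse b \<in> R"
    using assms by (auto simp: max_ideal_def)
  then show False
    using assms place_mult[of "inverse a" "inverse b"] by (auto simp: max_ideal_def mult.commute)
qed

lemma const_in_max_ideal_iff: "const c \<in> max_ideal R \<longleftrightarrow> c = 0"
  using place_const[of c] place_const[of "inverse c"] by (auto simp: max_ideal_def)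

lemma unit_inverse: "z \<in> R - max_ideal R \<Longrightarrow> inverse z \<in> R - max_ideal R"
  by (auto simp: max_ideal_def place_0)

lemma unit_mult: "z \<in> R - max_ideal R \<Longrightarrow> z' \<in> R - max_ideal R \<Longrightarrow> z * z' \<in> R - max_ideal R"
  using max_ideal_prime[of z z'] place_mult[of z z'] by auto

lemma unit_power: "z \<in> R - max_ideal R \<Longrightarrow> z ^ k \<in> R - max_ideal R"
proof (induction k)
  case 0
  then show ?case using place_1 max_ideal_1 by simp
next
  case (Suc k)
  then show ?case using unit_mult[of z "z ^ k"] by simp
qed

lemma unit_power_int: "z \<in> R - max_ideal R \<Longrightarrow> z powi k \<in> R - max_ideal R"
  using unit_power[of z "nat k"] unit_inverse[OF unit_power, of z "nat (- k)"]
  by (auto simp: power_int_def power_inverse)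

lemma reduces_to_in: "reduces_to R z c \<Longrightarrow> z \<in> R"
  unfolding reduces_to_def
  using place_add[OF max_ideal_subset place_const, of "z - const c" c] by simp

lemma reduces_to_0: "reduces_to R z 0 \<longleftrightarrow> z \<in> max_ideal R"
  by (simp add: reduces_to_def)

lemma reduces_to_in_max_ideal_iff: "reduces_to R z c \<Longrightarrow> z \<in> max_ideal R \<longleftrightarrow> c = 0"
  using max_ideal_diff[of z "z - const c"]
  by (auto simp: reduces_to_def const_in_max_ideal_iff)

lemma reduces_to_const: "reduces_to R (const c) c"
  by (simp add: reduces_to_def max_ideal_0)

lemma reduces_to_add:
  "reduces_to R a c \<Longrightarrow> reduces_to R b d \<Longrightarrow> reduces_to R (a + b) (c + d)"
  using max_ideal_add[of "a - const c" "b - const d"] by (simp add: reduces_to_def algebra_simps)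

lemma reduces_to_mult:
  assumes "reduces_to R a c" "reduces_to R b d"
  shows "reduces_to R (a * b) (c * d)"
proof -
  have "a * b - const (c * d) = (a - const c) * b + const c * (b - const d)"
    by (simp add: algebra_simps)
  moreover have "(a - const c) * b \<in> max_ideal R" "const c * (b - const d) \<in> max_ideal R"
    using assms reduces_to_in[OF assms(2)] max_ideal_mult max_ideal_mult' place_const
    by (simp_all add: reduces_to_def)
  ultimately show ?thesis
    using max_ideal_add by (simp add: reduces_to_def)
qed

lemma reduces_to_minus: "reduces_to R a c \<Longrightarrow> reduces_to R (- a) (- c)"
  using reduces_to_mult[OF reduces_to_const[of "-1"], of a c] by simp

lemma reduces_to_diff:
  "reduces_to R a c \<Longrightarrow> reduces_to R b d \<Longrightarrow> reduces_to R (a - b) (c - d)"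
  using reduces_to_add[OF _ reduces_to_minus, of a c b d] by simp

lemma reduces_to_power: "reduces_to R a c \<Longrightarrow> reduces_to R (a ^ n) (c ^ n)"
  by (induction n) (use reduces_to_const[of 1] in \<open>auto intro: reduces_to_mult\<close>)

lemma reduces_to_inverse:
  assumes "reduces_to R a c" "c \<noteq> 0"
  shows "reduces_to R (inverse a) (inverse c)"
proof -
  have a: "a \<in> R - max_ideal R"
    using assms reduces_to_in_max_ideal_iff reduces_to_in by blast
  then have "a \<noteq> 0" by (auto simp: max_ideal_0)
  then have "inverse a - const (inverse c) = - (a - const c) * (inverse a * const (inverse c))"
    using assms by (simp add: field_simps)
  then show ?thesis
    using assms(1) unit_inverse[OF a] unfolding reduces_to_def
    by (metis Diff_iff max_ideal_minus max_ideal_mult place_const place_mult)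
qed

lemma reduces_to_divide:
  "reduces_to R a c \<Longrightarrow> reduces_to R b d \<Longrightarrow> d \<noteq> 0 \<Longrightarrow> reduces_to R (a / b) (c / d)"
  by (simp add: divide_inverse reduces_to_mult reduces_to_inverse)

lemma reduces_to_pev: "reduces_to R x a \<Longrightarrow> reduces_to R (pev p x) (poly p a)"
  by (induction p) (use reduces_to_const[of 0] in \<open>auto intro!: reduces_to_add reduces_to_mult reduces_to_const\<close>)

lemma reduces_to_unique: "reduces_to R z c \<Longrightarrow> reduces_to R z d \<Longrightarrow> c = d"
  using reduces_to_diff[of z c z d] reduces_to_in_max_ideal_iff[of 0 "c - d"] max_ideal_0 by simp

lemma unit_residue_unit: "unit_residue R z \<Longrightarrow> z \<in> R - max_ideal R"
  using reduces_to_in reduces_to_in_max_ideal_iff by (auto simp: unit_residue_def)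

lemma unit_residue_const: "c \<noteq> 0 \<Longrightarrow> unit_residue R (const c)"
  unfolding unit_residue_def using reduces_to_const by blast

lemma unit_residue_1: "unit_residue R 1"
  using unit_residue_const[of 1] by simp

lemma unit_residue_mult: "unit_residue R a \<Longrightarrow> unit_residue R b \<Longrightarrow> unit_residue R (a * b)"
  unfolding unit_residue_def using reduces_to_mult no_zero_divisors by blast

lemma unit_residue_inverse: "unit_residue R a \<Longrightarrow> unit_residue R (inverse a)"
  unfolding unit_residue_def using reduces_to_inverse nonzero_imp_inverse_nonzero by blast

lemma unit_residue_add:
  assumes "unit_residue R a" "b \<in> max_ideal R"
  shows "unit_residue R (a + b)"
  using assms reduces_to_add[of a _ b 0] unfolding unit_residue_def reduces_to_0 by auto

lemma max_ideal_power: "z \<in> max_ideal R \<Longrightarrow> n > 0 \<Longrightarrow> z ^ n \<in> max_ideal R"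
  by (cases n) (auto intro: max_ideal_mult place_power max_ideal_subset)

lemma power_int_unit_iff:
  assumes "t \<in> max_ideal R" "t \<noteq> 0" "u \<in> R - max_ideal R"
  shows power_int_mult_unit_in: "t powi n * u \<in> R \<longleftrightarrow> n \<ge> 0"
    and power_int_mult_unit_in_max_ideal: "t powi n * u \<in> max_ideal R \<longleftrightarrow> n > 0"
proof -
  have pos: "t powi m * v \<in> max_ideal R" if "m > 0" "v \<in> R - max_ideal R" for m v
    using that assms max_ideal_power[of t "nat m"]
    by (auto simp: power_int_def intro!: max_ideal_mult)
  have neg: "t powi n * u \<notin> R" if "n < 0"
  proof
    assume *: "t powi n * u \<in> R"
    have "inverse (t powi n * u) = t powi (- n) * inverse u"
      by (simp add: power_int_minus)
    moreover have "t powi (- n) * inverse u \<in> max_ideal R"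
      by (intro pos unit_inverse[OF assms(3)]) (use that in simp)
    ultimately have "inverse (t powi n * u) \<in> max_ideal R"
      by (simp only:)
    moreover have "t powi n * u \<noteq> 0"
      using assms by (auto simp: max_ideal_0)
    ultimately show False using * by (auto simp: max_ideal_def)
  qed
  show "t powi n * u \<in> R \<longleftrightarrow> n \<ge> 0"
    using neg pos[of n u] assms max_ideal_subset by (cases n "0::int" rule: linorder_cases) auto
  show "t powi n * u \<in> max_ideal R \<longleftrightarrow> n > 0"
    using neg pos[of n u] assms max_ideal_subset by (cases n "0::int" rule: linorder_cases) auto
qed

lemma uniformizer_in: "uniformizer R t \<Longrightarrow> t \<in> max_ideal R \<and> t \<noteq> 0"
  unfolding uniformizer_def using place_1 by (metis image_eqI mult.right_neutral)

text \<open>The description of \<open>ord_at\<close> admits every uniformizer. Two of them divide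
  each other, so they differ by a unit \<open>r\<close> whose powers are absorbed into
  \<open>u\<close>, and the exponent is the same for both.\<close>

lemma ord_at_eqI:
  assumes t: "uniformizer R t" and z: "z = t powi n * u" and u: "u \<in> R - max_ideal R"
  shows "ord_at R z = n"
  unfolding ord_at_def
proof (rule the_equality)
  have t': "t \<in> max_ideal R" "t \<noteq> 0" using uniformizer_in[OF t] by auto
  show "\<exists>t. uniformizer R t \<and> z / t powi n \<in> R - max_ideal R"
    using t t' u by (intro exI[of _ t]) (simp add: z)
  fix m
  assume "\<exists>t. uniformizer R t \<and> z / t powi m \<in> R - max_ideal R"
  then obtain t2 where t2: "uniformizer R t2" and m: "z / t2 powi m \<in> R - max_ideal R" by blast
  have t2': "t2 \<in> max_ideal R" "t2 \<noteq> 0" using uniformizer_in[OF t2] by auto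
  obtain r r' where r: "r \<in> R" "t2 = t * r" "r' \<in> R" "t = t2 * r'"
    using t t2 t' t2' unfolding uniformizer_def by blast
  have "inverse r = r'" 
  proof (rule inverse_unique)
    have "t * (r * r') = t" unfolding mult.assoc[symmetric] r(2)[symmetric] using r(4) by simp
    then show "r * r' = 1" using t' by simp
  qed
  moreover have "r \<noteq> 0" using r(2) t2' by auto
  ultimately have ru: "r \<in> R - max_ideal R" using r(1,3) by (simp add: max_ideal_def)
  have rpow: "r powi k \<in> R - max_ideal R" for k
    using unit_power_int[OF ru] .
  have "t powi (n - m) * u = (z / t2 powi m) * r powi m"
    using t' t2' unfolding z by (simp add: r(2) power_int_diff power_int_mult_distrib)
  then have "t powi (n - m) * u \<in> R - max_ideal R"
    using unit_mult[OF m rpow] by simp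
  then show "m = n"
    using power_int_mult_unit_in[OF t' u, of "n-m"] power_int_mult_unit_in_max_ideal[OF t' u, of "n-m"]
    by auto
qed

end

text \<open>
  The unit \<open>u\<close> must not depend on the place in \<open>Q\<close>; this is what forces \<open>Q\<close> to have at most one
  element.
\<close>

definition local_parameter ::
  "'k::field ambient set \<Rightarrow> 'k ambient set set \<Rightarrow> 'k ambient \<Rightarrow> bool" where
  "local_parameter F Q t \<longleftrightarrow> is_subfield F \<and> Q \<subseteq> places F \<and> t \<in> F \<and> t \<noteq> 0 \<and> (\<forall>R\<in>Q. t \<in> max_ideal R) \<and>
    (\<forall>w\<in>F. w \<noteq> 0 \<longrightarrow> (\<exists>n u. w = t powi n * u \<and> (\<forall>R\<in>Q. unit_residue R u)))"

context
  fixes F :: "'k::field ambient set" and Q t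
  assumes lp: "local_parameter F Q t"
begin

lemma local_parameter_F: "is_subfield F" and local_parameter_nz: "t \<noteq> 0"
  using lp by (auto simp: local_parameter_def)

lemma local_parameter_decomp:
  "w \<in> F \<Longrightarrow> w \<noteq> 0 \<Longrightarrow> \<exists>n u. w = t powi n * u \<and> (\<forall>R\<in>Q. unit_residue R u)"
  using lp unfolding local_parameter_def by blast

lemma local_parameter_place: "R \<in> Q \<Longrightarrow> R \<in> places F" "R \<in> Q \<Longrightarrow> t \<in> max_ideal R"
  using lp by (auto simp: local_parameter_def)

text \<open>The decomposition of a function is shared by all places in \<open>Q\<close>, and the
  sign of its exponent decides membership in each of them.\<close>

lemma local_parameter_unique:
  assumes "R \<in> Q" "R' \<in> Q"
  shows "R = R'"
proof -
  have "w \<in> R \<longleftrightarrow> w \<in> R'" if "w \<in> F" for w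
  proof (cases "w = 0")
    case True
    then show ?thesis
      using assms place_0 local_parameter_F local_parameter_place by blast
  next
    case False
    then obtain n u where w: "w = t powi n * u" "\<And>R. R \<in> Q \<Longrightarrow> unit_residue R u"
      using local_parameter_decomp[OF \<open>w \<in> F\<close> False] by blast
    have "w \<in> S \<longleftrightarrow> n \<ge> 0" if "S \<in> Q" for S
      unfolding w(1) using local_parameter_F local_parameter_place[OF that] local_parameter_nz
      by (intro power_int_mult_unit_in unit_residue_unit w(2) that)
    then show ?thesis using assms by simp
  qed
  then show ?thesis
    using assms local_parameter_place local_parameter_F place_subset by blast
qed

lemma local_parameter_uniformizer:
  assumes "R \<in> Q"
  shows "uniformizer R t"
  unfolding uniformizer_def
proof (intro conjI local_parameter_nz equalityI subsetI)
  note P = local_parameter_F local_parameter_place(1)[OF assms]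
  fix w
  assume w: "w \<in> max_ideal R"
  show "w \<in> (\<lambda>z. t * z) ` R"
  proof (cases "w = 0")
    case True
    then show ?thesis using place_0[OF P] by (intro image_eqI[of _ _ 0]) auto
  next
    case False
    have "w \<in> F" using place_subset[OF P] max_ideal_subset[OF P] w by blast
    then obtain n u where n: "w = t powi n * u" "unit_residue R u"
      using local_parameter_decomp[OF _ False] assms by blast
    then have "n > 0"
      using w power_int_mult_unit_in_max_ideal[OF P local_parameter_place(2)[OF assms] local_parameter_nz
          unit_residue_unit[OF P n(2)], of n] by simp
    then have "w = t * (t powi (n - 1) * u)" "t powi (n - 1) * u \<in> R"
      using n power_int_mult_unit_in[OF P local_parameter_place(2)[OF assms] local_parameter_nz
          unit_residue_unit[OF P n(2)], of "n - 1"] local_parameter_nz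
      by (auto simp: power_int_diff)
    then show ?thesis by blast
  qed
next
  note P = local_parameter_F local_parameter_place(1)[OF assms]
  fix w
  assume "w \<in> (\<lambda>z. t * z) ` R"
  then show "w \<in> max_ideal R"
    using max_ideal_mult[OF P local_parameter_place(2)[OF assms]] by blast
qed

text \<open>This identifies the residue field with K: exponent zero leaves the residue of the unit,
  a positive exponent the residue zero.\<close>

lemma local_parameter_residue:
  assumes "R \<in> Q" "w \<in> R"
  obtains c where "reduces_to R w c"
proof (cases "w = 0")
  case True
  then show ?thesis
    using that reduces_to_const[OF local_parameter_F local_parameter_place(1)[OF assms(1)], of 0] by simp
next
  case False
  note P = local_parameter_F local_parameter_place(1)[OF assms(1)]
  have "w \<in> F" using place_subset[OF P] assms by blast
  then obtain n u where n: "w = t powi n * u" "unit_residue R u"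
    using local_parameter_decomp[OF _ False] assms by blast
  then have "n \<ge> 0"
    using assms power_int_mult_unit_in[OF P local_parameter_place(2)[OF assms(1)] local_parameter_nz
        unit_residue_unit[OF P n(2)], of n] by simp
  show ?thesis
  proof (cases "n = 0")
    case True
    then show ?thesis using n that by (auto simp: unit_residue_def)
  next
    case False
    then have "w \<in> max_ideal R"
      using n \<open>n \<ge> 0\<close> power_int_mult_unit_in_max_ideal[OF P local_parameter_place(2)[OF assms(1)] local_parameter_nz
          unit_residue_unit[OF P n(2)], of n] by auto
    then show ?thesis using that[of 0] by (simp add: reduces_to_def)
  qed
qed

end

section \<open>Order of vanishing at discrete places\<close>

definition discrete_place :: "'k::field ambient set \<Rightarrow> 'k ambient set \<Rightarrow> bool" where
  "discrete_place F R \<longleftrightarrow> (\<exists>t. local_parameter F {R} t)"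

lemma local_parameter_mono: "local_parameter F Q t \<Longrightarrow> Q' \<subseteq> Q \<Longrightarrow> local_parameter F Q' t"
  unfolding local_parameter_def by blast

context
  fixes F R :: "'k::field ambient set"
  assumes R: "discrete_place F R"
begin

lemma discrete_place_F: "is_subfield F"
  and discrete_place_place: "R \<in> places F"
  using R by (auto simp: discrete_place_def local_parameter_def)

text \<open>The hypothesis provides decompositions for one parameter only; they are rewritten here
  in terms of an arbitrary uniformizer.\<close>

lemma ord_atE:
  assumes "w \<in> F" "w \<noteq> 0" "uniformizer R t"
  obtains n u where "ord_at R w = n" "w = t powi n * u" "u \<in> R - max_ideal R"
proof -
  note P = discrete_place_F discrete_place_place
  obtain s where s: "local_parameter F {R} s" using R by (auto simp: discrete_place_def)
  have us: "uniformizer R s" using local_parameter_uniformizer[OF s] by simp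
  have s0: "s \<noteq> 0" "t \<noteq> 0" "t \<in> max_ideal R" "s \<in> max_ideal R"
    using uniformizer_in[OF P us] uniformizer_in[OF P assms(3)] by auto
  have tF: "t \<in> F" using place_subset[OF P] max_ideal_subset[OF P] s0 by blast
  obtain m v where v: "t = s powi m * v" "v \<in> R - max_ideal R"
    using local_parameter_decomp[OF s tF s0(2)] unit_residue_unit[OF P] by blast
  obtain n u where u: "w = s powi n * u" "u \<in> R - max_ideal R"
    using local_parameter_decomp[OF s assms(1,2)] unit_residue_unit[OF P] by blast
  obtain r where r: "s = t * r" "r \<in> R"
    using assms(3) s0 unfolding uniformizer_def by blast
  have rv: "s powi (m - 1) * (v * r) = 1"
    using v(1)[symmetric] r(1)[symmetric] s0 by (simp add: power_int_diff flip: mult.assoc)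
  \<comment> \<open>A larger exponent would put the product in \<open>rv\<close>, which is 1, into
    the maximal ideal; a nonpositive one would keep \<open>t\<close> out of it.\<close>
  have "m = 1"
  proof -
    have "m > 0" using v s0 power_int_mult_unit_in_max_ideal[OF P s0(4,1) v(2), of m] by auto
    moreover have "\<not> m > 1"
    proof
      assume "m > 1"
      then have "s powi (m - 1) * v \<in> max_ideal R"
        using power_int_mult_unit_in_max_ideal[OF P s0(4,1) v(2), of "m - 1"] by auto
      then have "s powi (m - 1) * v * r \<in> max_ideal R" using r max_ideal_mult[OF P] by blast
      then show False using rv max_ideal_1[OF P] by (simp add: mult.assoc)
    qed
    ultimately show ?thesis by simp
  qed
  then have st: "t = s * v" using v by simp
  have vpi: "v powi k \<in> R - max_ideal R" for k
    using unit_power_int[OF P v(2)] .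
  have w: "w = t powi n * (v powi (- n) * u)"
    using v s0 by (auto simp: st u(1) power_int_mult_distrib power_int_minus)
  moreover have vu: "v powi (- n) * u \<in> R - max_ideal R"
    using unit_mult[OF P vpi u(2)] .
  moreover have "ord_at R w = n" using ord_at_eqI[OF P assms(3) w vu] .
  ultimately show ?thesis using that by blast
qed

lemma discrete_place_uniformizer: "\<exists>t. uniformizer R t"
  using R local_parameter_uniformizer unfolding discrete_place_def by blast

lemma ord_at_mult:
  assumes "z \<in> F" "w \<in> F" "z \<noteq> 0" "w \<noteq> 0"
  shows "ord_at R (z * w) = ord_at R z + ord_at R w"
proof -
  note P = discrete_place_F discrete_place_place
  obtain t where t: "uniformizer R t" using discrete_place_uniformizer by blast
  have t0: "t \<noteq> 0" using uniformizer_in[OF P t] by simp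
  obtain m u where u: "ord_at R z = m" "z = t powi m * u" "u \<in> R - max_ideal R" using ord_atE[OF assms(1,3) t] .
  obtain n v where v: "ord_at R w = n" "w = t powi n * v" "v \<in> R - max_ideal R" using ord_atE[OF assms(2,4) t] .
  have "z * w = t powi (m + n) * (u * v)"
    unfolding u(2) v(2) by (simp add: power_int_add t0)
  then show ?thesis
    unfolding u(1) v(1) by (rule ord_at_eqI[OF P t _ unit_mult[OF P u(3) v(3)]])
qed

lemma ord_at_unit: "u \<in> R - max_ideal R \<Longrightarrow> ord_at R u = 0"
  using discrete_place_uniformizer ord_at_eqI[OF discrete_place_F discrete_place_place, of _ u 0 u] by auto

lemma ord_at_inverse:
  assumes "z \<in> F" "z \<noteq> 0"
  shows "ord_at R (inverse z) = - ord_at R z"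
  using ord_at_mult[of z "inverse z"] assms sf_inverse[OF discrete_place_F] ord_at_unit[of 1]
    place_1[OF discrete_place_F discrete_place_place] max_ideal_1[OF discrete_place_F discrete_place_place] by auto

lemma ord_at_divide:
  assumes "z \<in> F" "w \<in> F" "z \<noteq> 0" "w \<noteq> 0"
  shows "ord_at R (z / w) = ord_at R z - ord_at R w"
  using ord_at_mult[of z "inverse w"] ord_at_inverse[of w] assms sf_inverse[OF discrete_place_F]
  by (simp add: divide_inverse)

lemma ord_at_power:
  assumes "z \<in> F" "z \<noteq> 0"
  shows "ord_at R (z ^ n) = int n * ord_at R z"
proof (induction n)
  case 0
  show ?case using ord_at_unit[of 1] place_1[OF discrete_place_F discrete_place_place]
      max_ideal_1[OF discrete_place_F discrete_place_place] by simp
next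
  case (Suc n)
  then show ?case using assms ord_at_mult[of z "z ^ n"] sf_power[OF discrete_place_F]
    by (simp add: algebra_simps)
qed

lemma ord_at_nonneg_iff:
  assumes "z \<in> F" "z \<noteq> 0"
  shows "ord_at R z \<ge> 0 \<longleftrightarrow> z \<in> R"
proof -
  note P = discrete_place_F discrete_place_place
  obtain t where t: "uniformizer R t" using discrete_place_uniformizer by blast
  obtain n u where u: "ord_at R z = n" "z = t powi n * u" "u \<in> R - max_ideal R" using ord_atE[OF assms t] .
  show ?thesis
    unfolding u(1) unfolding u(2)
    using power_int_mult_unit_in[OF P _ _ u(3), of t n] uniformizer_in[OF P t] by simp
qed

lemma ord_at_pos_iff:
  assumes "z \<in> F" "z \<noteq> 0"
  shows "ord_at R z > 0 \<longleftrightarrow> z \<in> max_ideal R"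
proof -
  note P = discrete_place_F discrete_place_place
  obtain t where t: "uniformizer R t" using discrete_place_uniformizer by blast
  obtain n u where u: "ord_at R z = n" "z = t powi n * u" "u \<in> R - max_ideal R" using ord_atE[OF assms t] .
  show ?thesis
    unfolding u(1) unfolding u(2)
    using power_int_mult_unit_in_max_ideal[OF P _ _ u(3), of t n] uniformizer_in[OF P t] by simp
qed

lemma ord_at_uniformizer: "uniformizer R t \<Longrightarrow> ord_at R t = 1"
  using ord_at_eqI[OF discrete_place_F discrete_place_place, of t t 1 1]
    place_1[OF discrete_place_F discrete_place_place] max_ideal_1[OF discrete_place_F discrete_place_place] by auto

end

subsection \<open>Existence of places\<close>

definition coeffs_in :: "'a::field set \<Rightarrow> 'a poly \<Rightarrow> bool" where
  "coeffs_in R P \<longleftrightarrow> (\<forall>i. coeff P i \<in> R)"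

text \<open>
  A subring that is maximal among those containing \<open>w\<close> but not its inverse is a valuation
  ring; this is the case of Chevalley's extension theorem that provides all the places below.
\<close>

locale maximal_avoiding =
  fixes F R :: "'a::field set" and w :: 'a
  assumes F: "is_subfield F" and sub: "R \<subseteq> F" and one: "1 \<in> R"
    and diff: "a \<in> R \<Longrightarrow> b \<in> R \<Longrightarrow> a - b \<in> R"
    and mult: "a \<in> R \<Longrightarrow> b \<in> R \<Longrightarrow> a * b \<in> R"
    and w: "w \<in> R" "inverse w \<notin> R" "w \<noteq> 0"
    and maximal: "\<And>A. A \<subseteq> F \<Longrightarrow> R \<subseteq> A \<Longrightarrow> (\<forall>a\<in>A. \<forall>b\<in>A. a - b \<in> A \<and> a * b \<in> A)
      \<Longrightarrow> inverse w \<notin> A \<Longrightarrow> A = R"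
begin

lemma zero: "0 \<in> R"
  using diff[OF one one] by simp

lemma minus: "a \<in> R \<Longrightarrow> - a \<in> R"
  using diff[OF zero] by simp

lemma add: "a \<in> R \<Longrightarrow> b \<in> R \<Longrightarrow> a + b \<in> R"
  using diff[OF _ minus, of a b] by simp

lemma sum: "(\<And>i. i \<in> I \<Longrightarrow> g i \<in> R) \<Longrightarrow> sum g I \<in> R"
  by (induction I rule: infinite_finite_induct) (auto intro: zero add)

lemma coeffs_in_diff: "coeffs_in R P \<Longrightarrow> coeffs_in R P' \<Longrightarrow> coeffs_in R (P - P')"
  and coeffs_in_add: "coeffs_in R P \<Longrightarrow> coeffs_in R P' \<Longrightarrow> coeffs_in R (P + P')"
  and coeffs_in_mult: "coeffs_in R P \<Longrightarrow> coeffs_in R P' \<Longrightarrow> coeffs_in R (P * P')"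
  and coeffs_in_smult: "a \<in> R \<Longrightarrow> coeffs_in R P \<Longrightarrow> coeffs_in R (smult a P)"
  and coeffs_in_monom: "a \<in> R \<Longrightarrow> coeffs_in R (monom a n)"
  and coeffs_in_reflect: "coeffs_in R P \<Longrightarrow> coeffs_in R (reflect_poly P)"
  and coeffs_in_pCons: "coeffs_in R (pCons a P) \<longleftrightarrow> a \<in> R \<and> coeffs_in R P"
  by (auto simp: coeffs_in_def coeff_mult coeff_reflect_poly coeff_pCons split: nat.splits
      intro: diff add mult sum zero)

lemma coeffs_in_poly: "coeffs_in R P \<Longrightarrow> z \<in> R \<Longrightarrow> poly P z \<in> R"
  by (induction P) (auto simp: coeffs_in_pCons intro: zero add mult)

text \<open>The ring R[z] properly contains \<open>R\<close>, so by maximality it contains the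
  inverse of \<open>w\<close>.\<close>

lemma adjoin:
  assumes z: "z \<in> F" "z \<notin> R"
  obtains P where "coeffs_in R P" "w * poly P z = 1"
proof -
  define A where "A = {poly P z | P. coeffs_in R P}"
  have "R \<subseteq> A"
  proof
    fix r assume "r \<in> R"
    then have "coeffs_in R [:r:]" by (auto simp: coeffs_in_pCons) (simp add: coeffs_in_def zero)
    then show "r \<in> A" unfolding A_def by force
  qed
  moreover have "coeffs_in R [:0, 1:]" by (auto simp: coeffs_in_pCons zero one) (simp add: coeffs_in_def zero)
  then have "z \<in> A" unfolding A_def by force
  moreover have "poly P z \<in> F" if "coeffs_in R P" for P
    using that by (induction P) (use z sub in \<open>auto simp: coeffs_in_pCons intro!: sf[OF F]\<close>)
  then have "A \<subseteq> F" by (auto simp: A_def)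
  moreover have "\<forall>a\<in>A. \<forall>b\<in>A. a - b \<in> A \<and> a * b \<in> A"
    unfolding A_def using coeffs_in_diff coeffs_in_mult
    by clarsimp (metis poly_diff poly_mult)
  ultimately have "inverse w \<in> A"
    using maximal[of A] z by blast
  then obtain P where "coeffs_in R P" "poly P z = inverse w" by (auto simp: A_def)
  then show ?thesis using that w by simp
qed

text \<open>Otherwise adjoining the inverse yields a relation w P(1 / (1 - w b)) = 1. Clearing
  denominators with the reflected polynomial and expanding the power of 1 - w b modulo w exhibits 1
  as a multiple of \<open>w\<close> in \<open>R\<close>.\<close>

lemma one_minus_unit:
  assumes b: "b \<in> R"
  shows "inverse (1 - w * b) \<in> R"
proof (rule ccontr)
  assume nin: "inverse (1 - w * b) \<notin> R"
  have rR: "1 - w * b \<in> R" using b w by (intro diff one mult)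
  then have "inverse (1 - w * b) \<in> F" using sub by (auto intro: sf[OF F])
  then obtain P where P: "coeffs_in R P" "w * poly P (inverse (1 - w * b)) = 1"
    using adjoin nin by blast
  have nz: "1 - w * b \<noteq> 0"
    using b w by (metis eq_iff_diff_eq_0 inverse_unique)
  let ?S = "poly (reflect_poly P) (1 - w * b)"
  have S: "?S \<in> R" using coeffs_in_poly coeffs_in_reflect P rR by blast
  have "w * ?S = (1 - w * b) ^ degree P"
    using P nz by (simp add: poly_reflect_poly_nz)
  moreover have "\<exists>b'\<in>R. (1 - w * b) ^ n = 1 - w * b'" for n
  proof (induction n)
    case 0
    then show ?case using zero by force
  next
    case (Suc n)
    then obtain b' where "b' \<in> R" and b': "(1 - w * b) ^ n = 1 - w * b'" by blast
    moreover have "(1 - w * b) ^ Suc n = 1 - w * (b + b' - w * b * b')"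
      unfolding power_Suc b' by (simp add: algebra_simps)
    ultimately show ?case
      using b w by (metis add diff mult)
  qed
  ultimately obtain b' where "b' \<in> R" "w * ?S = 1 - w * b'" by metis
  then have "w * (?S + b') = 1" by (simp add: algebra_simps)
  then have "inverse w = ?S + b'" by (rule inverse_unique)
  then show False using w S \<open>b' \<in> R\<close> add by auto
qed

text \<open>Chevalley's reduction: the relation in 1 / z, divided by the unit 1 - w q0, expresses z
  as e w Q'(1 / z). Substituting this for one factor z of the leading term of \<open>P\<close>
  lowers the degree.\<close>

lemma reduce_degree:
  assumes z: "z \<noteq> 0" and P: "coeffs_in R P" "w * poly P z = 1"
    and Q: "coeffs_in R Q" "w * poly Q (inverse z) = 1" and deg: "degree Q \<le> degree P"
  obtains P' where "coeffs_in R P'" "w * poly P' z = 1" "degree P' < degree P"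
proof -
  have nonconst: "degree T \<noteq> 0" if "coeffs_in R T" "w * poly T x = 1" for T x
  proof
    assume "degree T = 0"
    then obtain c where "T = [:c:]" by (auto elim: degree_eq_zeroE)
    then have "c \<in> R" "inverse w = c"
      using that by (auto simp: coeffs_in_pCons intro: inverse_unique)
    then show False using w by simp
  qed
  obtain q0 Q' where Qc: "Q = pCons q0 Q'" by (cases Q)
  have dQ: "degree Q = Suc (degree Q')"
    using nonconst[OF Q] by (auto simp: Qc split: if_splits)
  have q: "q0 \<in> R" "coeffs_in R Q'" using Q by (auto simp: Qc coeffs_in_pCons)
  define e where "e = inverse (1 - w * q0)"
  have e: "e \<in> R" unfolding e_def by (rule one_minus_unit[OF q(1)])
  have nz: "1 - w * q0 \<noteq> 0"
    using q w by (metis eq_iff_diff_eq_0 inverse_unique)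
  have "(1 - w * q0) * z = w * poly Q' (inverse z)"
    using Q(2) z by (simp add: Qc field_simps)
  then have ez: "z = e * w * poly Q' (inverse z)"
    using nz by (simp add: e_def field_simps)
  let ?n = "degree P" and ?m = "degree Q'"
  \<comment> \<open>The rewritten leading term. Reflection turns Q'(1 / z) into a polynomial in z at
    the cost of the factor z^m, and the degree is at most (n - m - 1) + m.\<close>
  define T where "T = smult (coeff P ?n * e * w) (monom 1 (?n - Suc ?m) * reflect_poly Q')"
  define P0 where "P0 = P - monom (coeff P ?n) ?n"
  have "poly T z = coeff P ?n * z ^ (?n - Suc ?m) * z ^ ?m * (e * w * poly Q' (inverse z))"
    using z by (simp add: T_def poly_monom poly_reflect_poly_nz)
  also have "\<dots> = coeff P ?n * z ^ (?n - Suc ?m + ?m + 1)"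
    unfolding ez[symmetric] by (simp add: power_add)
  also have "?n - Suc ?m + ?m + 1 = ?n" using deg dQ by simp
  finally have "poly (P0 + T) z = poly P z" by (simp add: P0_def poly_monom)
  moreover have "coeffs_in R (P0 + T)"
    unfolding P0_def T_def using P q e w one
    by (intro coeffs_in_add coeffs_in_diff coeffs_in_smult coeffs_in_mult coeffs_in_monom coeffs_in_reflect mult)
      (auto simp: coeffs_in_def)
  moreover have "degree T \<le> ?n - 1"
  proof -
    have "degree T \<le> degree (monom 1 (?n - Suc ?m) * reflect_poly Q')"
      unfolding T_def by (rule degree_smult_le)
    also have "\<dots> \<le> (?n - Suc ?m) + ?m"
      using degree_mult_le[of "monom 1 (?n - Suc ?m)" "reflect_poly Q'"] degree_reflect_poly_le[of Q']
        degree_monom_le[of "1::'a" "?n - Suc ?m"] by linarith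
    finally show ?thesis using deg dQ by simp
  qed
  moreover have "degree P0 \<le> ?n - 1"
    unfolding P0_def
  proof (rule degree_le, intro allI impI)
    fix i assume "?n - 1 < i"
    then show "coeff (P - monom (coeff P ?n) ?n) i = 0"
      using coeff_eq_0[of P i] by (cases "i = ?n") auto
  qed
  ultimately have "degree (P0 + T) < degree P" "coeffs_in R (P0 + T)" "w * poly (P0 + T) z = 1"
    using P nonconst[OF P] degree_add_le[of P0 "?n - 1" T] by auto
  then show ?thesis using that by blast
qed

text \<open>Descent on the total degree: the longer relation is shortened, with z and 1 / z
  exchanging roles where necessary. This excludes that z and its inverse are both missing from
  \<open>R\<close>.\<close>

lemma no_common_relation:
  assumes "z \<noteq> 0" "coeffs_in R P" "w * poly P z = 1"
    and "coeffs_in R Q" "w * poly Q (inverse z) = 1"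
  shows False
  using assms
proof (induction "degree P + degree Q" arbitrary: z P Q rule: less_induct)
  case less
  show ?case
  proof (cases "degree Q \<le> degree P")
    case True
    then obtain P' where "coeffs_in R P'" "w * poly P' z = 1" "degree P' < degree P"
      using reduce_degree less.prems by blast
    then show ?thesis using less.hyps[of P' Q z] less.prems by simp
  next
    case False
    then obtain Q' where "coeffs_in R Q'" "w * poly Q' (inverse z) = 1" "degree Q' < degree Q"
      using reduce_degree[of "inverse z" Q P] less.prems by auto
    then show ?thesis using less.hyps[of P Q' z] less.prems by simp
  qed
qed

lemma valuation: "z \<in> F \<Longrightarrow> z \<in> R \<or> inverse z \<in> R"
  using adjoin[of z] adjoin[of "inverse z"] no_common_relation[of z] zero sf_inverse[OF F, of z] by metis

end

lemma place_exists:
  assumes F: "is_subfield F" and K: "range const \<subseteq> F" and w: "w \<in> F" "w \<notin> range const"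
  obtains R where "R \<in> places F" "w \<in> max_ideal R"
proof -
  define \<A> where "\<A> = {A. A \<subseteq> F \<and> range const \<subseteq> A \<and> w \<in> A \<and> inverse w \<notin> A \<and>
    (\<forall>a\<in>A. \<forall>b\<in>A. a - b \<in> A \<and> a * b \<in> A)}"
  have w0: "w \<noteq> 0" using w(2) const_0 by (metis rangeI)
  \<comment> \<open>Zorn's lemma starts from K[w]. It does not contain the inverse of
    \<open>w\<close>: w p(w) - 1 has constant coefficient -1, so it is not the zero polynomial, and
    \<open>w\<close> is transcendental.\<close>
  have "{pev p w | p. True} \<in> \<A>"
  proof -
    have "inverse w \<noteq> pev p w" for p
    proof
      assume "inverse w = pev p w"
      then have "pev (pCons 0 p - 1) w = 0" using w0 by (simp add: field_simps)
      then have "pCons 0 p - 1 = 0" using pev_eq_0_iff[OF w(2)] by blast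
      then have "coeff (pCons 0 p - 1) 0 = 0" by simp
      then show False by simp
    qed
    moreover have "\<exists>p. const c = pev p w" for c by (rule exI[of _ "[:c:]"]) simp
    moreover have "\<exists>p. w = pev p w" by (rule exI[of _ "[:0,1:]"]) simp
    moreover have "\<exists>r. pev p w - pev q w = pev r w" "\<exists>r. pev p w * pev q w = pev r w" for p q
      by (metis pev_diff, metis pev_mult)
    ultimately show ?thesis
      unfolding \<A>_def using pev_in_subfield[OF F K w(1)] by auto
  qed
  moreover have "\<Union>\<C> \<in> \<A>" if C: "\<C> \<noteq> {}" "subset.chain \<A> \<C>" for \<C>
  proof -
    have sub: "\<C> \<subseteq> \<A>" and ch: "\<And>A B. A \<in> \<C> \<Longrightarrow> B \<in> \<C> \<Longrightarrow> A \<subseteq> B \<or> B \<subseteq> A"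
      using C by (auto simp: subset.chain_def)
    have "a - b \<in> \<Union>\<C> \<and> a * b \<in> \<Union>\<C>" if ab: "a \<in> \<Union>\<C>" "b \<in> \<Union>\<C>" for a b
    proof -
      obtain A B where AB: "A \<in> \<C>" "a \<in> A" "B \<in> \<C>" "b \<in> B" using ab by blast
      then obtain D where "D \<in> \<C>" "a \<in> D" "b \<in> D" using ch[of A B] by blast
      then show ?thesis using sub unfolding \<A>_def by blast
    qed
    moreover obtain A where "A \<in> \<C>" using C by blast
    ultimately show ?thesis using sub unfolding \<A>_def by blast
  qed
  ultimately obtain R where R: "R \<in> \<A>" "\<And>A. A \<in> \<A> \<Longrightarrow> R \<subseteq> A \<Longrightarrow> A = R"
    using subset_Zorn_nonempty[of \<A>] by blast
  have RA: "R \<subseteq> F" "range const \<subseteq> R" "w \<in> R" "inverse w \<notin> R"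
    and cl: "\<And>a b. a \<in> R \<Longrightarrow> b \<in> R \<Longrightarrow> a - b \<in> R \<and> a * b \<in> R"
    using R(1) unfolding \<A>_def by blast+
  have "const 1 \<in> R" using RA(2) by blast
  have "maximal_avoiding F R w"
  proof
    fix A
    assume "A \<subseteq> F" "R \<subseteq> A" "\<forall>a\<in>A. \<forall>b\<in>A. a - b \<in> A \<and> a * b \<in> A" "inverse w \<notin> A"
    then have "A \<in> \<A>" unfolding \<A>_def using RA by blast
    then show "A = R" using R(2) \<open>R \<subseteq> A\<close> by blast
  qed (use RA cl F w0 \<open>const 1 \<in> R\<close> in simp_all)
  then have "z \<in> R \<or> inverse z \<in> R" if "z \<in> F" for z
    using that by (rule maximal_avoiding.valuation)
  then have "R \<in> places F"
    using RA cl sf_inverse[OF F w(1)] unfolding places_def by blast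
  moreover have "w \<in> max_ideal R" using RA by (simp add: max_ideal_def)
  ultimately show ?thesis using that by blast
qed

section \<open>Quadratic relations over K(x)\<close>

lemma order_simple_root:
  assumes "p = [:-a, 1:] * g" "poly g a \<noteq> (0::'a::field)"
  shows "order a p = 1"
proof -
  have "order a p = order a [:-a, 1:] + order a g"
    unfolding assms(1) by (rule order_mult) (use assms(2) in \<open>simp only: mult_eq_0_iff, auto\<close>)
  then show ?thesis using assms(2) order_power_n_n[of a 1] by (simp add: order_0I)
qed

text \<open>After multiplication by \<open>B\<close>, the square of p B equals - A B q^2; for
  nonzero \<open>q\<close> the order at \<open>a\<close> would be even on one side and odd on the
  other.\<close>

lemma odd_order_no_square_relation:
  fixes p :: "'a::field poly"
  assumes eq: "p * p * B + A * q * q = 0" and AB: "A * B \<noteq> 0" and odd: "odd (order a (A * B))"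
  shows "q = 0"
proof (rule ccontr)
  assume q: "q \<noteq> 0"
  have "(p * B) * (p * B) + (A * B) * (q * q) = (p * p * B + A * q * q) * B"
    by (simp add: algebra_simps)
  then have *: "(p * B) * (p * B) = - ((A * B) * (q * q))" by (simp add: eq eq_neg_iff_add_eq_0)
  moreover have nz: "(A * B) * (q * q) \<noteq> 0" using AB q by simp
  ultimately have "p * B \<noteq> 0" by auto
  then have "order a ((p * B) * (p * B)) = 2 * order a (p * B)"
    by (subst order_mult) auto
  moreover have "order a ((A * B) * (q * q)) = order a (A * B) + 2 * order a q"
    using nz q by (subst order_mult, simp, subst order_mult) auto
  ultimately have "2 * order a (p * B) = order a (A * B) + 2 * order a q"
    using * by (simp only: order_uminus)
  then show False using odd by presburger
qed

lemma eval2_smult [simp]: "eval2 (smult a g) p = pev a (fst p) * eval2 g p"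
  using eval2_mult[of "[:a:]" g p] by simp

text \<open>Eliminating y gives B p^2 + A q^2 = 0 at \<open>x\<close>, hence as polynomials. In
  effect the relation A + B Y^2 is irreducible over K(x).\<close>

lemma quadratic_independent:
  assumes x: "x \<notin> range const" and rel: "pev A x + pev B x * y\<^sup>2 = 0"
    and AB: "A * B \<noteq> 0" "odd (order a (A * B))"
  shows "pev p x + pev q x * y = 0 \<longleftrightarrow> p = 0 \<and> q = 0"
proof
  assume eq: "pev p x + pev q x * y = 0"
  then have P: "pev p x = - (pev q x * y)" by (simp add: eq_neg_iff_add_eq_0)
  have "pev (p * p * B + A * q * q) x = (pev q x)\<^sup>2 * (pev A x + pev B x * y\<^sup>2)"
    by (simp add: P power2_eq_square algebra_simps)
  then have "pev (p * p * B + A * q * q) x = 0"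
    unfolding rel by simp
  then have "p * p * B + A * q * q = 0"
    using pev_eq_0_iff[OF x] by blast
  then have "q = 0" using AB by (rule odd_order_no_square_relation)
  then show "p = 0 \<and> q = 0" using eq pev_eq_0_iff[OF x] by simp
qed simp

text \<open>Division by A + B Y^2 leaves one remainder p + q Y for both pairs, and by independence
  it vanishes at either pair only if it is zero.\<close>

lemma same_relations_quadratic:
  assumes x: "x \<notin> range const" "pev A x + pev B x * y\<^sup>2 = 0"
    and x': "x' \<notin> range const" "pev A x' + pev B x' * y'\<^sup>2 = 0"
    and AB: "A * B \<noteq> 0" "odd (order a (A * B))"
  shows "same_relations (x, y) (x', y')"
  unfolding same_relations_def
proof
  fix g
  let ?E = "[:A, 0, B:]"
  have E: "?E \<noteq> 0" "degree ?E = 2" using AB by auto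
  \<comment> \<open>The coefficients are polynomials in X, so only pseudo-division is available; its
    factor \<open>c\<close> is harmless because it does not vanish at a transcendental
    element.\<close>
  obtain c h where c: "c \<noteq> 0" "smult c g = ?E * h + pseudo_mod g ?E"
    using pseudo_mod(1)[OF E(1)] by blast
  have "pseudo_mod g ?E = 0 \<or> degree (pseudo_mod g ?E) < 2"
    using pseudo_mod(2)[OF E(1), of g] E(2) by simp
  then have "degree (pseudo_mod g ?E) < 2" by auto
  then obtain p q where pq: "pseudo_mod g ?E = [:p, q:]"
  proof -
    have "pseudo_mod g ?E = [:coeff (pseudo_mod g ?E) 0, coeff (pseudo_mod g ?E) 1:]"
      using \<open>degree (pseudo_mod g ?E) < 2\<close>
      by (intro poly_eqI) (auto simp: coeff_pCons coeff_eq_0 split: nat.splits)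
    then show ?thesis by (rule that)
  qed
  have "eval2 g (x, y) = 0 \<longleftrightarrow> p = 0 \<and> q = 0"
    if x: "x \<notin> range const" "pev A x + pev B x * y\<^sup>2 = 0" for x y
  proof -
    have "pev c x * eval2 g (x, y) = eval2 (smult c g) (x, y)" by simp
    also have "\<dots> = (pev A x + pev B x * y\<^sup>2) * eval2 h (x, y) + (pev p x + pev q x * y)"
      unfolding c(2) pq by (simp add: power2_eq_square algebra_simps)
    finally have "eval2 g (x, y) = 0 \<longleftrightarrow> pev p x + pev q x * y = 0"
      using c(1) x(2) pev_eq_0_iff[OF x(1), of c] by auto
    then show ?thesis using quadratic_independent[OF x AB] by simp
  qed
  then show "eval2 g (x', y') = 0 \<longleftrightarrow> eval2 g (x, y) = 0" using x x' by simp
qed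

subsection \<open>Images of places\<close>

definition preimage_place ::
  "'k::field ambient \<times> 'k ambient \<Rightarrow> 'k ambient \<times> 'k ambient \<Rightarrow> 'k ambient set \<Rightarrow> 'k ambient set" where
  "preimage_place p q R = {z \<in> fun_field p. specialize p q z \<in> R}"

lemma image_point_eq: "image_point C \<phi> P = preimage_place (generic_point C) \<phi> P"
  by (simp add: image_point_def preimage_place_def function_field_eq pullback_eq)

context
  fixes p q :: "'k::field ambient \<times> 'k ambient" and F R :: "'k ambient set"
  assumes sr: "same_relations p q" and F: "is_subfield F" and q: "fun_field q \<subseteq> F" and R: "R \<in> places F"
begin

text \<open>The place axioms transfer along the embedding except for properness, which requires a
  function \<open>z\<close> whose image lies outside \<open>R\<close>.\<close>

lemma preimage_place_places:
  assumes "z \<in> fun_field p" "specialize p q z \<notin> R"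
  shows "preimage_place p q R \<in> places (fun_field p)"
proof -
  note S = is_subfield_fun_field[of p]
  have spq: "specialize p q x \<in> F" if "x \<in> fun_field p" for x
    using specialize_image[OF sr] q that by blast
  show ?thesis
    unfolding places_def preimage_place_def
    using assms place_const[OF F R] place_diff[OF F R] place_mult[OF F R] place_valuation[OF F R spq]
    by (auto simp: const_in_fun_field specialize_simps[OF sr] sr intro: sf_diff[OF S] sf_mult[OF S] sf_inverse[OF S])
qed

lemma preimage_place_max_ideal:
  "z \<in> fun_field p \<Longrightarrow> z \<in> max_ideal (preimage_place p q R) \<longleftrightarrow> specialize p q z \<in> max_ideal R"
  unfolding max_ideal_def preimage_place_def
  using sf_inverse[OF is_subfield_fun_field, of z p] specialize_eq_0_iff[OF sr, of z]
  by (auto simp: specialize_inverse[OF sr])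

lemma preimage_place_reduces_to:
  "z \<in> fun_field p \<Longrightarrow> reduces_to (preimage_place p q R) z c \<longleftrightarrow> reduces_to R (specialize p q z) c"
  unfolding reduces_to_def
  by (subst preimage_place_max_ideal)
    (auto simp: specialize_diff[OF sr] specialize_const[OF sr] const_in_fun_field intro: sf_diff[OF is_subfield_fun_field])

end

text \<open>An order for a whole set of places at once, with one unit serving all of them, as
  \<open>local_parameter\<close> demands.\<close>

definition has_ord :: "'k::field ambient set set \<Rightarrow> 'k ambient \<Rightarrow> int \<Rightarrow> 'k ambient \<Rightarrow> bool" where
  "has_ord Q t n w \<longleftrightarrow> (\<exists>u. w = t powi n * u \<and> (\<forall>R\<in>Q. unit_residue R u))"

lemma has_ordI: "w = t powi n * u \<Longrightarrow> (\<And>R. R \<in> Q \<Longrightarrow> unit_residue R u) \<Longrightarrow> has_ord Q t n w"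
  unfolding has_ord_def by blast

context
  fixes F :: "'k::field ambient set" and Q and t :: "'k ambient"
  assumes F: "is_subfield F" and Q: "Q \<subseteq> places F" and t: "t \<noteq> 0"
begin

lemma has_ord_mult:
  assumes "has_ord Q t m z" "has_ord Q t n w"
  shows "has_ord Q t (m + n) (z * w)"
proof -
  obtain u v where u: "z = t powi m * u" "\<And>R. R \<in> Q \<Longrightarrow> unit_residue R u"
    and v: "w = t powi n * v" "\<And>R. R \<in> Q \<Longrightarrow> unit_residue R v"
    using assms unfolding has_ord_def by blast
  show ?thesis
  proof (rule has_ordI)
    show "z * w = t powi (m + n) * (u * v)" by (simp add: u(1) v(1) power_int_add t)
    show "unit_residue R (u * v)" if "R \<in> Q" for R
      using that Q u(2) v(2) by (auto intro: unit_residue_mult[OF F])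
  qed
qed

lemma has_ord_inverse:
  assumes "has_ord Q t n w"
  shows "has_ord Q t (- n) (inverse w)"
proof -
  obtain u where u: "w = t powi n * u" "\<And>R. R \<in> Q \<Longrightarrow> unit_residue R u"
    using assms unfolding has_ord_def by blast
  show ?thesis
  proof (rule has_ordI)
    show "inverse w = t powi - n * inverse u" by (simp add: u(1) power_int_minus)
    show "unit_residue R (inverse u)" if "R \<in> Q" for R
      using that Q u(2) by (auto intro: unit_residue_inverse[OF F])
  qed
qed

lemma has_ord_divide: "has_ord Q t m z \<Longrightarrow> has_ord Q t n w \<Longrightarrow> has_ord Q t (m - n) (z / w)"
  using has_ord_mult[OF _ has_ord_inverse, of m z n w] by (simp add: divide_inverse)

lemma has_ord_unit: "(\<And>R. R \<in> Q \<Longrightarrow> unit_residue R u) \<Longrightarrow> has_ord Q t 0 u"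
  by (rule has_ordI[of _ _ _ u]) simp_all

lemma has_ord_self: "has_ord Q t 1 t"
  using Q unit_residue_1[OF F] by (intro has_ordI[of _ _ _ 1]) auto

lemma has_ord_power: "has_ord Q t n w \<Longrightarrow> has_ord Q t (int k * n) (w ^ k)"
proof (induction k)
  case 0
  then show ?case using has_ord_unit[of 1] unit_residue_1[OF F] Q by auto
next
  case (Suc k)
  then show ?case using has_ord_mult[of n w "int k * n" "w ^ k"] by (simp add: algebra_simps)
qed

lemma has_ord_add:
  assumes m: "has_ord Q t m z" and n: "has_ord Q t n w" and "m < n"
    and max: "\<And>R. R \<in> Q \<Longrightarrow> t \<in> max_ideal R"
  shows "has_ord Q t m (z + w)"
proof -
  obtain u v where u: "z = t powi m * u" "\<And>R. R \<in> Q \<Longrightarrow> unit_residue R u"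
    and v: "w = t powi n * v" "\<And>R. R \<in> Q \<Longrightarrow> unit_residue R v"
    using m n unfolding has_ord_def by blast
  have "z + w = t powi m * (u + t powi (n - m) * v)"
    unfolding u(1) v(1) using t by (simp add: power_int_diff distrib_left)
  then show ?thesis
  proof (rule has_ordI)
    fix R assume R: "R \<in> Q"
    then have RF: "R \<in> places F" using Q by blast
    show "unit_residue R (u + t powi (n - m) * v)"
      using \<open>m < n\<close> max[OF R] t unit_residue_unit[OF F RF v(2)[OF R]]
      by (intro unit_residue_add[OF F RF] u(2) R) (simp add: power_int_mult_unit_in_max_ideal[OF F RF])
  qed
qed

text \<open>Meant for summands whose orders have opposite parity, where \<open>m\<close> and
  \<open>n\<close> differ automatically; the implications admit a summand that is zero.\<close>

lemma has_ord_sum_ex: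
  assumes "z \<noteq> 0 \<Longrightarrow> has_ord Q t m z" "w \<noteq> 0 \<Longrightarrow> has_ord Q t n w" "m \<noteq> n" "z + w \<noteq> 0"
    and max: "\<And>R. R \<in> Q \<Longrightarrow> t \<in> max_ideal R"
  shows "\<exists>n. has_ord Q t n (z + w)"
  using assms has_ord_add[of m z n w] has_ord_add[of n w m z]
  by (cases "z = 0"; cases "w = 0"; cases m n rule: linorder_cases) (auto simp: add.commute)

end

lemma local_parameterI:
  assumes F: "is_subfield F" and Q: "Q \<subseteq> places F" and t: "t \<in> F" "t \<noteq> 0" "\<And>R. R \<in> Q \<Longrightarrow> t \<in> max_ideal R"
    and dec: "\<And>w. w \<in> F \<Longrightarrow> w \<noteq> 0 \<Longrightarrow> \<exists>n. has_ord Q t n w"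
  shows "local_parameter F Q t"
  using assms unfolding local_parameter_def has_ord_def by blast

lemma has_ord_ord_at:
  assumes lp: "local_parameter F Q t" and "has_ord Q t n w" "R \<in> Q"
  shows "ord_at R w = n"
  using assms ord_at_eqI[OF local_parameter_F[OF lp] local_parameter_place(1)[OF lp], of R t w n]
    unit_residue_unit[OF local_parameter_F[OF lp] local_parameter_place(1)[OF lp], of R]
    local_parameter_uniformizer[OF lp, of R]
  unfolding has_ord_def by blast

lemma poly_root_factor:
  assumes "poly p a = (0::'a::field)"
  obtains q where "p = [:-a, 1:] * q" "p \<noteq> 0 \<Longrightarrow> degree p = Suc (degree q)"
proof -
  obtain q where q: "p = [:-a, 1:] * q" using assms by (metis dvdE poly_eq_0_iff_dvd)
  moreover have "degree p = Suc (degree q)" if "p \<noteq> 0"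
    using that unfolding q by (subst degree_mult_eq) auto
  ultimately show ?thesis using that by blast
qed

subsection \<open>Places of a plane cubic\<close>

text \<open>Instantiated twice: for the Legendre equation with its generic point, and for the
  Edwards curve in the coordinates \<open>(s, t)\<close>. The latter has leading coefficient 1 - D,
  so the cubic is not assumed monic.\<close>

locale cubic_pair =
  fixes f :: "'k::field alg_closure poly" and s t :: "'k ambient"
  assumes two: "(2::'k alg_closure) \<noteq> 0" and deg: "degree f = 3"
    and simple: "poly f a = 0 \<Longrightarrow> poly (pderiv f) a \<noteq> 0"
    and s: "s \<notin> range const" and t_sq: "t\<^sup>2 = pev f s"
begin

abbreviation F where "F \<equiv> fun_field (s, t)"

lemma F: "is_subfield F" by (rule is_subfield_fun_field)

lemma const_F: "const c \<in> F" and s_F: "s \<in> F" and t_F: "t \<in> F"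
  using const_in_fun_field fst_in_fun_field[of "(s, t)"] snd_in_fun_field[of "(s, t)"] by auto

lemma pev_F: "pev p s \<in> F"
  using pev_in_subfield[OF F _ s_F] const_F by auto

lemmas F_intros = sf[OF F] const_F s_F t_F pev_F

lemma pev_s [simp]: "pev p s = 0 \<longleftrightarrow> p = 0"
  by (rule pev_eq_0_iff[OF s])

lemma simple_root:
  assumes "poly f a = 0"
  obtains g where "f = [:-a, 1:] * g" "poly g a \<noteq> 0"
proof -
  obtain g where g: "f = [:-a, 1:] * g" using poly_root_factor assms by metis
  then have "poly (pderiv f) a = poly g a"
    unfolding g pderiv_mult by (simp add: pderiv_pCons)
  then show ?thesis using that g simple[OF assms] by simp
qed

lemma f_nz: "f \<noteq> 0" using deg by auto

text \<open>Every root of the squarefree \<open>f\<close> is simple. The shape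
  \<open>- f * 1\<close> is the product A * B for the relation - f + 1 Y^2 = 0.\<close>

lemma odd_order: "\<exists>a. odd (order a (- f * 1))"
proof -
  obtain a where a: "poly f a = 0" using alg_closed_imp_poly_has_root[of f] deg by auto
  then obtain g where g: "f = [:-a, 1:] * g" "poly g a \<noteq> 0" using simple_root by blast
  then have "order a f = 1" by (rule order_simple_root)
  then show ?thesis by (intro exI[of _ a]) simp
qed

lemma independent: "pev p s + pev q s * t = 0 \<longleftrightarrow> p = 0 \<and> q = 0"
proof -
  obtain a where "odd (order a (- f * 1))" using odd_order by blast
  then show ?thesis
    using quadratic_independent[OF s, of "- f" 1 t a p q] f_nz by (simp add: t_sq)
qed

text \<open>The reason why t -> - t, negation on the curve, is an automorphism of
  \<open>F\<close>.\<close>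

lemma conj_relations: "same_relations (s, t) (s, - t)"
proof -
  obtain a where "odd (order a (- f * 1))" using odd_order by blast
  then show ?thesis
    by (intro same_relations_quadratic[OF s _ s, of "- f" 1]) (use f_nz in \<open>auto simp: t_sq\<close>)
qed

lemma norm_eq: "(pev p s + pev q s * t) * (pev p s - pev q s * t) = pev (p * p - q * q * f) s"
  by (simp add: algebra_simps flip: t_sq) (simp add: power2_eq_square)

lemma norm_nz: "p \<noteq> 0 \<or> q \<noteq> 0 \<Longrightarrow> p * p - q * q * f \<noteq> 0"
  using norm_eq[of p q] independent[of p q] independent[of p "-q"] by force

text \<open>Such quotients already form a subfield containing the constants, s and t; an inverse is
  the conjugate divided by the norm.\<close>

lemma normal_form:
  assumes "w \<in> F"
  obtains p q r where "r \<noteq> 0" "w = (pev p s + pev q s * t) / pev r s"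
proof -
  let ?S = "{(pev p s + pev q s * t) / pev r s | p q r. r \<noteq> 0}"
  have I: "w \<in> ?S" if "w = (pev p s + pev q s * t) / pev r s" "r \<noteq> 0" for p q r w
    using that by blast
  have "is_subfield ?S"
    unfolding is_subfield_def
  proof (intro conjI ballI)
    show "1 \<in> ?S" by (rule I[of _ 1 0 1]) simp_all
    fix a b assume "a \<in> ?S" "b \<in> ?S"
    then obtain p q r p' q' r' where a: "a = (pev p s + pev q s * t) / pev r s" "r \<noteq> 0"
      and b: "b = (pev p' s + pev q' s * t) / pev r' s" "r' \<noteq> 0" by blast
    show "a - b \<in> ?S"
      by (rule I[of _ "p * r' - p' * r" "q * r' - q' * r" "r * r'"])
        (use a(2) b(2) in \<open>simp_all add: a(1) b(1) diff_frac_eq algebra_simps\<close>)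
    have "(pev p s + pev q s * t) * (pev p' s + pev q' s * t)
        = pev (p * p' + q * q' * f) s + pev (p * q' + p' * q) s * t"
      by (simp add: algebra_simps flip: t_sq) (simp add: power2_eq_square algebra_simps)
    then show "a * b \<in> ?S"
      by (intro I[of _ "p * p' + q * q' * f" "p * q' + p' * q" "r * r'"])
        (use a(2) b(2) in \<open>simp_all add: a(1) b(1)\<close>)
  next
    fix a assume "a \<in> ?S"
    then obtain p q r where a: "a = (pev p s + pev q s * t) / pev r s" "r \<noteq> 0" by blast
    show "inverse a \<in> ?S"
    proof (cases "p = 0 \<and> q = 0")
      case True
      then show ?thesis by (intro I[of _ 0 0 1]) (simp_all add: a)
    next
      case False
      then have nz: "p * p - q * q * f \<noteq> 0" "pev p s + pev q s * t \<noteq> 0"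
        using norm_nz independent by blast+
      have "inverse a = pev r s / (pev p s + pev q s * t)" by (simp add: a)
      also have "\<dots> = pev r s * (pev p s - pev q s * t) / pev (p * p - q * q * f) s"
      proof -
        have "pev p s - pev q s * t \<noteq> 0" using independent[of p "- q"] False by auto
        then show ?thesis unfolding norm_eq[symmetric] by simp
      qed
      also have "\<dots> = (pev (r * p) s + pev (- (r * q)) s * t) / pev (p * p - q * q * f) s"
        by (simp add: algebra_simps)
      finally show ?thesis using nz(1) by (rule I)
    qed
  qed
  moreover have "const c \<in> ?S" for c by (rule I[of _ "[:c:]" 0 1]) simp_all
  then have "range const \<subseteq> ?S" by blast
  moreover have "s \<in> ?S" by (rule I[of _ "[:0,1:]" 0 1]) simp_all
  moreover have "t \<in> ?S" by (rule I[of _ 0 1 1]) simp_all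
  ultimately have "F \<subseteq> ?S" by (intro fun_field_least) auto
  then show ?thesis using that assms by blast
qed

section \<open>Centres of places and local parameters on the cubic\<close>

lemma t_integral:
  assumes R: "R \<in> places F" and f: "pev f s \<in> R"
  shows "t \<in> R"
proof (rule ccontr)
  note P = F R
  assume "t \<notin> R"
  then have "inverse t \<in> max_ideal R" using inverse_in_max_ideal[OF P t_F] by blast
  then have "inverse t ^ 2 * pev f s \<in> max_ideal R"
    using max_ideal_mult[OF P max_ideal_power[OF P]] f by auto
  moreover have "t \<noteq> 0" using \<open>t \<notin> R\<close> place_0[OF P] by auto
  then have "inverse t ^ 2 * pev f s = 1" by (simp flip: t_sq) (simp add: field_simps)
  ultimately show False using max_ideal_1[OF P] by simp
qed

text \<open>Otherwise all s - a are units, hence all nonzero polynomials in s, which split into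
  linear factors. Then t lies in \<open>R\<close> too, and the normal form puts all of
  \<open>F\<close> into \<open>R\<close>, against properness.\<close>

lemma s_residue_exists:
  assumes R: "R \<in> places F" and "s \<in> R"
  obtains a where "reduces_to R s a"
proof -
  note P = F R
  have "\<exists>a. s - const a \<in> max_ideal R"
  proof (rule ccontr)
    assume "\<not> ?thesis"
    then have lin: "s - const a \<in> R - max_ideal R" for a
      using place_diff[OF P \<open>s \<in> R\<close> place_const[OF P]] by blast
    have u: "pev p s \<in> R - max_ideal R" if "p \<noteq> 0" for p
      using that
    proof (induction "degree p" arbitrary: p)
      case 0
      then obtain c where "p = [:c:]" by (auto elim: degree_eq_zeroE)
      then show ?case using 0 place_const[OF P] const_in_max_ideal_iff[OF P] by auto
    next
      case (Suc n)
      then obtain a where "poly p a = 0" using alg_closed_imp_poly_has_root[of p] by auto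
      then obtain q where q: "p = [:-a, 1:] * q" "p \<noteq> 0 \<Longrightarrow> degree p = Suc (degree q)"
        using poly_root_factor by metis
      have "q \<noteq> 0" using q(1) Suc.prems by auto
      moreover have "n = degree q" using q(2) Suc.hyps(2) Suc.prems by simp
      ultimately have "pev q s \<in> R - max_ideal R" using Suc.hyps(1) by blast
      moreover have "pev p s = (s - const a) * pev q s"
        unfolding q(1) pev_mult by simp
      ultimately show ?case
        using unit_mult[OF P lin[of a]] by simp
    qed
    have "t \<in> R" using t_integral[OF R] u[OF f_nz] by blast
    have "F \<subseteq> R"
    proof
      fix w assume "w \<in> F"
      then obtain p q r where w: "r \<noteq> 0" "w = (pev p s + pev q s * t) / pev r s"
        using normal_form by blast
      have pR: "pev p s \<in> R" for p using u[of p] place_0[OF P] by (cases "p = 0") auto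
      show "w \<in> R"
        unfolding w(2) divide_inverse using unit_inverse[OF P u[OF w(1)]] pR \<open>t \<in> R\<close>
        by (auto intro!: place_mult[OF P] place_add[OF P])
    qed
    then show False using R by (auto simp: places_def)
  qed
  then show ?thesis using that by (auto simp: reduces_to_def)
qed

text \<open>The product (t - b)(t + b) = f(s) - f(a) lies in the prime ideal of \<open>R\<close>, so
  t reduces to one of the two square roots.\<close>

lemma center_exists:
  assumes R: "R \<in> places F" and "s \<in> R"
  obtains a b where "reduces_to R s a" "reduces_to R t b" "b\<^sup>2 = poly f a"
proof -
  note P = F R
  obtain a where a: "reduces_to R s a" using s_residue_exists assms by blast
  have fR: "reduces_to R (pev f s) (poly f a)" by (rule reduces_to_pev[OF P a])
  have "t \<in> R" using t_integral[OF R] reduces_to_in[OF P fR] by blast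
  obtain b where b: "b\<^sup>2 = poly f a" using nth_root_exists[of 2 "poly f a"] by auto
  have "(t - const b) * (t + const b) = pev f s - const (poly f a)"
    by (simp add: algebra_simps flip: t_sq b) (simp add: power2_eq_square)
  then have "(t - const b) * (t + const b) \<in> max_ideal R"
    using fR by (simp add: reduces_to_def)
  then have "reduces_to R t b \<or> reduces_to R t (- b)"
    using max_ideal_prime[OF P] place_diff[OF P \<open>t \<in> R\<close> place_const[OF P, of b]]
      place_add[OF P \<open>t \<in> R\<close> place_const[OF P, of b]] by (auto simp: reduces_to_def)
  then show ?thesis using that a b by auto
qed

text \<open>A set of places: uniqueness follows only once a common local parameter for the whole set
  has been found.\<close>

definition places_at :: "'k alg_closure \<Rightarrow> 'k alg_closure \<Rightarrow> 'k ambient set set" where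
  "places_at a b = {R \<in> places F. reduces_to R s a \<and> reduces_to R t b}"

definition places_inf :: "'k ambient set set" where
  "places_inf = {R \<in> places F. s \<notin> R}"

lemma place_cases:
  assumes "R \<in> places F"
  obtains "R \<in> places_inf" | a b where "b\<^sup>2 = poly f a" "R \<in> places_at a b"
  using center_exists assms unfolding places_at_def places_inf_def by blast

lemma local_parameterI':
  assumes Q: "Q \<subseteq> places F" and pi: "\<pi> \<in> F" "\<pi> \<noteq> 0" "\<And>R. R \<in> Q \<Longrightarrow> \<pi> \<in> max_ideal R"
    and dec: "\<And>p q. p \<noteq> 0 \<or> q \<noteq> 0 \<Longrightarrow> \<exists>n. has_ord Q \<pi> n (pev p s + pev q s * t)"
  shows "local_parameter F Q \<pi>"
proof (rule local_parameterI[OF F Q pi])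
  fix w assume w: "w \<in> F" "w \<noteq> 0"
  then obtain p q r where pqr: "r \<noteq> 0" "w = (pev p s + pev q s * t) / pev r s"
    using normal_form by blast
  then have "p \<noteq> 0 \<or> q \<noteq> 0" using w by auto
  then obtain m where m: "has_ord Q \<pi> m (pev p s + pev q s * t)" using dec by blast
  obtain n where "has_ord Q \<pi> n (pev r s)" using dec[of r 0] pqr(1) by auto
  then show "\<exists>n. has_ord Q \<pi> n w"
    unfolding pqr(2) using has_ord_divide[OF F Q pi(2) m] by blast
qed

lemma local_parameter_generic:
  assumes b: "b \<noteq> 0" "b\<^sup>2 = poly f a"
  shows "local_parameter F (places_at a b) (s - const a)"
proof (rule local_parameterI')
  let ?Q = "places_at a b" and ?\<pi> = "s - const a"
  show Q: "?Q \<subseteq> places F" by (auto simp: places_at_def)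
  show "?\<pi> \<in> F" by (intro F_intros)
  show nz: "?\<pi> \<noteq> 0" using s by auto
  show "\<And>R. R \<in> ?Q \<Longrightarrow> ?\<pi> \<in> max_ideal R" by (simp add: places_at_def reduces_to_def)
  note ho = F Q nz
  have unit: "has_ord ?Q ?\<pi> 0 (pev p s + pev q s * t)" if "poly p a + poly q a * b \<noteq> 0" for p q
  proof (rule has_ord_unit[OF ho])
    fix R assume "R \<in> ?Q"
    then have "reduces_to R (pev p s + pev q s * t) (poly p a + poly q a * b)"
      by (auto simp: places_at_def intro!: reduces_to_add[OF F] reduces_to_mult[OF F] reduces_to_pev[OF F])
    then show "unit_residue R (pev p s + pev q s * t)" using that unfolding unit_residue_def by blast
  qed
  have poly: "\<exists>n. has_ord ?Q ?\<pi> n (pev p s)" if "p \<noteq> 0" for p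
  proof -
    obtain q where q: "p = [:-a, 1:] ^ order a p * q" "\<not> [:-a, 1:] dvd q"
      using order_decomp[OF \<open>p \<noteq> 0\<close>] by blast
    have "pev p s = ?\<pi> ^ order a p * pev q s" by (subst q(1)) simp
    moreover have "has_ord ?Q ?\<pi> 0 (pev q s)"
      using unit[of q 0] q(2) by (simp add: poly_eq_0_iff_dvd)
    ultimately show ?thesis
      using has_ord_mult[OF ho has_ord_power[OF ho has_ord_self[OF ho]]] by metis
  qed
  fix p q :: "'k alg_closure poly"
  assume "p \<noteq> 0 \<or> q \<noteq> 0"
  then show "\<exists>n. has_ord ?Q ?\<pi> n (pev p s + pev q s * t)"
  proof (induction "degree p + degree q + of_bool (p \<noteq> 0) + of_bool (q \<noteq> 0)" arbitrary: p q rule: less_induct)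
    case less
    \<comment> \<open>Either the function is a unit, or its conjugate is one and the order is that
      of the norm, a polynomial in s. If both vanish, then \<open>p\<close> and \<open>q\<close>
      vanish at \<open>a\<close>, because 2 and \<open>b\<close> are nonzero, and s - a is divided
      out.\<close>
    consider "poly p a + poly q a * b \<noteq> 0" | "poly p a - poly q a * b \<noteq> 0"
      | "poly p a + poly q a * b = 0" "poly p a - poly q a * b = 0" by blast
    then show ?case
    proof cases
      case 1
      then show ?thesis using unit by blast
    next
      case 2
      then have u: "has_ord ?Q ?\<pi> 0 (pev p s - pev q s * t)" using unit[of p "- q"] by simp
      have "pev p s - pev q s * t \<noteq> 0" using independent[of p "- q"] less.prems by auto
      then have eq: "pev p s + pev q s * t = pev (p * p - q * q * f) s / (pev p s - pev q s * t)"
        unfolding norm_eq[symmetric] by simp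
      show ?thesis
        unfolding eq using poly[OF norm_nz[OF less.prems]] has_ord_divide[OF ho _ u] by blast
    next
      case 3
      have "2 * poly p a = (poly p a + poly q a * b) + (poly p a - poly q a * b)"
        "2 * (poly q a * b) = (poly p a + poly q a * b) - (poly p a - poly q a * b)"
        by (simp_all add: algebra_simps)
      then have "poly p a = 0" "poly q a = 0" unfolding 3 using two b by auto
      then obtain p' q' where p': "p = [:-a, 1:] * p'" "p \<noteq> 0 \<Longrightarrow> degree p = Suc (degree p')"
        and q': "q = [:-a, 1:] * q'" "q \<noteq> 0 \<Longrightarrow> degree q = Suc (degree q')"
        using poly_root_factor by metis
      have nz': "p = 0 \<longleftrightarrow> p' = 0" "q = 0 \<longleftrightarrow> q' = 0"
        unfolding p'(1) q'(1) by (simp_all only: mult_eq_0_iff) simp_all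
      have "\<exists>n. has_ord ?Q ?\<pi> n (pev p' s + pev q' s * t)"
        by (rule less.hyps) (use less.prems p'(2) q'(2) nz' in \<open>cases "p = 0"; cases "q = 0"; simp\<close>)+
      then obtain n where n: "has_ord ?Q ?\<pi> n (pev p' s + pev q' s * t)" by blast
      have "pev p s + pev q s * t = ?\<pi> * (pev p' s + pev q' s * t)"
        unfolding p'(1) q'(1) pev_mult by (simp add: algebra_simps)
      then show ?thesis using has_ord_mult[OF ho has_ord_self[OF ho] n] by auto
    qed
  qed
qed

text \<open>Since \<open>g\<close> does not vanish at the simple root, this gives s - a order two
  with respect to t.\<close>

lemma s_minus_root:
  assumes "poly f a = 0"
  obtains g where "s - const a = t\<^sup>2 / pev g s" "poly g a \<noteq> 0"
proof -
  obtain g where g: "f = [:-a, 1:] * g" "poly g a \<noteq> 0" using simple_root[OF assms] by blast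
  then have "pev g s \<noteq> 0" by auto
  then have "s - const a = t\<^sup>2 / pev g s" by (simp add: t_sq g(1) field_simps)
  then show ?thesis using g that by blast
qed

lemma t_nz: "t \<noteq> 0" using t_sq f_nz by auto

lemma has_ord_two_torsion:
  assumes a: "poly f a = 0"
  shows "has_ord (places_at a 0) t 2 (s - const a)"
    and "p \<noteq> 0 \<Longrightarrow> has_ord (places_at a 0) t (2 * int (order a p)) (pev p s)"
proof -
  let ?Q = "places_at a 0"
  have Q: "?Q \<subseteq> places F" by (auto simp: places_at_def)
  note ho = F Q t_nz
  have unit: "has_ord ?Q t 0 (pev p s)" if "poly p a \<noteq> 0" for p
  proof (rule has_ord_unit[OF ho])
    fix R assume "R \<in> ?Q"
    then have "reduces_to R (pev p s) (poly p a)"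
      by (auto simp: places_at_def intro!: reduces_to_pev[OF F])
    then show "unit_residue R (pev p s)" using that unfolding unit_residue_def by blast
  qed
  obtain g where g: "s - const a = t\<^sup>2 / pev g s" "poly g a \<noteq> 0"
    using s_minus_root[OF a] .
  show sa: "has_ord ?Q t 2 (s - const a)"
    unfolding g(1) using has_ord_divide[OF ho has_ord_power[OF ho has_ord_self[OF ho], of 2] unit[OF g(2)]] by simp
  show "has_ord ?Q t (2 * int (order a p)) (pev p s)" if p: "p \<noteq> 0"
  proof -
    obtain q where q: "p = [:-a, 1:] ^ order a p * q" "\<not> [:-a, 1:] dvd q"
      using order_decomp[OF p] by blast
    have "pev p s = (s - const a) ^ order a p * pev q s" by (subst q(1)) simp
    moreover have "has_ord ?Q t 0 (pev q s)"
      using unit[of q] q(2) by (simp add: poly_eq_0_iff_dvd)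
    ultimately show ?thesis
      using has_ord_mult[OF ho has_ord_power[OF ho sa, of "order a p"], of 0 "pev q s"] by (simp add: mult.commute)
  qed
qed

text \<open>With respect to t, polynomials in s have even order and their multiples by t odd order,
  so the two parts of a numerator never cancel.\<close>

lemma local_parameter_two_torsion:
  assumes a: "poly f a = 0"
  shows "local_parameter F (places_at a 0) t"
proof (rule local_parameterI')
  let ?Q = "places_at a 0"
  show Q: "?Q \<subseteq> places F" by (auto simp: places_at_def)
  show max: "\<And>R. R \<in> ?Q \<Longrightarrow> t \<in> max_ideal R" by (simp add: places_at_def reduces_to_def)
  note ho = F Q t_nz
  fix p q :: "'k alg_closure poly"
  assume nz: "p \<noteq> 0 \<or> q \<noteq> 0"
  show "\<exists>n. has_ord ?Q t n (pev p s + pev q s * t)"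
  proof (rule has_ord_sum_ex[OF ho])
    show "has_ord ?Q t (2 * int (order a p)) (pev p s)" if "pev p s \<noteq> 0"
      using that has_ord_two_torsion(2)[OF a] by auto
    show "has_ord ?Q t (2 * int (order a q) + 1) (pev q s * t)" if "pev q s * t \<noteq> 0"
      using that by (intro has_ord_mult[OF ho] has_ord_two_torsion(2)[OF a] has_ord_self[OF ho]) auto
    show "2 * int (order a p) \<noteq> 2 * int (order a q) + 1" by presburger
    show "pev p s + pev q s * t \<noteq> 0" using nz independent by blast
  qed (rule max)
qed (rule t_F, rule t_nz)

lemma s_nz: "s \<noteq> 0" using s by (metis const_0 rangeI)

lemma reduces_to_inf:
  assumes R: "R \<in> places F" "s \<notin> R"
  shows "reduces_to R (pev p s / s ^ degree p) (lead_coeff p)"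
proof (induction p)
  case 0
  then show ?case using reduces_to_const[OF F R(1), of 0] by simp
next
  case (pCons a p)
  have inv: "reduces_to R (inverse s) 0"
    using inverse_in_max_ideal[OF F R(1) s_F R(2)] by (simp add: reduces_to_def)
  show ?case
  proof (cases "p = 0")
    case True
    then show ?thesis using reduces_to_const[OF F R(1)] by simp
  next
    case False
    have "reduces_to R (const a * inverse s ^ Suc (degree p) + pev p s / s ^ degree p) (a * 0 ^ Suc (degree p) + lead_coeff p)"
      by (intro reduces_to_add[OF F R(1)] reduces_to_mult[OF F R(1)] reduces_to_const[OF F R(1)]
          reduces_to_power[OF F R(1)] inv pCons.IH)
    then show ?thesis using False s_nz by (simp add: field_simps)
  qed
qed

lemma unit_residue_inf:
  assumes "R \<in> places_inf" "p \<noteq> 0"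
  shows "unit_residue R (pev p s / s ^ degree p)"
  unfolding unit_residue_def
proof (intro exI conjI)
  show "reduces_to R (pev p s / s ^ degree p) (lead_coeff p)"
    using assms(1) by (intro reduces_to_inf) (auto simp: places_inf_def)
qed (use assms(2) in simp)

text \<open>As \<open>f\<close> has degree three, f(s) / s^3 is a unit and (s / t)^2 is 1 / s times
  its inverse. The square being regular, s / t is regular, and primeness of the maximal ideal
  finishes.\<close>

lemma s_over_t_max_ideal:
  assumes "R \<in> places_inf"
  shows "s / t \<in> max_ideal R"
proof -
  have R: "R \<in> places F" "s \<notin> R" using assms by (auto simp: places_inf_def)
  note P = F R(1)
  let ?u = "pev f s / s ^ 3"
  have u: "?u \<in> R - max_ideal R"
    using unit_residue_unit[OF P unit_residue_inf[OF assms f_nz]] deg by simp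
  have eq: "(s / t) * (s / t) = inverse s * inverse ?u"
    using s_nz t_nz f_nz by (simp add: field_simps flip: t_sq) (simp add: power2_eq_square power3_eq_cube)
  moreover have "inverse s * inverse ?u \<in> max_ideal R"
    using max_ideal_mult[OF P inverse_in_max_ideal[OF P s_F R(2)]] unit_inverse[OF P u] by blast
  ultimately have sq: "(s / t) * (s / t) \<in> max_ideal R" by (simp only:)
  have "s / t \<in> R"
  proof (rule ccontr)
    assume nR: "s / t \<notin> R"
    then have i: "inverse (s / t) \<in> R"
      by (intro place_valuation[OF P]) (auto intro: F_intros)
    have "(s / t) * (s / t) * (inverse (s / t)) \<in> R"
      using place_mult[OF P max_ideal_subset[OF P sq] i] .
    then show False using nR s_nz t_nz by (simp add: mult.assoc)
  qed
  then show ?thesis using max_ideal_prime[OF P sq] by blast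
qed

text \<open>The order -2 of s results from writing s as the inverse of (s / t)^2 times the unit f(s)
  / s^3; t is then s divided by s / t.\<close>

lemma has_ord_inf:
  shows has_ord_inf_t: "has_ord places_inf (s / t) (-3) t"
    and has_ord_inf_poly: "p \<noteq> 0 \<Longrightarrow> has_ord places_inf (s / t) (- 2 * int (degree p)) (pev p s)"
proof -
  let ?Q = places_inf and ?\<pi> = "s / t"
  have Q: "?Q \<subseteq> places F" by (auto simp: places_inf_def)
  have nz: "?\<pi> \<noteq> 0" using s_nz t_nz by simp
  note ho = F Q nz
  have "has_ord ?Q ?\<pi> 0 (pev f s / s ^ 3)"
    using unit_residue_inf[OF _ f_nz] deg by (intro has_ord_unit[OF ho]) simp
  from has_ord_inverse[OF ho has_ord_mult[OF ho has_ord_power[OF ho has_ord_self[OF ho], of 2] this]]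
  have "has_ord ?Q ?\<pi> (-2) (inverse (?\<pi> ^ 2 * (pev f s / s ^ 3)))" by simp
  also have "inverse (?\<pi> ^ 2 * (pev f s / s ^ 3)) = s"
    using s_nz t_nz by (simp flip: t_sq) (simp add: field_simps power2_eq_square power3_eq_cube)
  finally have s: "has_ord ?Q ?\<pi> (-2) s" .
  have "has_ord ?Q ?\<pi> (-2 - 1) (s / ?\<pi>)"
    by (rule has_ord_divide[OF ho s has_ord_self[OF ho]])
  then show "has_ord ?Q ?\<pi> (-3) t" using s_nz t_nz by simp
  show "has_ord ?Q ?\<pi> (- 2 * int (degree p)) (pev p s)" if "p \<noteq> 0"
  proof -
    have "has_ord ?Q ?\<pi> 0 (pev p s / s ^ degree p)"
      using unit_residue_inf[OF _ that] by (intro has_ord_unit[OF ho])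
    from has_ord_mult[OF ho has_ord_power[OF ho s, of "degree p"] this]
    show ?thesis using s_nz by (simp add: mult.commute)
  qed
qed

lemma local_parameter_inf: "local_parameter F places_inf (s / t)"
proof (rule local_parameterI')
  let ?Q = places_inf and ?\<pi> = "s / t"
  show Q: "?Q \<subseteq> places F" by (auto simp: places_inf_def)
  show nz: "?\<pi> \<noteq> 0" using s_nz t_nz by simp
  note ho = F Q nz
  fix p q :: "'k alg_closure poly"
  assume pq: "p \<noteq> 0 \<or> q \<noteq> 0"
  show "\<exists>n. has_ord ?Q ?\<pi> n (pev p s + pev q s * t)"
  proof (rule has_ord_sum_ex[OF ho])
    show "has_ord ?Q ?\<pi> (- 2 * int (degree p)) (pev p s)" if "pev p s \<noteq> 0"
      using that by (intro has_ord_inf_poly) auto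
    show "has_ord ?Q ?\<pi> (- 2 * int (degree q) + -3) (pev q s * t)" if "pev q s * t \<noteq> 0"
      using that by (intro has_ord_mult[OF ho] has_ord_inf_poly has_ord_inf_t) auto
    show "- 2 * int (degree p) \<noteq> - 2 * int (degree q) + -3" by presburger
    show "pev p s + pev q s * t \<noteq> 0" using pq independent by blast
  qed (rule s_over_t_max_ideal)
qed (auto intro: F_intros s_over_t_max_ideal)

lemma places_at_places: "R \<in> places_at a b \<Longrightarrow> R \<in> places F"
  and places_at_s: "R \<in> places_at a b \<Longrightarrow> reduces_to R s a"
  and places_at_t: "R \<in> places_at a b \<Longrightarrow> reduces_to R t b"
  by (auto simp: places_at_def)

lemma places_inf_places: "R \<in> places_inf \<Longrightarrow> R \<in> places F"
  and places_inf_s: "R \<in> places_inf \<Longrightarrow> s \<notin> R"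
  by (auto simp: places_inf_def)

lemma places_at_local_parameter:
  assumes "b\<^sup>2 = poly f a"
  obtains \<pi> where "local_parameter F (places_at a b) \<pi>"
  using local_parameter_generic[of b a] local_parameter_two_torsion[of a] assms by (cases "b = 0") auto

lemma place_local_parameter:
  assumes "R \<in> places F"
  obtains Q \<pi> where "local_parameter F Q \<pi>" "R \<in> Q"
  using assms by (rule place_cases) (use local_parameter_inf places_at_local_parameter in blast)+

lemma discrete: "R \<in> places F \<Longrightarrow> discrete_place F R"
  unfolding discrete_place_def using place_local_parameter local_parameter_mono[of F]
  by (metis empty_subsetI insert_subset)

lemma places_at_unique:
  "b\<^sup>2 = poly f a \<Longrightarrow> R \<in> places_at a b \<Longrightarrow> R' \<in> places_at a b \<Longrightarrow> R = R'"
  using places_at_local_parameter local_parameter_unique by metis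

lemma places_inf_unique: "R \<in> places_inf \<Longrightarrow> R' \<in> places_inf \<Longrightarrow> R = R'"
  using local_parameter_inf local_parameter_unique by metis

lemma residue_exists:
  assumes "R \<in> places F" "w \<in> R"
  obtains c where "reduces_to R w c"
  using assms place_local_parameter local_parameter_residue by metis

text \<open>Subtracting the residue turns a regular nonconstant function into one with a zero, whose
  inverse has a pole. This supplies the witness of properness for images of places.\<close>

lemma nonconstant_pole:
  assumes R: "R \<in> places F" and u: "u \<notin> range const" "u \<in> R"
  obtains c where "inverse (u - const c) \<notin> R"
proof -
  obtain c where c: "reduces_to R u c" using residue_exists[OF R u(2)] .
  moreover have "u - const c \<noteq> 0" using u(1) by auto
  ultimately have "inverse (u - const c) \<notin> R" by (simp add: reduces_to_def max_ideal_def)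
  then show ?thesis by (rule that)
qed

lemma places_inf_exists: obtains R where "R \<in> places_inf"
proof -
  have "inverse s \<notin> range const"
  proof
    assume "inverse s \<in> range const"
    then obtain c where "inverse s = const c" by blast
    then have "s = const (inverse c)" by (metis const_inverse inverse_inverse_eq)
    then show False using s by blast
  qed
  then obtain R where R: "R \<in> places F" "inverse s \<in> max_ideal R"
    using place_exists[OF F _ sf_inverse[OF F s_F]] const_F by blast
  have "s \<notin> R"
    using R(2) s_nz by (auto simp: max_ideal_def)
  then show ?thesis using that R by (auto simp: places_inf_def)
qed

lemma preimage_place_places':
  assumes sr: "same_relations p q" and q: "fun_field q \<subseteq> F" and R: "R \<in> places F" and nc: "fst q \<notin> range const"
  shows "preimage_place p q R \<in> places (fun_field p)"
proof (cases "fst q \<in> R")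
  case True
  then obtain c where "inverse (fst q - const c) \<notin> R" using nonconstant_pole R nc by blast
  then have "specialize p q (inverse (fst p - const c)) \<notin> R"
    by (simp add: specialize_simps[OF sr] specialize_fst[OF sr] specialize_const[OF sr] const_in_fun_field fst_in_fun_field
        sf_diff[OF is_subfield_fun_field])
  then show ?thesis
    by (intro preimage_place_places[OF sr F q R]) (auto intro: sf_inverse[OF is_subfield_fun_field]
        sf_diff[OF is_subfield_fun_field] const_in_fun_field fst_in_fun_field)
next
  case False
  then show ?thesis
    by (intro preimage_place_places[OF sr F q R, of "fst p"]) (auto simp: specialize_fst[OF sr] fst_in_fun_field)
qed

text \<open>Some place has s reducing to \<open>a\<close>. If t reduces to the wrong square root
  there, the place is moved by t -> - t.\<close>

lemma places_at_exists:
  assumes b: "b\<^sup>2 = poly f a"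
  obtains R where "R \<in> places_at a b"
proof -
  have "s - const a \<notin> range const"
    using s by (metis (no_types, lifting) const_add diff_add_cancel rangeE rangeI)
  then obtain R where R: "R \<in> places F" "s - const a \<in> max_ideal R"
    using place_exists[OF F _ sf_diff[OF F s_F const_F]] const_F by blast
  have sa: "reduces_to R s a" using R(2) by (simp add: reduces_to_def)
  then obtain a' b' where ab': "reduces_to R s a'" "reduces_to R t b'" "b'\<^sup>2 = poly f a'"
    using center_exists[OF R(1) reduces_to_in[OF F R(1)]] by metis
  have "a' = a" using reduces_to_unique[OF F R(1)] sa ab' by blast
  then have "b'\<^sup>2 = b\<^sup>2" using b ab' by simp
  then consider "b' = b" | "b' = - b" using power2_eq_iff by blast
  then show ?thesis
  proof cases
    case 1
    then show ?thesis using that R sa ab' by (auto simp: places_at_def)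
  next
    case 2
    have sub: "fun_field (s, - t) \<subseteq> F"
      by (rule fun_field_least[OF F]) (auto intro: F_intros)
    let ?R = "preimage_place (s, t) (s, - t) R"
    have "?R \<in> places F"
      using preimage_place_places'[OF conj_relations sub R(1)] s by simp
    moreover have "reduces_to ?R s a" "reduces_to ?R t b"
      using specialize_fst[OF conj_relations] specialize_snd[OF conj_relations] sa
        reduces_to_minus[OF F R(1) ab'(2)] 2
      by (simp_all add: preimage_place_reduces_to[OF conj_relations F sub R(1)] s_F t_F)
    ultimately show ?thesis using that by (auto simp: places_at_def)
  qed
qed

section \<open>Orders of polynomials and functions regular on the affine part\<close>

lemma ord_at_inf_poly:
  "R \<in> places_inf \<Longrightarrow> p \<noteq> 0 \<Longrightarrow> ord_at R (pev p s) = - 2 * int (degree p)"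
  by (rule has_ord_ord_at[OF local_parameter_inf has_ord_inf_poly])

text \<open>Even and odd orders cannot cancel, so any term in t forces a pole of order at least
  three; a function with at most a double pole at infinity is free of t.\<close>

lemma ord_at_inf_le:
  assumes R: "R \<in> places_inf" and q: "q \<noteq> 0"
  shows "ord_at R (pev p s + pev q s * t) \<le> - 3"
    and "degree p \<le> degree q + 1 \<Longrightarrow> ord_at R (pev p s + pev q s * t) = - 3 - 2 * int (degree q)"
proof -
  have Q: "places_inf \<subseteq> places F" using places_inf_places by blast
  have nz: "s / t \<noteq> 0" using s_nz t_nz by simp
  note ho = F Q nz
  have qt: "has_ord places_inf (s / t) (- 2 * int (degree q) + - 3) (pev q s * t)"
    by (intro has_ord_mult[OF ho] has_ord_inf_poly has_ord_inf_t q)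
  note ord = has_ord_ord_at[OF local_parameter_inf _ R]
  have "ord_at R (pev p s + pev q s * t) \<le> - 3 \<and>
    (degree p \<le> degree q + 1 \<longrightarrow> ord_at R (pev p s + pev q s * t) = - 3 - 2 * int (degree q))"
  proof (cases "p = 0")
    case True
    then show ?thesis using ord[OF qt] by simp
  next
    case False
    note p = has_ord_inf_poly[OF False]
    show ?thesis
    proof (cases "degree p \<le> degree q + 1")
      case True
      have "has_ord places_inf (s / t) (- 2 * int (degree q) + - 3) (pev q s * t + pev p s)"
        by (rule has_ord_add[OF ho qt p]) (use True s_over_t_max_ideal in auto)
      then show ?thesis using ord by (fastforce simp: add.commute)
    next
      case False
      have "has_ord places_inf (s / t) (- 2 * int (degree p)) (pev p s + pev q s * t)"
        by (rule has_ord_add[OF ho p qt]) (use False s_over_t_max_ideal in auto)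
      then show ?thesis using ord[of "- 2 * int (degree p)"] False by auto
    qed
  qed
  then show "ord_at R (pev p s + pev q s * t) \<le> - 3"
    "degree p \<le> degree q + 1 \<Longrightarrow> ord_at R (pev p s + pev q s * t) = - 3 - 2 * int (degree q)" by auto
qed

lemma ord_at_linear:
  assumes b: "b\<^sup>2 = poly f a" and R: "R \<in> places_at a b"
  shows "ord_at R (s - const c) = (if c = a then if b = 0 then 2 else 1 else 0)"
proof -
  note RF = places_at_places[OF R]
  consider "c \<noteq> a" | "c = a" "b = 0" | "c = a" "b \<noteq> 0" by blast
  then show ?thesis
  proof cases
    case 1
    have "reduces_to R (s - const c) (a - c)"
      by (intro reduces_to_diff[OF F RF] places_at_s[OF R] reduces_to_const[OF F RF])
    then have "s - const c \<in> R - max_ideal R"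
      using 1 reduces_to_in[OF F RF] reduces_to_in_max_ideal_iff[OF F RF] by force
    then show ?thesis using 1 ord_at_unit[OF discrete[OF RF]] by simp
  next
    case 2
    then show ?thesis
      using has_ord_ord_at[OF local_parameter_two_torsion has_ord_two_torsion(1)] b R by auto
  next
    case 3
    then show ?thesis
      using ord_at_uniformizer[OF discrete[OF RF] local_parameter_uniformizer[OF local_parameter_generic[OF _ b] R]]
      by simp
  qed
qed

lemma ord_at_poly:
  assumes b: "b\<^sup>2 = poly f a" and R: "R \<in> places_at a b" and p: "p \<noteq> 0"
  shows "ord_at R (pev p s) = int (order a p) * (if b = 0 then 2 else 1)"
proof -
  note RF = places_at_places[OF R]
  obtain q where q: "p = [:-a, 1:] ^ order a p * q" "\<not> [:-a, 1:] dvd q"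
    using order_decomp[OF p] by blast
  have eq: "pev p s = (s - const a) ^ order a p * pev q s" by (subst q(1)) simp
  have nz: "s - const a \<noteq> 0" "q \<noteq> 0" using s q(2) by auto
  have "reduces_to R (pev q s) (poly q a)" by (rule reduces_to_pev[OF F RF places_at_s[OF R]])
  then have "pev q s \<in> R - max_ideal R"
    using q(2) reduces_to_in[OF F RF] reduces_to_in_max_ideal_iff[OF F RF] by (simp add: poly_eq_0_iff_dvd)
  then have "ord_at R (pev q s) = 0" by (rule ord_at_unit[OF discrete[OF RF]])
  moreover have "ord_at R ((s - const a) ^ order a p) = int (order a p) * (if b = 0 then 2 else 1)"
    using ord_at_power[OF discrete[OF RF] _ nz(1)] ord_at_linear[OF b R, of a] by (simp add: F_intros)
  ultimately show ?thesis
    unfolding eq using nz by (subst ord_at_mult[OF discrete[OF RF]]) (auto intro!: F_intros)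
qed

text \<open>This says that the affine coordinate ring is integrally closed. Roots of the denominator
  are divided out one by one, since both \<open>p\<close> and \<open>q\<close> must vanish at
  them.\<close>

lemma integral_at_affine:
  assumes w: "w \<in> F" and reg: "\<And>a b R. b\<^sup>2 = poly f a \<Longrightarrow> R \<in> places_at a b \<Longrightarrow> w \<in> R"
  obtains p q where "w = pev p s + pev q s * t"
proof -
  have "\<exists>p q. w = pev p s + pev q s * t"
    if "r \<noteq> 0" "w = (pev p s + pev q s * t) / pev r s" for p q r
    using that
  proof (induction "degree r" arbitrary: p q r)
    case 0
    then obtain c where c: "r = [:c:]" by (auto elim: degree_eq_zeroE)
    then have "w = pev (smult (inverse c) p) s + pev (smult (inverse c) q) s * t"
      using 0 by (simp add: field_simps)
    then show ?case by blast
  next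
    case (Suc n)
    then obtain a where "poly r a = 0" using alg_closed_imp_poly_has_root[of r] by auto
    then obtain r' where r': "r = [:-a, 1:] * r'" "r \<noteq> 0 \<Longrightarrow> degree r = Suc (degree r')"
      using poly_root_factor by metis
    obtain b where b: "b\<^sup>2 = poly f a" using nth_root_exists[of 2 "poly f a"] by auto
    have wr: "w * pev r s = pev p s + pev q s * t" using Suc.prems by simp
    have van: "poly p a + poly q a * c = 0" if c: "c\<^sup>2 = poly f a" for c
    proof -
      obtain R where R: "R \<in> places_at a c" using places_at_exists[OF c] .
      note P = F places_at_places[OF R]
      have "reduces_to R (pev r s) (poly r a)" by (rule reduces_to_pev[OF P places_at_s[OF R]])
      then have "pev r s \<in> max_ideal R" using \<open>poly r a = 0\<close> reduces_to_0[OF P] by simp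
      then have "pev p s + pev q s * t \<in> max_ideal R"
        unfolding wr[symmetric] by (rule max_ideal_mult'[OF P reg[OF c R]])
      moreover have "reduces_to R (pev p s + pev q s * t) (poly p a + poly q a * c)"
        by (intro reduces_to_add[OF P] reduces_to_mult[OF P] reduces_to_pev[OF P] places_at_s[OF R] places_at_t[OF R])
      ultimately show ?thesis using reduces_to_in_max_ideal_iff[OF P] by blast
    qed
    have "2 * poly p a = (poly p a + poly q a * b) + (poly p a + poly q a * (- b))" by simp
    then have pa: "poly p a = 0" using van[OF b] van[of "- b"] b two by auto
    \<comment> \<open>For b = 0 the two evaluations coincide and say nothing about \<open>q\<close>.
      Writing s - a as t^2 / g(s) makes p(s) and r(s) divisible by t^2; cancelling one t shows that
      q(s) is t times a regular function.\<close>
    have qa: "poly q a = 0"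
    proof (cases "b = 0")
      case False
      then show ?thesis using van[OF b] pa by simp
    next
      case True
      then have fa: "poly f a = 0" using b by simp
      obtain R where R: "R \<in> places_at a 0" using places_at_exists[of 0 a] fa by auto
      note P = F places_at_places[OF R]
      obtain p' where p': "p = [:-a, 1:] * p'" using poly_root_factor[OF pa] by metis
      obtain g where g: "s - const a = t\<^sup>2 / pev g s" "poly g a \<noteq> 0" using s_minus_root[OF fa] .
      have gR: "reduces_to R (inverse (pev g s)) (inverse (poly g a))"
        by (intro reduces_to_inverse[OF P] reduces_to_pev[OF P] places_at_s[OF R] g)
      have polR: "pev h s \<in> R" for h
        using reduces_to_in[OF P reduces_to_pev[OF P places_at_s[OF R]]] .
      have tM: "t \<in> max_ideal R" using places_at_t[OF R] reduces_to_0[OF P] by simp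
      have gnz: "pev g s \<noteq> 0" using g by auto
      have lin: "pev [:-a, 1:] s = t * (t * inverse (pev g s))"
        using g(1) by (simp add: power2_eq_square divide_inverse)
      have ps: "pev p s = t * (t * (inverse (pev g s) * pev p' s))"
        unfolding p' pev_mult lin by (simp only: mult.assoc)
      have rs: "pev r s = t * (t * (inverse (pev g s) * pev r' s))"
        unfolding r'(1) pev_mult lin by (simp only: mult.assoc)
      have "t * pev q s = t * (t * (w * (inverse (pev g s) * pev r' s) - inverse (pev g s) * pev p' s))"
        using wr unfolding ps rs by (simp add: algebra_simps)
      then have "pev q s = t * (w * (inverse (pev g s) * pev r' s) - inverse (pev g s) * pev p' s)"
        using t_nz by simp
      moreover have "w * (inverse (pev g s) * pev r' s) - inverse (pev g s) * pev p' s \<in> R"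
        using reg[OF _ R] fa reduces_to_in[OF P gR] polR
        by (auto intro!: place_diff[OF P] place_mult[OF P])
      ultimately have "pev q s \<in> max_ideal R" using max_ideal_mult[OF P tM] by simp
      then show ?thesis
        using reduces_to_in_max_ideal_iff[OF P reduces_to_pev[OF P places_at_s[OF R]]] by blast
    qed
    obtain p' q' where p': "p = [:-a, 1:] * p'" and q': "q = [:-a, 1:] * q'"
      using poly_root_factor[OF pa] poly_root_factor[OF qa] by metis
    have "s - const a \<noteq> 0" using s by auto
    have num: "pev p s + pev q s * t = (s - const a) * (pev p' s + pev q' s * t)"
      unfolding p' q' pev_mult by (simp add: algebra_simps)
    have den: "pev r s = (s - const a) * pev r' s"
      unfolding r'(1) pev_mult by simp
    have "w = (pev p' s + pev q' s * t) / pev r' s"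
      unfolding Suc.prems(2) num den using \<open>s - const a \<noteq> 0\<close> by simp
    moreover have "r' \<noteq> 0" using Suc.prems(1) r'(1) by auto
    ultimately show ?case using Suc.hyps(1)[of r' p' q'] Suc.hyps(2) Suc.prems(1) r'(2) by simp
  qed
  then show ?thesis using normal_form[OF w] that by metis
qed

lemma places_inf_at_disjoint: "R \<in> places_inf \<Longrightarrow> R \<notin> places_at a b"
  using places_inf_s reduces_to_in[OF F places_at_places places_at_s] by blast

lemma places_at_eq_iff:
  assumes b: "b\<^sup>2 = poly f a" and R: "R \<in> places_at a b" and S: "S \<in> places_at e c"
  shows "S = R \<longleftrightarrow> e = a \<and> c = b"
proof
  assume eq: "S = R"
  note P = F places_at_places[OF R]
  show "e = a \<and> c = b"
    using reduces_to_unique[OF P places_at_s[OF S[unfolded eq]] places_at_s[OF R]]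
      reduces_to_unique[OF P places_at_t[OF S[unfolded eq]] places_at_t[OF R]] by simp
next
  assume "e = a \<and> c = b"
  then show "S = R" using places_at_unique[OF b] R S by simp
qed

text \<open>A function of s alone has even order at infinity and where b = 0. Elsewhere (a, b) and
  (a, -b) are distinct points with the same order.\<close>

lemma odd_ord_other_place:
  assumes R: "R \<in> places F" and z: "z = pev p s / pev r s" "p \<noteq> 0" "r \<noteq> 0" and odd: "odd (ord_at R z)"
  obtains R' where "R' \<in> places F" "R' \<noteq> R" "ord_at R' z = ord_at R z"
  using R
proof (rule place_cases)
  assume "R \<in> places_inf"
  then have "ord_at R z = 2 * (int (degree r) - int (degree p))"
    unfolding z(1) using z by (subst ord_at_divide[OF discrete[OF R]]) (simp_all add: pev_F ord_at_inf_poly)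
  then show ?thesis using odd by simp
next
  fix a b assume b: "b\<^sup>2 = poly f a" and Rab: "R \<in> places_at a b"
  have ord: "ord_at S z = (int (order a p) - int (order a r)) * (if c = 0 then 2 else 1)"
    if c: "c\<^sup>2 = poly f a" and S: "S \<in> places_at a c" for S c
    unfolding z(1) using z
    by (subst ord_at_divide[OF discrete[OF places_at_places[OF S]]])
      (simp_all add: pev_F ord_at_poly[OF c S])
  have "b \<noteq> 0" using odd ord[OF b Rab] by auto
  have b': "(- b)\<^sup>2 = poly f a" using b by simp
  obtain R' where R': "R' \<in> places_at a (- b)" using places_at_exists[OF b'] .
  have "R' \<noteq> R"
  proof
    assume "R' = R"
    then have "reduces_to R t (- b)" using places_at_t[OF R'] by simp
    then have "b = - b" by (rule reduces_to_unique[OF F R places_at_t[OF Rab]])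
    then have "b + b = b + - b" by (rule arg_cong)
    then have "2 * b = 0" by simp
    then show False using two \<open>b \<noteq> 0\<close> by simp
  qed
  moreover have "ord_at R' z = ord_at R z" using ord[OF b Rab] ord[OF b' R'] by simp
  ultimately show ?thesis using that places_at_places[OF R'] by blast
qed

lemma no_degree_one:
  assumes R: "R \<in> places F" and R': "R' \<in> places F" and z: "z \<in> F" "z \<noteq> 0"
    and div: "\<And>S. S \<in> places F \<Longrightarrow> ord_at S z = of_bool (S = R) - of_bool (S = R')"
  shows "R = R'"
proof (rule ccontr)
  assume "R \<noteq> R'"
  have inf_const: "q = 0" if "S \<in> places_inf" "ord_at S (pev p s + pev q s * t) > - 3" for S p q
    using ord_at_inf_le(1)[OF that(1), of q p] that(2) by auto
  have "\<exists>p r. p \<noteq> 0 \<and> r \<noteq> 0 \<and> z = pev p s / pev r s"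
    using R'
  proof (rule place_cases)
    assume inf: "R' \<in> places_inf"
    have "z \<in> S" if "b\<^sup>2 = poly f a" "S \<in> places_at a b" for a b S
    proof -
      have "S \<noteq> R'" using inf that(2) places_inf_at_disjoint by blast
      then have "ord_at S z \<ge> 0" using div[OF places_at_places[OF that(2)]] by simp
      then show ?thesis using ord_at_nonneg_iff[OF discrete[OF places_at_places[OF that(2)]] z] by simp
    qed
    then obtain p q where pq: "z = pev p s + pev q s * t" using integral_at_affine[OF z(1)] by metis
    have "q = 0" using inf_const[OF inf, of p q] div[OF R'] \<open>R \<noteq> R'\<close> pq by auto
    then show ?thesis using pq z(2) by (intro exI[of _ p] exI[of _ 1]) auto
  next
    fix a b assume b: "b\<^sup>2 = poly f a" and Rab: "R' \<in> places_at a b"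
    \<comment> \<open>The factor clears the pole at \<open>R'\<close> and costs at most a double
      pole at infinity, short of the order -3 that a term in t would force.\<close>
    let ?w = "z * (s - const a)"
    have nz: "s - const a \<noteq> 0" using s by auto
    have sF: "s - const a \<in> F" by (intro F_intros)
    have w: "?w \<in> F" "?w \<noteq> 0" using z nz sF by (auto intro: F_intros)
    have ordw: "ord_at S ?w = of_bool (S = R) - of_bool (S = R') + ord_at S (s - const a)" if "S \<in> places F" for S
      using ord_at_mult[OF discrete[OF that] z(1) sF z(2) nz] div[OF that] by simp
    have "?w \<in> S" if c: "c\<^sup>2 = poly f e" and S: "S \<in> places_at e c" for e c S
    proof -
      note SF = places_at_places[OF S]
      have "s - const a \<in> S" using reduces_to_in[OF F SF places_at_s[OF S]] place_diff[OF F SF _ place_const[OF F SF]] by blast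
      then have "ord_at S (s - const a) \<ge> 0" using ord_at_nonneg_iff[OF discrete[OF SF] sF nz] by simp
      moreover have "ord_at S (s - const a) > 0" if "S = R'"
        using ord_at_pos_iff[OF discrete[OF SF] sF nz] places_at_s[OF Rab] that by (simp add: reduces_to_def)
      ultimately have "ord_at S ?w \<ge> 0" using ordw[OF SF] by (cases "S = R'") auto
      then show ?thesis using ord_at_nonneg_iff[OF discrete[OF SF] w] by simp
    qed
    then obtain p q where pq: "?w = pev p s + pev q s * t" using integral_at_affine[OF w(1)] by metis
    obtain Z where Z: "Z \<in> places_inf" using places_inf_exists .
    have "Z \<noteq> R'" using Rab Z places_inf_at_disjoint by blast
    moreover have "ord_at Z (s - const a) = - 2" using ord_at_inf_poly[OF Z, of "[:-a, 1:]"] by simp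
    ultimately have "ord_at Z ?w > - 3" using ordw[OF places_inf_places[OF Z]] by simp
    then have "q = 0" using inf_const[OF Z] pq by simp
    then have "?w = pev p s" using pq by simp
    then have "z = pev p s / pev [:-a, 1:] s" using nz by (simp add: field_simps)
    moreover have "p \<noteq> 0" using \<open>?w = pev p s\<close> w(2) by auto
    ultimately show ?thesis by (intro exI[of _ p] exI[of _ "[:-a, 1:]"]) auto
  qed
  then obtain p r where pr: "z = pev p s / pev r s" "p \<noteq> 0" "r \<noteq> 0" by blast
  \<comment> \<open>The simple zero at \<open>R\<close> is odd, so it recurs at another place; but
    the given divisor has no other zero.\<close>
  have "ord_at R z = 1" using div[OF R] \<open>R \<noteq> R'\<close> by simp
  then obtain S where "S \<in> places F" "S \<noteq> R" "ord_at S z = 1"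
    using odd_ord_other_place[OF R pr] by auto
  then show False using div[of S] by (cases "S = R'") auto
qed

section \<open>Divisors of vertical and tangent lines, and addition of points\<close>

lemma divisor_two_torsion:
  assumes a: "poly f a = 0" and P: "P \<in> places_at a 0" and Z: "Z \<in> places_inf" and S: "S \<in> places F"
  shows "ord_at S (s - const a) = 2 * of_bool (S = P) - 2 * of_bool (S = Z)"
  using S
proof (rule place_cases)
  assume inf: "S \<in> places_inf"
  then have "S = Z" "S \<noteq> P" using places_inf_unique Z P places_inf_at_disjoint by blast+
  then show ?thesis using ord_at_inf_poly[OF inf, of "[:-a, 1:]"] by simp
next
  fix c e assume c: "c\<^sup>2 = poly f e" and Sc: "S \<in> places_at e c"
  have "S \<noteq> Z" using Z Sc places_inf_at_disjoint by blast
  moreover have "S = P \<longleftrightarrow> e = a \<and> c = 0"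
    using places_at_eq_iff[OF _ P Sc] a by simp
  moreover have "e = a \<Longrightarrow> c = 0" using c a by simp
  ultimately show ?thesis using ord_at_linear[OF c Sc, of a] by auto
qed

text \<open>The line times its conjugate is c (s - a)^2 (s - e), so their joint order is known and
  has only to be distributed at each affine place. Division by s - e cancels the third intersection
  point and leaves its reflection \<open>R\<close> as a pole.\<close>

lemma divisor_tangent:
  fixes l :: "'k alg_closure poly"
  assumes l: "degree l \<le> 1" "poly l a \<noteq> 0"
    and tangent: "f - l * l = smult c ([:-a, 1:] * [:-a, 1:] * [:-e, 1:])" "c \<noteq> 0"
    and P: "P \<in> places_at a (poly l a)" and R: "R \<in> places_at e (- poly l e)"
    and Z: "Z \<in> places_inf" and S: "S \<in> places F"
  shows "ord_at S ((t - pev l s) / (s - const e)) = 2 * of_bool (S = P) - of_bool (S = R) - of_bool (S = Z)"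
proof -
  let ?L = "t - pev l s" and ?L' = "t + pev l s"
  note D = discrete[OF S]
  have LF: "?L \<in> F" "?L' \<in> F" and lin: "s - const x \<in> F" for x by (auto intro!: F_intros)
  have nz: "?L \<noteq> 0" "?L' \<noteq> 0" using independent[of "- l" 1] independent[of l 1] by (auto simp: algebra_simps)
  have sx: "s - const x \<noteq> 0" for x using s by auto
  have "?L * ?L' = pev (f - l * l) s"
    by (simp flip: t_sq) (simp add: power2_eq_square algebra_simps)
  also have "\<dots> = const c * ((s - const a) * (s - const a) * (s - const e))"
    unfolding tangent(1) pev_smult pev_mult by simp
  finally have norm: "?L * ?L' = const c * ((s - const a) * (s - const a) * (s - const e))" .
  have "const c \<in> S - max_ideal S"
    using tangent(2) place_const[OF F S] const_in_max_ideal_iff[OF F S] by simp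
  then have "ord_at S (const c) = 0" by (rule ord_at_unit[OF D])
  then have ordL: "ord_at S ?L + ord_at S ?L' = 2 * ord_at S (s - const a) + ord_at S (s - const e)"
    using arg_cong[OF norm, of "ord_at S"] tangent(2) LF nz lin sx
    by (simp add: ord_at_mult[OF D] F_intros)
  have fl: "poly f x = (poly l x)\<^sup>2" if "x = a \<or> x = e" for x
  proof -
    have "poly (f - l * l) x = 0"
      unfolding tangent(1) poly_smult poly_mult using that by auto
    then show ?thesis by (simp add: power2_eq_square)
  qed
  have goal: "ord_at S (?L / (s - const e)) = ord_at S ?L - ord_at S (s - const e)"
    by (rule ord_at_divide[OF D LF(1) lin nz(1) sx])
  show ?thesis
    using S
  proof (rule place_cases)
    assume inf: "S \<in> places_inf"
    then have "S = Z" "S \<noteq> P" "S \<noteq> R" using places_inf_unique Z P R places_inf_at_disjoint by blast+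
    moreover have "ord_at S (pev (- l) s + pev 1 s * t) = - 3"
      using ord_at_inf_le(2)[OF inf, of 1 "- l"] l(1) by simp
    moreover have "ord_at S (s - const e) = - 2" using ord_at_inf_poly[OF inf, of "[:-e, 1:]"] by simp
    ultimately show ?thesis unfolding goal by simp
  next
    fix x y assume y: "y\<^sup>2 = poly f x" and Sxy: "S \<in> places_at x y"
    have "S \<noteq> Z" using Z Sxy places_inf_at_disjoint by blast
    have SP: "S = P \<longleftrightarrow> x = a \<and> y = poly l a"
      using places_at_eq_iff[OF _ P Sxy] fl[of a] by simp
    have fe: "(- poly l e)\<^sup>2 = poly f e" using fl[of e] by simp
    have SR: "S = R \<longleftrightarrow> x = e \<and> y = - poly l e"
      by (rule places_at_eq_iff[OF fe R Sxy])
    have lR: "reduces_to S (pev l s) (poly l x)" by (rule reduces_to_pev[OF F S places_at_s[OF Sxy]])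
    have LR: "reduces_to S ?L (y - poly l x)" "reduces_to S ?L' (y + poly l x)"
      using places_at_t[OF Sxy] lR by (auto intro: reduces_to_diff[OF F S] reduces_to_add[OF F S])
    have unit: "ord_at S z = 0" if "reduces_to S z v" "v \<noteq> 0" for z v
      using that reduces_to_in[OF F S] reduces_to_in_max_ideal_iff[OF F S]
      by (intro ord_at_unit[OF D]) auto
    note lo = ord_at_linear[OF y Sxy]
    \<comment> \<open>Off the line \<open>?L\<close> is a unit. On it with nonzero y,
      \<open>?L'\<close> is a unit and \<open>?L\<close> carries the whole order. At a point of
      order two on the line both vanish, and the joint order 2 can only split as 1 + 1.\<close>
    consider (1) "y \<noteq> poly l x" | (2) "y = poly l x" "y \<noteq> 0" | (3) "y = 0" "poly l x = 0" by blast
    then show ?thesis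
    proof cases
      case 1
      then have "ord_at S ?L = 0" using unit[OF LR(1)] by simp
      moreover have "\<not> S = P" using 1 SP by auto
      moreover have "x = e \<Longrightarrow> y = - poly l e \<and> y \<noteq> 0"
        using 1 y fl[of e] by (auto simp: power2_eq_iff)
      ultimately show ?thesis unfolding goal using \<open>S \<noteq> Z\<close> SR lo[of e] by auto
    next
      case 2
      then have "y + poly l x = 2 * y" by simp
      then have "ord_at S ?L' = 0" using unit[OF LR(2)] 2 two by simp
      moreover have "\<not> S = R"
      proof
        assume "S = R"
        then have "2 * y = 0" using SR 2 by (metis \<open>y + poly l x = 2 * y\<close> add.left_inverse)
        then show False using two 2 by simp
      qed
      moreover have "S = P \<longleftrightarrow> x = a" using SP 2 by auto
      ultimately show ?thesis unfolding goal using \<open>S \<noteq> Z\<close> lo[of a] ordL 2 by auto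
    next
      case 3
      have "x \<noteq> a" using 3 l(2) by auto
      have "poly f x = 0" using y 3 by simp
      then have "poly (f - l * l) x = 0" using 3 by simp
      then have "x = e" unfolding tangent(1) poly_smult poly_mult using \<open>x \<noteq> a\<close> tangent(2) by auto
      have "ord_at S ?L > 0" "ord_at S ?L' > 0"
        using LR 3 ord_at_pos_iff[OF D] LF nz by (simp_all add: reduces_to_def)
      moreover have "ord_at S (s - const a) = 0" "ord_at S (s - const e) = 2"
        using lo[of a] lo[of e] 3 \<open>x \<noteq> a\<close> \<open>x = e\<close> by auto
      moreover have "S = R" "S \<noteq> P" using SP SR 3 \<open>x \<noteq> a\<close> \<open>x = e\<close> by auto
      ultimately show ?thesis unfolding goal using \<open>S \<noteq> Z\<close> ordL by simp
    qed
  qed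
qed

text \<open>For uniqueness, the quotient of the functions belonging to two candidates has divisor
  (R') - (R), and \<open>no_degree_one\<close> applies.\<close>

lemma add_points_eqI:
  assumes C: "function_field C = F" "points C = places F" and Z: "origin C \<in> places F"
    and R: "R \<in> places F" and z: "z \<in> F" "z \<noteq> 0"
    and div: "\<And>S. S \<in> places F \<Longrightarrow>
      of_bool (S = P) + of_bool (S = Q) - (of_bool (S = R) + of_bool (S = origin C)) = ord_at S z"
  shows "add_points C P Q = R"
  unfolding add_points_def
proof (rule the_equality)
  show "R \<in> points C \<and> lin_equiv C (\<lambda>S. pt_divisor P S + pt_divisor Q S) (\<lambda>S. pt_divisor R S + pt_divisor (origin C) S)"
    unfolding C lin_equiv_def pt_divisor_def using R z div by blast
  fix R'
  assume "R' \<in> points C \<and> lin_equiv C (\<lambda>S. pt_divisor P S + pt_divisor Q S) (\<lambda>S. pt_divisor R' S + pt_divisor (origin C) S)"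
  then obtain z' where R': "R' \<in> places F" and z': "z' \<in> F" "z' \<noteq> 0"
    and div': "\<And>S. S \<in> places F \<Longrightarrow>
      of_bool (S = P) + of_bool (S = Q) - (of_bool (S = R') + of_bool (S = origin C)) = ord_at S z'"
    unfolding C lin_equiv_def pt_divisor_def by blast
  have "ord_at S (z / z') = of_bool (S = R') - of_bool (S = R)" if "S \<in> places F" for S
    using ord_at_divide[OF discrete[OF that] z(1) z'(1) z(2) z'(2)] div[OF that] div'[OF that] by simp
  then show "R' = R"
    using no_degree_one[OF R' R, of "z / z'"] z z' by (simp add: F_intros)
qed

end

section \<open>Generic points of curves quadratic in Y\<close>

lemma generic_fst_nonconstant: "to_ac (Fract [:0, 1:] 1) \<notin> range const"
  by (auto simp: const_def eq_fract)

text \<open>The ambient field is algebraically closed and so contains a square root of - A / B;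
  hence the choice in \<open>generic_point\<close> picks an actual root.\<close>

lemma generic_point_quadratic:
  assumes "equation C = [:A, 0, B:]" and B: "map_poly to_ac B \<noteq> 0"
  shows "fst (generic_point C) \<notin> range const"
    and "pev (map_poly to_ac A) (fst (generic_point C))
      + pev (map_poly to_ac B) (fst (generic_point C)) * (snd (generic_point C))\<^sup>2 = 0"
proof -
  let ?x = "to_ac (Fract [:0, 1:] 1)" and ?A = "map_poly to_ac A" and ?B = "map_poly to_ac B"
  have x: "?x \<notin> range const" by (rule generic_fst_nonconstant)
  then have B0: "pev ?B ?x \<noteq> 0" using B pev_eq_0_iff by blast
  have eval: "eval2 (lift2 (equation C)) (?x, y) = pev ?A ?x + pev ?B ?x * y\<^sup>2" for y
    by (simp add: assms(1) power2_eq_square algebra_simps)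
  obtain y where "y ^ 2 = - pev ?A ?x / pev ?B ?x"
    using nth_root_exists[of 2] by (metis zero_less_numeral)
  then have "eval2 (lift2 (equation C)) (?x, y) = 0" unfolding eval using B0 by simp
  then have "eval2 (lift2 (equation C)) (?x, snd (generic_point C)) = 0"
    unfolding generic_point_def Let_def snd_conv by (rule someI)
  moreover have fst: "fst (generic_point C) = ?x" by (simp add: generic_point_def Let_def)
  ultimately show "pev ?A (fst (generic_point C)) + pev ?B (fst (generic_point C)) * (snd (generic_point C))\<^sup>2 = 0"
    by (simp add: eval)
  show "fst (generic_point C) \<notin> range const" using x fst by simp
qed

subsection \<open>The Edwards and Legendre curves\<close>

locale edwards_legendre =
  fixes d :: "'k::field"
  assumes char: "CHAR('k) \<noteq> 2" and d0: "d \<noteq> 0" and d1: "d \<noteq> 1"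
begin

definition D :: "'k alg_closure" where "D = to_ac d"
abbreviation c :: "'k ambient" where "c \<equiv> const D"

definition x where "x = fst (generic_point (edwards d))"
definition y where "y = snd (generic_point (edwards d))"
definition u where "u = fst (generic_point (legendre d))"
definition v where "v = snd (generic_point (legendre d))"

lemma gpE: "generic_point (edwards d) = (x, y)" and gpL: "generic_point (legendre d) = (u, v)"
  by (simp_all add: x_def y_def u_def v_def)

lemma D0: "D \<noteq> 0" and D1: "D \<noteq> 1"
  using d0 d1 to_ac_eq_iff[of d 1] by (auto simp: D_def simp del: to_ac_eq_iff)

lemma two: "(2::'k alg_closure) \<noteq> 0"
proof
  assume "(2::'k alg_closure) = 0"
  then have "of_nat 2 = (0::'k alg_closure)" by simp
  then have "CHAR('k) dvd 2" by (simp only: of_nat_eq_0_iff_char_dvd CHAR_alg_closure)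
  moreover have "CHAR('k) \<noteq> 1" by simp
  ultimately show False using char dvd_imp_le[of "CHAR('k)" 2] by (metis One_nat_def prime_nat_iff two_is_prime_nat)
qed

lemma four: "(4::'k alg_closure) \<noteq> 0"
  using two by (metis mult_2_right mult_eq_0_iff numeral_Bit0)

lemma two': "(2::'k ambient) \<noteq> 0" and four': "(4::'k ambient) \<noteq> 0"
  using two four const_eq_0_iff[of "2 :: 'k alg_closure"] const_eq_0_iff[of "4 :: 'k alg_closure"] by simp_all

lemma c0: "c \<noteq> 0" and c1: "c \<noteq> 1" "1 - c \<noteq> 0"
  using D0 D1 const_eq_iff[of D 1] by auto

abbreviation AE :: "'k alg_closure poly" where "AE \<equiv> [:-1, 0, 1:]"
abbreviation BE :: "'k alg_closure poly" where "BE \<equiv> [:1, 0, -D:]"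
definition fL :: "'k alg_closure poly" where "fL = [:0, D, - (1 + D), 1:]"
text \<open>The cubic of the overview: (1 - D) (s^3 + A s^2 + s) with the Montgomery coefficient A =
  2 (1 + D) / (1 - D).\<close>

definition fE :: "'k alg_closure poly" where "fE = [:0, 1 - D, 2 * (1 + D), 1 - D:]"

lemma x_nonconst: "x \<notin> range const" and xy_rel: "pev AE x + pev BE x * y\<^sup>2 = 0"
proof -
  have eq: "equation (edwards d) = [:[:-1, 0, 1:], 0, [:1, 0, -d:]:]" by (simp add: edwards_def)
  have B: "map_poly to_ac [:1, 0, -d:] = BE" and A: "map_poly to_ac [:-1, 0, 1:] = AE"
    by (simp_all add: map_poly_pCons D_def)
  have "BE \<noteq> 0" by simp
  then show "x \<notin> range const" "pev AE x + pev BE x * y\<^sup>2 = 0"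
    using generic_point_quadratic[OF eq] unfolding x_def y_def A B by blast+
qed

lemma edwards_rel: "x\<^sup>2 + y\<^sup>2 = 1 + c * x\<^sup>2 * y\<^sup>2"
  using xy_rel by (simp add: power2_eq_square algebra_simps)

lemma u_nonconst: "u \<notin> range const" and uv_rel: "pev (- fL) u + pev 1 u * v\<^sup>2 = 0"
proof -
  have eq: "equation (legendre d) = [: - ([:0, 1:] * [:-1, 1:] * [:-d, 1:]), 0, 1 :]" by (simp add: legendre_def)
  have B: "map_poly to_ac 1 = 1" by simp
  have A: "map_poly to_ac (- ([:0, 1:] * [:-1, 1:] * [:-d, 1:])) = - fL"
    by (simp add: map_poly_pCons D_def fL_def)
  have "(1::'k alg_closure poly) \<noteq> 0" by simp
  then show "u \<notin> range const" "pev (- fL) u + pev 1 u * v\<^sup>2 = 0"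
    using generic_point_quadratic[OF eq] unfolding u_def v_def A B by blast+
qed

lemma legendre_rel: "v\<^sup>2 = pev fL u"
  using uv_rel by simp

lemma pev_fL: "pev fL z = z * (z - 1) * (z - c)"
  by (simp add: fL_def algebra_simps)

lemma cubic_L: "cubic_pair fL u v"
proof
  show "poly (pderiv fL) a \<noteq> 0" if "poly fL a = 0" for a
  proof -
    have "a * (a - 1) * (a - D) = 0" using that by (simp add: fL_def algebra_simps)
    then consider "a = 0" | "a = 1" | "a = D" by auto
    then show ?thesis
      by cases (use D0 D1 in \<open>simp_all add: fL_def pderiv_pCons algebra_simps\<close>)
  qed
qed (use two u_nonconst legendre_rel in \<open>simp_all add: fL_def\<close>)

sublocale L: cubic_pair fL u v by (rule cubic_L)

text \<open>Every nonconstant point on the Edwards equation is generic. The required odd order is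
  the simple zero of (X^2 - 1)(1 - D X^2) at 1, which needs 2 nonzero and D different from
  1.\<close>

lemma relations_E:
  assumes "x1 \<notin> range const" "x1\<^sup>2 + y1\<^sup>2 = 1 + c * x1\<^sup>2 * y1\<^sup>2"
  shows "same_relations (x, y) (x1, y1)"
proof (rule same_relations_quadratic[OF x_nonconst xy_rel assms(1)])
  show "pev AE x1 + pev BE x1 * y1\<^sup>2 = 0"
    using assms(2) by (simp add: power2_eq_square algebra_simps)
  show "AE * BE \<noteq> 0" by simp
  have "order 1 (AE * BE) = 1"
    by (rule order_simple_root[of _ _ "[:1, 1:] * BE"]) (use two D1 in simp_all)
  then show "odd (order 1 (AE * BE))" by simp
qed

lemma relations_L:
  assumes "u1 \<notin> range const" "v1\<^sup>2 = u1 * (u1 - 1) * (u1 - c)"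
  shows "same_relations (u, v) (u1, v1)"
proof (rule same_relations_quadratic[OF u_nonconst uv_rel assms(1)])
  show "pev (- fL) u1 + pev 1 u1 * v1\<^sup>2 = 0" using assms(2) by (simp add: pev_fL)
  show "- fL * 1 \<noteq> 0" by (simp add: fL_def)
  have "order 0 (- fL * 1) = 1"
    by (rule order_simple_root[of _ _ "[:- D, 1 + D, -1:]"]) (use D0 in \<open>simp_all add: fL_def\<close>)
  then show "odd (order 0 (- fL * 1))" by simp
qed

lemma nonconst_nz: "z \<notin> range const \<Longrightarrow> z \<noteq> const a"
  by blast

lemma x_nz: "x \<noteq> 0" using nonconst_nz[OF x_nonconst, of 0] by simp

text \<open>For constant y = e the curve equation becomes a polynomial relation for x; its
  coefficients e^2 - 1 and 1 - D e^2 vanish together only if D = 1.\<close>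

lemma y_nonconst: "y \<notin> range const"
proof
  assume "y \<in> range const"
  then obtain e where e: "y = const e" by blast
  then have "pev [:e\<^sup>2 - 1, 0, 1 - D * e\<^sup>2:] x = 0"
    using edwards_rel by (simp add: power2_eq_square algebra_simps)
  then have "[:e\<^sup>2 - 1, 0, 1 - D * e\<^sup>2:] = 0" using pev_eq_0_iff[OF x_nonconst] by blast
  then have e2: "e\<^sup>2 - 1 = 0" and De2: "1 - D * e\<^sup>2 = 0" unfolding pCons_eq_0_iff by blast+
  have "e\<^sup>2 = 1" using e2 by simp
  then show False using De2 D1 by simp
qed

lemma y_nz: "1 - y \<noteq> 0" "1 + y \<noteq> 0"
  using nonconst_nz[OF y_nonconst, of 1] nonconst_nz[OF y_nonconst, of "-1"]
  by (auto simp: add_eq_0_iff)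

section \<open>From the Edwards curve to the Montgomery cubic\<close>

definition s where "s = (1 + y) / (1 - y)"
definition t where "t = 2 * s / x"

lemma s_y: "s * (1 - y) = 1 + y" using y_nz by (simp add: s_def)

lemma s1_nz: "s + 1 \<noteq> 0"
proof
  assume "s + 1 = 0"
  then have "s = - 1" by (simp add: add_eq_0_iff2)
  then have "2 = (0::'k ambient)" using s_y by (simp add: algebra_simps)
  then show False using two' by simp
qed

lemma y_s: "y = (s - 1) / (s + 1)"
  using s_y s1_nz by (simp add: field_simps)

lemma s_nonconst: "s \<notin> range const"
proof
  assume "s \<in> range const"
  then obtain e where e: "s = const e" by blast
  then have "y = const ((e - 1) / (e + 1))" using y_s by simp
  then show False using y_nonconst by blast
qed

lemma s_nz: "s \<noteq> 0" using nonconst_nz[OF s_nonconst, of 0] by simp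

lemma t_nz: "t \<noteq> 0" using s_nz x_nz two' by (simp add: t_def)

lemma x_st: "x = 2 * s / t" using s_nz x_nz two' by (simp add: t_def)

lemma t_sq: "t\<^sup>2 = pev fE s"
proof -
  \<comment> \<open>Multiplying the curve equation by (s + 1)^2 clears the denominator of y = (s -
    1) / (s + 1) and leaves x^2 ((s + 1)^2 - c (s - 1)^2) = 4 s.\<close>
  have sq: "(s + 1)\<^sup>2 * y\<^sup>2 = (s - 1)\<^sup>2" using y_s s1_nz by (simp add: power_divide)
  have "(s + 1)\<^sup>2 * (x\<^sup>2 + y\<^sup>2 - 1 - c * x\<^sup>2 * y\<^sup>2) = 0" using edwards_rel by simp
  moreover have "(s + 1)\<^sup>2 * (x\<^sup>2 + y\<^sup>2 - 1 - c * x\<^sup>2 * y\<^sup>2)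
    = x\<^sup>2 * ((s + 1)\<^sup>2 - c * ((s + 1)\<^sup>2 * y\<^sup>2)) + ((s + 1)\<^sup>2 * y\<^sup>2) - (s + 1)\<^sup>2"
    by (simp add: algebra_simps)
  ultimately have "x\<^sup>2 * ((s + 1)\<^sup>2 - c * (s - 1)\<^sup>2) = 4 * s"
    unfolding sq by (simp add: power2_eq_square algebra_simps)
  moreover have "pev fE s = s * ((s + 1)\<^sup>2 - c * (s - 1)\<^sup>2)"
    by (simp add: fE_def power2_eq_square algebra_simps)
  ultimately have "x\<^sup>2 * pev fE s = 4 * s\<^sup>2"
    by (simp add: power2_eq_square mult.left_commute)
  then show ?thesis using x_nz by (simp add: t_def power_divide power_mult_distrib field_simps)
qed

lemma poly_fE: "poly fE a = a * ((1 - D) * a\<^sup>2 + 2 * (1 + D) * a + (1 - D))"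
  by (simp add: fE_def power2_eq_square algebra_simps)

lemma cubic_E: "cubic_pair fE s t"
proof
  show "poly (pderiv fE) a \<noteq> 0" if "poly fE a = 0" for a
  proof (cases "a = 0")
    case True
    then show ?thesis using D1 by (simp add: fE_def pderiv_pCons)
  next
    case False
    let ?q = "(1 - D) * a\<^sup>2 + 2 * (1 + D) * a + (1 - D)"
    have q: "?q = 0" using that False by (simp add: poly_fE)
    have p': "poly (pderiv fE) a = 2 * a * ((1 - D) * a + (1 + D)) + ?q"
      by (simp add: fE_def pderiv_pCons power2_eq_square algebra_simps)
    \<comment> \<open>Completing the square: 4 D is a quarter of the discriminant of the quadratic
      factor, so that factor has no double root.\<close>
    have "(1 - D) * ?q = ((1 - D) * a + (1 + D))\<^sup>2 - 4 * D"
      by (simp add: power2_eq_square algebra_simps)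
    then have "((1 - D) * a + (1 + D))\<^sup>2 = 4 * D" unfolding q by simp
    then have "(1 - D) * a + (1 + D) \<noteq> 0" using four D0 by auto
    then show ?thesis unfolding p' q using False two by simp
  qed
qed (use two D1 s_nonconst t_sq in \<open>simp_all add: fE_def\<close>)

sublocale E: cubic_pair fE s t by (rule cubic_E)

lemma fun_field_E: "fun_field (x, y) = E.F"
proof
  note E = is_subfield_fun_field[of "(x, y)"]
  have "x \<in> fun_field (x, y)" "y \<in> fun_field (x, y)"
    using fst_in_fun_field[of "(x, y)"] snd_in_fun_field[of "(x, y)"] by simp_all
  then have s: "s \<in> fun_field (x, y)" unfolding s_def by (intro sf[OF E])
  then have "t \<in> fun_field (x, y)"
    unfolding t_def using \<open>x \<in> fun_field (x, y)\<close> by (intro sf[OF E])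
  then show "E.F \<subseteq> fun_field (x, y)"
    using s by (intro fun_field_least[OF E]) (auto simp: const_in_fun_field)
next
  have "y \<in> E.F" unfolding y_s by (intro E.F_intros)
  moreover have "x \<in> E.F" unfolding x_st by (intro E.F_intros)
  ultimately show "fun_field (x, y) \<subseteq> E.F"
    by (intro fun_field_least[OF E.F]) (auto simp: const_in_fun_field)
qed

lemma points_E: "points (edwards d) = places E.F" and points_L: "points (legendre d) = places L.F"
  by (simp_all add: points_eq gpE gpL fun_field_E)

lemma function_field_E: "function_field (edwards d) = E.F" and function_field_L: "function_field (legendre d) = L.F"
  by (simp_all add: function_field_eq gpE gpL fun_field_E)

section \<open>The images of the generic points satisfy the target equations\<close>

definition pu where "pu = 1 / x\<^sup>2"
definition pv where "pv = y * (c - 1) / (x * (1 - y\<^sup>2))"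
definition hx where "hx = 2 * v / (c - u\<^sup>2)"
definition hy where "hy = (v\<^sup>2 - u\<^sup>2 * (1 - c)) / (v\<^sup>2 + u\<^sup>2 * (1 - c))"

lemma psi_eq: "psi d = (pu, pv)" and psi_hat_eq: "psi_hat d = (hx, hy)"
  by (simp_all add: psi_def psi_hat_def gpE gpL pu_def pv_def hx_def hy_def base_const_def D_def)

lemma y_sq_nz: "1 - y\<^sup>2 \<noteq> 0"
  using y_nz by (metis mult_eq_0_iff one_power2 square_diff_square_factored power2_eq_square)

lemma pu_nonconst: "pu \<notin> range const"
proof
  assume "pu \<in> range const"
  then obtain e where e: "pu = const e" by blast
  then have "pev [:-1, 0, e:] x = 0"
    using x_nz by (simp add: pu_def field_simps power2_eq_square)
  then have "[:-1, 0, e:] = 0" using pev_eq_0_iff[OF x_nonconst] by blast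
  then show False by simp
qed

lemma pu_eq: "pu * (1 - y\<^sup>2) = 1 - c * y\<^sup>2"
  using edwards_rel x_nz by (simp add: pu_def field_simps)

text \<open>Thus the factors pu, pu - 1 and pu - c of the Legendre cubic are 1 / x^2, y^2 (1 - c) /
  (1 - y^2) and (1 - c) / (1 - y^2), whose product is visibly the square of
  \<open>pv\<close>.\<close>

lemma pu_minus: "(pu - 1) * (1 - y\<^sup>2) = y\<^sup>2 * (1 - c)" "(pu - c) * (1 - y\<^sup>2) = 1 - c"
  using pu_eq by (simp_all add: algebra_simps)

lemma psi_rel: "pv\<^sup>2 = pu * (pu - 1) * (pu - c)"
proof -
  have "pv\<^sup>2 = y\<^sup>2 * (c - 1)\<^sup>2 / (x\<^sup>2 * (1 - y\<^sup>2)\<^sup>2)"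
    by (simp add: pv_def power_divide power_mult_distrib)
  then have "(1 - y\<^sup>2)\<^sup>2 * pv\<^sup>2 = y\<^sup>2 * (c - 1)\<^sup>2 / x\<^sup>2"
    using y_sq_nz by simp
  also have "\<dots> = pu * (y\<^sup>2 * (1 - c)) * (1 - c)"
    by (simp add: pu_def power2_commute[of c 1]) (simp add: power2_eq_square)
  also have "\<dots> = pu * ((pu - 1) * (1 - y\<^sup>2)) * ((pu - c) * (1 - y\<^sup>2))"
    by (simp only: pu_minus)
  also have "\<dots> = (1 - y\<^sup>2)\<^sup>2 * (pu * (pu - 1) * (pu - c))"
    by (simp only: power2_eq_square ac_simps)
  finally show ?thesis using y_sq_nz by simp
qed

lemma relations_psi: "same_relations (u, v) (pu, pv)"
  by (rule relations_L[OF pu_nonconst psi_rel])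

lemma u_nz: "u \<noteq> 0" "u - 1 \<noteq> 0" "u - c \<noteq> 0" "c - u\<^sup>2 \<noteq> 0"
proof -
  show "u \<noteq> 0" "u - 1 \<noteq> 0" "u - c \<noteq> 0"
    using nonconst_nz[OF u_nonconst, of 0] nonconst_nz[OF u_nonconst, of 1] nonconst_nz[OF u_nonconst, of D] by simp_all
  show "c - u\<^sup>2 \<noteq> 0"
    using L.pev_s[of "[:D, 0, -1:]"] by (simp add: power2_eq_square)
qed

lemma v_nz: "v \<noteq> 0" by (rule L.t_nz)

lemma v_sq: "v\<^sup>2 = u * (u - 1) * (u - c)" using legendre_rel by (simp add: pev_fL)

lemma hy_nz: "u\<^sup>2 - 2 * c * u + c \<noteq> 0"
  using L.pev_s[of "[:D, - 2 * D, 1:]"] by (simp add: power2_eq_square algebra_simps)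

text \<open>The Legendre equation turns numerator and denominator into u times a quadratic in u, so
  \<open>hy\<close> is a function of u alone.\<close>

lemma hy_eq: "hy = (u\<^sup>2 - 2 * u + c) / (u\<^sup>2 - 2 * c * u + c)"
proof -
  have "v\<^sup>2 - u\<^sup>2 * (1 - c) = u * (u\<^sup>2 - 2 * u + c)" "v\<^sup>2 + u\<^sup>2 * (1 - c) = u * (u\<^sup>2 - 2 * c * u + c)"
    unfolding v_sq by (simp_all add: power2_eq_square algebra_simps)
  then show ?thesis using u_nz by (simp add: hy_def)
qed

lemma hx_sq: "hx\<^sup>2 = 4 * (u * (u - 1) * (u - c)) / (c - u\<^sup>2)\<^sup>2"
  by (simp add: hx_def power_divide power_mult_distrib flip: v_sq)

lemma hx_nonconst: "hx \<notin> range const"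
proof
  assume "hx \<in> range const"
  then obtain e where e: "hx = const e" by blast
  have "hx\<^sup>2 * (c - u\<^sup>2)\<^sup>2 = 4 * (u * (u - 1) * (u - c))" using u_nz by (simp add: hx_sq)
  \<comment> \<open>The coefficient 4 of u^3 does not involve \<open>e\<close>, so this polynomial
    is never zero.\<close>
  then have "pev [:- (e\<^sup>2 * D\<^sup>2), 4 * D, 2 * D * e\<^sup>2 - 4 * (1 + D), 4, - (e\<^sup>2):] u = 0"
    unfolding e by (simp add: power2_eq_square algebra_simps)
  then have "[:- (e\<^sup>2 * D\<^sup>2), 4 * D, 2 * D * e\<^sup>2 - 4 * (1 + D), 4, - (e\<^sup>2):] = 0"
    using pev_eq_0_iff[OF u_nonconst] by blast
  then show False using four by simp
qed

lemma psi_hat_rel: "hx\<^sup>2 + hy\<^sup>2 = 1 + c * hx\<^sup>2 * hy\<^sup>2"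
proof -
  let ?A = "(c - u\<^sup>2)\<^sup>2" and ?B = "u\<^sup>2 - 2 * c * u + c" and ?N = "u\<^sup>2 - 2 * u + c" and ?M = "4 * (u * (u - 1) * (u - c))"
  have "?M * ?B\<^sup>2 + ?N\<^sup>2 * ?A = ?A * ?B\<^sup>2 + c * ?M * ?N\<^sup>2"
    by (simp add: power2_eq_square algebra_simps)
  moreover have "M / A + (N / B)\<^sup>2 = 1 + c * (M / A) * (N / B)\<^sup>2"
    if "M * B\<^sup>2 + N\<^sup>2 * A = A * B\<^sup>2 + c * M * N\<^sup>2" "A \<noteq> 0" "B \<noteq> 0" for M A B N
  proof -
    have "M / A + (N / B)\<^sup>2 = (M * B\<^sup>2 + N\<^sup>2 * A) / (A * B\<^sup>2)"
      using that by (simp add: power_divide add_frac_eq)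
    also have "\<dots> = 1 + c * (M / A) * (N / B)\<^sup>2"
      unfolding that(1) using that by (simp add: power_divide add_divide_distrib)
    finally show ?thesis .
  qed
  ultimately show ?thesis
    unfolding hx_sq hy_eq using u_nz(4) hy_nz by simp
qed

lemma relations_psi_hat: "same_relations (x, y) (hx, hy)"
  by (rule relations_E[OF hx_nonconst psi_hat_rel])

end

section \<open>Quadratic extensions and a criterion for degree two\<close>

lemma dimension_two:
  fixes K0 :: "'a::field set"
  assumes K0: "is_subfield K0" and w: "w \<notin> K0"
  shows "ring.dimension ring_of_type_algebra 2 K0 {a + b * w | a b. a \<in> K0 \<and> b \<in> K0}"
proof -
  let ?R = "ring_of_type_algebra :: 'a ring"
  interpret ring ?R by (rule ring_from_type_algebra)
  have ops: "carrier ?R = UNIV" "\<And>p q. p \<otimes>\<^bsub>?R\<^esub> q = p * q" "\<And>p q. p \<oplus>\<^bsub>?R\<^esub> q = p + q" "\<zero>\<^bsub>?R\<^esub> = 0"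
    by (simp_all add: ring_of_type_algebra_def)
  have ext: "line_extension K0 p E = {k * p + e | k e. k \<in> K0 \<and> e \<in> E}" for p E
    unfolding set_eq_iff line_extension_mem_iff ops by blast
  \<comment> \<open>\<open>dimension\<close> is built up by line extensions from the zero space:
    first along 1, which gives \<open>K0\<close>, then along \<open>w\<close>.\<close>
  have "line_extension K0 1 {0} = K0" by (auto simp: ext)
  moreover have "dimension 1 K0 (line_extension K0 1 {0})"
    using Suc_dim[of 1 "{\<zero>\<^bsub>?R\<^esub>}" 0 K0] zero_dim by (simp add: ops)
  ultimately have "dimension (Suc 1) K0 (line_extension K0 w K0)"
    using Suc_dim[of w K0 1 K0] w by (simp add: ops)
  moreover have "line_extension K0 w K0 = {a + b * w | a b. a \<in> K0 \<and> b \<in> K0}"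
    by (auto simp: ext add.commute)
  ultimately show ?thesis by (simp add: numeral_2_eq_2)
qed

lemma is_subfield_quadratic_extension:
  fixes K0 :: "'a::field set"
  assumes K0: "is_subfield K0" and w: "w \<notin> K0" and quad: "w\<^sup>2 = \<alpha> * w + \<beta>" "\<alpha> \<in> K0" "\<beta> \<in> K0"
  shows "is_subfield {a + b * w | a b. a \<in> K0 \<and> b \<in> K0}" (is "is_subfield ?S")
  unfolding is_subfield_def
proof (intro conjI ballI)
  have I: "z \<in> ?S" if "z = a + b * w" "a \<in> K0" "b \<in> K0" for z a b using that by blast
  show "1 \<in> ?S" by (rule I[of _ 1 0]) (auto intro: sf[OF K0])
  fix z z' assume "z \<in> ?S" "z' \<in> ?S"
  then obtain a b a' b' where z: "z = a + b * w" "a \<in> K0" "b \<in> K0" and z': "z' = a' + b' * w" "a' \<in> K0" "b' \<in> K0" by blast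
  show "z - z' \<in> ?S"
    by (rule I[of _ "a - a'" "b - b'"]) (use z z' in \<open>auto simp: algebra_simps intro: sf[OF K0]\<close>)
  have "z * z' = a * a' + (a * b' + a' * b) * w + b * b' * w\<^sup>2"
    by (simp add: z(1) z'(1) power2_eq_square algebra_simps)
  also have "\<dots> = (a * a' + b * b' * \<beta>) + (a * b' + a' * b + b * b' * \<alpha>) * w"
    unfolding quad(1) by (simp add: algebra_simps)
  finally show "z * z' \<in> ?S"
    by (rule I) (use z z' quad in \<open>auto intro!: sf[OF K0]\<close>)
next
  have I: "z \<in> ?S" if "z = a + b * w" "a \<in> K0" "b \<in> K0" for z a b using that by blast
  fix z assume "z \<in> ?S"
  then obtain a b where z: "z = a + b * w" "a \<in> K0" "b \<in> K0" by blast
  show "inverse z \<in> ?S"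
  proof (cases "b = 0")
    case True
    then show ?thesis using z by (intro I[of _ "inverse a" 0]) (auto intro: sf[OF K0])
  next
    case False
    \<comment> \<open>The other root of the quadratic equation is \<open>\<alpha> - w\<close>;
      \<open>?z'\<close> is the corresponding conjugate of z and \<open>?N\<close> its norm.\<close>
    let ?N = "a\<^sup>2 + a * b * \<alpha> - b\<^sup>2 * \<beta>" and ?z' = "(a + b * \<alpha>) + (- b) * w"
    have "z * ?z' = a\<^sup>2 + a * b * \<alpha> + b\<^sup>2 * (\<alpha> * w) - b\<^sup>2 * w\<^sup>2"
      by (simp add: z(1) power2_eq_square algebra_simps)
    also have "\<dots> = ?N" unfolding quad(1) by (simp add: algebra_simps)
    finally have N: "z * ?z' = ?N" .
    have notin: "e + f * w \<noteq> 0" if "e \<in> K0" "f \<in> K0" "f \<noteq> 0" for e f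
    proof
      assume "e + f * w = 0"
      then have "w = - e / f" using that by (simp add: field_simps eq_neg_iff_add_eq_0)
      then show False using w that by (auto intro: sf[OF K0])
    qed
    have "?z' \<noteq> 0" using z False quad by (intro notin) (auto intro!: sf[OF K0])
    then have "inverse z = ?z' / (z * ?z')" by (simp add: inverse_eq_divide)
    then have "inverse z = ?z' / ?N" unfolding N .
    then have "inverse z = (a + b * \<alpha>) / ?N + (- b / ?N) * w"
      by (simp add: add_divide_distrib diff_divide_distrib)
    then show ?thesis
      by (rule I) (use z quad in \<open>auto intro!: sf[OF K0]\<close>)
  qed
qed

text \<open>Used contrapositively: a function moved by a translation that fixes the two pulled back
  coordinates cannot lie in the field they generate.\<close>

lemma specialize_fixes:
  assumes sr: "same_relations p q" and ab: "a \<in> fun_field p" "b \<in> fun_field p"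
    and fix_ab: "specialize p q a = a" "specialize p q b = b" and z: "z \<in> fun_field (a, b)"
  shows "specialize p q z = z"
proof -
  have sub: "fun_field (a, b) \<subseteq> fun_field p"
    by (rule fun_field_least[OF is_subfield_fun_field]) (use ab in \<open>auto intro: const_in_fun_field\<close>)
  have e: "specialize p q (eval2 g (a, b)) = eval2 g (a, b)" for g
    using specialize_eval2'[OF sr ab] fix_ab by simp
  obtain g h where "z = eval2 g (a, b) / eval2 h (a, b)" using z by (auto simp: fun_field_def)
  moreover have "eval2 g (a, b) \<in> fun_field p" for g using eval2_in_fun_field sub by blast
  ultimately show ?thesis by (simp add: specialize_divide[OF sr] e)
qed

lemma base_fun_field_subset: "base_fun_field p \<subseteq> fun_field p"
  by (rule base_fun_field_least[OF is_subfield_fun_field])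
    (auto simp: base_const_def const_in_fun_field fst_in_fun_field snd_in_fun_field)

text \<open>The equation \<open>quad\<close> bounds the degree by two, and \<open>w\<close> outside
  the pulled back field bounds it from below. The form of \<open>gen\<close> asks only that both
  coordinates of C be expressed through \<open>w\<close> and the pulled back field.\<close>

lemma isogeny_of_degree_twoI:
  assumes sr: "same_relations (generic_point C') \<phi>"
    and \<phi>: "fst \<phi> \<in> base_function_field C" "snd \<phi> \<in> base_function_field C"
    and orig: "image_point C' \<phi> (origin C) = origin C'"
    and w: "w \<in> base_function_field C" "w \<notin> base_fun_field \<phi>"
    and quad: "w\<^sup>2 = \<alpha> * w + \<beta>" "\<alpha> \<in> base_fun_field \<phi>" "\<beta> \<in> base_fun_field \<phi>"
    and gen: "\<And>S. is_subfield S \<Longrightarrow> base_fun_field \<phi> \<subseteq> S \<Longrightarrow> w \<in> S \<Longrightarrow>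
      fst (generic_point C) \<in> S \<and> snd (generic_point C) \<in> S"
  shows "isogeny_of_degree 2 C C' \<phi>"
proof -
  let ?K = "base_fun_field \<phi>" and ?S = "{a + b * w | a b. a \<in> base_fun_field \<phi> \<and> b \<in> base_fun_field \<phi>}"
  note K = is_subfield_base_fun_field[of \<phi>] and E = is_subfield_base_fun_field[of "generic_point C"]
  have S: "is_subfield ?S" by (rule is_subfield_quadratic_extension[OF K w(2) quad])
  have KS: "?K \<subseteq> ?S" using sf_0[OF K] by force
  have wS: "w \<in> ?S" using sf_0[OF K] sf_1[OF K] by force
  have KE: "?K \<subseteq> base_function_field C"
    unfolding base_function_field_eq
    by (rule base_fun_field_least[OF E])
      (use \<phi> in \<open>auto simp: base_function_field_eq base_const_in_base_fun_field\<close>)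
  have "base_function_field C = ?S"
  proof
    show "base_function_field C \<subseteq> ?S"
      unfolding base_function_field_eq using gen[OF S KS wS] KS
      by (intro base_fun_field_least[OF S]) (auto simp: base_const_in_base_fun_field subset_iff)
    show "?S \<subseteq> base_function_field C"
      using KE w(1) E by (auto simp: base_function_field_eq intro!: sf_add[OF E] sf_mult[OF E])
  qed
  then have "ring.dimension ring_of_type_algebra 2 ?K (base_function_field C)"
    using dimension_two[OF K w(2)] by simp
  then show ?thesis
    unfolding isogeny_of_degree_def dominant_rational_map_def
    using sr \<phi> orig
    by (simp add: same_relations_def pullback_eq base_function_field_eq specialize_base_image[OF sr])
qed

section \<open>Places over (0, 1), (0, -1) and the point at infinity\<close>

context edwards_legendre
begin

text \<open>The scaling factor is itself the third coordinate and reduces to 1, so dividing by it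
  recovers x and y; conversely the factor 1 serves.\<close>

lemma lies_over_affine:
  assumes R: "R \<in> places E.F"
  shows "lies_over (edwards d) R (0, e, 1) \<longleftrightarrow> reduces_to R x 0 \<and> reduces_to R y e"
proof -
  note P = E.F R
  have "reduces_to R x 0 \<and> reduces_to R y e"
    if "reduces_to R (\<sigma> * x) 0" "reduces_to R (\<sigma> * y) e" "reduces_to R \<sigma> 1" for \<sigma>
  proof -
    have "\<sigma> \<noteq> 0" using that(3) reduces_to_unique[OF P reduces_to_const[OF P, of 0], of 1] by auto
    then show ?thesis
      using reduces_to_divide[OF P that(1,3)] reduces_to_divide[OF P that(2,3)] by simp
  qed
  moreover have "1 \<in> E.F" by (intro E.F_intros)
  ultimately show ?thesis
    unfolding lies_over_def gpE function_field_E
    using max_ideal_0[OF P] by (auto simp: reduces_to_def intro: bexI[of _ 1])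
qed

text \<open>If s were regular, s (1 - y) = 1 + y would vanish where y reduces to 1, contrary to 2
  being nonzero. Conversely, y = (1 - 1 / s) / (1 + 1 / s) and x = 2 (s / t) reduce as required at
  infinity.\<close>

lemma over_one_iff:
  assumes R: "R \<in> places E.F"
  shows "reduces_to R x 0 \<and> reduces_to R y 1 \<longleftrightarrow> R \<in> E.places_inf"
proof
  note P = E.F R
  assume xy: "reduces_to R x 0 \<and> reduces_to R y 1"
  show "R \<in> E.places_inf"
  proof (rule ccontr)
    assume "R \<notin> E.places_inf"
    then have "s \<in> R" using R by (auto simp: E.places_inf_def)
    moreover have "1 - y \<in> max_ideal R"
      using max_ideal_minus[OF P, of "y - 1"] xy by (simp add: reduces_to_def)
    ultimately have "1 + y \<in> max_ideal R" using max_ideal_mult'[OF P] s_y by metis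
    moreover have "reduces_to R (const 1 + y) (1 + 1)"
      using xy by (intro reduces_to_add[OF P] reduces_to_const[OF P]) auto
    ultimately show False using reduces_to_in_max_ideal_iff[OF P, of "1 + y" "1 + 1"] two by simp
  qed
next
  note P = E.F R
  assume inf: "R \<in> E.places_inf"
  have i: "reduces_to R (inverse s) 0"
    using inverse_in_max_ideal[OF P E.s_F E.places_inf_s[OF inf]] by (simp add: reduces_to_def)
  have "reduces_to R ((const 1 - inverse s) / (const 1 + inverse s)) ((1 - 0) / (1 + 0))"
    by (intro reduces_to_divide[OF P] reduces_to_diff[OF P] reduces_to_add[OF P] reduces_to_const[OF P] i) simp
  moreover have "(const 1 - inverse s) / (const 1 + inverse s) = y"
    unfolding y_s using s_nz s1_nz by (simp add: field_simps)
  ultimately have "reduces_to R y 1" by simp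
  moreover have "reduces_to R (const 2 * (s / t)) (2 * 0)"
    using E.s_over_t_max_ideal[OF inf] by (intro reduces_to_mult[OF P] reduces_to_const[OF P]) (simp add: reduces_to_def)
  then have "reduces_to R x 0" by (simp add: x_st)
  ultimately show "reduces_to R x 0 \<and> reduces_to R y 1" by simp
qed

lemma fE_0: "poly fE 0 = 0" by (simp add: fE_def)

text \<open>The point (0, -1) becomes the point (0, 0) of order two on the cubic. There s / t is of
  the form 0 / 0 and is rewritten as t / g(s) with \<open>g\<close> not vanishing at 0.\<close>

lemma over_minus_one_iff:
  assumes R: "R \<in> places E.F"
  shows "reduces_to R x 0 \<and> reduces_to R y (- 1) \<longleftrightarrow> R \<in> E.places_at 0 0"
proof
  note P = E.F R
  assume xy: "reduces_to R x 0 \<and> reduces_to R y (- 1)"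
  have "reduces_to R ((const 1 + y) / (const 1 - y)) ((1 + - 1) / (1 - (- 1)))"
    using xy two by (intro reduces_to_divide[OF P] reduces_to_diff[OF P] reduces_to_add[OF P] reduces_to_const[OF P]) auto
  then have s0: "reduces_to R s 0" by (simp add: s_def)
  then obtain a b where "reduces_to R s a" "reduces_to R t b" "b\<^sup>2 = poly fE a"
    using E.center_exists[OF R reduces_to_in[OF P]] by metis
  moreover from this have "a = 0" using s0 reduces_to_unique[OF P] by blast
  ultimately have "reduces_to R t 0" by (simp add: fE_0)
  then show "R \<in> E.places_at 0 0" using s0 R by (simp add: E.places_at_def)
next
  note P = E.F R
  assume R0: "R \<in> E.places_at 0 0"
  note s = E.places_at_s[OF R0] and t = E.places_at_t[OF R0]
  have "reduces_to R ((s - const 1) / (s + const 1)) ((0 - 1) / (0 + 1))"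
    by (intro reduces_to_divide[OF P] reduces_to_diff[OF P] reduces_to_add[OF P] reduces_to_const[OF P] s) simp
  then have "reduces_to R y (- 1)" by (simp add: y_s)
  moreover have "reduces_to R x 0"
  proof -
    obtain g where g: "s - const 0 = t\<^sup>2 / pev g s" "poly g 0 \<noteq> 0" using E.s_minus_root[OF fE_0] .
    have "reduces_to R (const 2 * (t / pev g s)) (2 * (0 / poly g 0))"
      by (intro reduces_to_divide[OF P] reduces_to_mult[OF P] reduces_to_const[OF P] reduces_to_pev[OF P] s t g)
    moreover have "s = t * (t / pev g s)" using g(1) by (simp add: power2_eq_square)
    then have "s / t = t / pev g s" using t_nz by (metis nonzero_mult_div_cancel_left)
    then have "const 2 * (t / pev g s) = const 2 * (s / t)" by (simp only:)
    then have "const 2 * (t / pev g s) = x" by (simp add: x_st)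
    ultimately show ?thesis by simp
  qed
  ultimately show "reduces_to R x 0 \<and> reduces_to R y (- 1)" by simp
qed

lemma point_over_E_one: "point_over (edwards d) (0, 1, 1) \<in> E.places_inf"
proof -
  obtain Z where Z: "Z \<in> E.places_inf" using E.places_inf_exists .
  have "R \<in> places E.F \<and> lies_over (edwards d) R (0, 1, 1) \<longleftrightarrow> R \<in> E.places_inf" for R
    using lies_over_affine over_one_iff E.places_inf_places by blast
  then show ?thesis
    unfolding point_over_def points_E by (simp only:) (rule theI[of "\<lambda>R. R \<in> E.places_inf" Z], rule Z, rule E.places_inf_unique[OF _ Z])
qed

lemma point_over_E_minus_one: "point_over (edwards d) (0, - 1, 1) \<in> E.places_at 0 0"
proof -
  have f0: "0\<^sup>2 = poly fE 0" by (simp add: fE_0)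
  obtain Z where Z: "Z \<in> E.places_at 0 0" using E.places_at_exists[OF f0] .
  have "R \<in> places E.F \<and> lies_over (edwards d) R (0, - 1, 1) \<longleftrightarrow> R \<in> E.places_at 0 0" for R
    using lies_over_affine over_minus_one_iff E.places_at_places by blast
  then show ?thesis
    unfolding point_over_def points_E by (simp only:) (rule theI[of "\<lambda>R. R \<in> E.places_at 0 0" Z], rule Z, rule E.places_at_unique[OF f0 _ Z])
qed

text \<open>Scaling by 1 / v gives (u / v : 1 : 1 / v), whose outer entries vanish at infinity. At a
  finite place v is regular, so the second coordinate could not reduce to 1 while the third reduces
  to 0.\<close>

lemma lies_over_infinity:
  assumes R: "R \<in> places L.F"
  shows "lies_over (legendre d) R (0, 1, 0) \<longleftrightarrow> R \<in> L.places_inf"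
proof
  note P = L.F R
  assume "lies_over (legendre d) R (0, 1, 0)"
  then obtain \<sigma> where \<sigma>: "\<sigma> * v - 1 \<in> max_ideal R" "\<sigma> \<in> max_ideal R"
    by (auto simp: lies_over_def gpL)
  show "R \<in> L.places_inf"
  proof (rule ccontr)
    assume "R \<notin> L.places_inf"
    then have "u \<in> R" using R by (auto simp: L.places_inf_def)
    then obtain b where "reduces_to R v b" using L.center_exists[OF R] by metis
    then have "\<sigma> * v \<in> max_ideal R" using max_ideal_mult[OF P \<sigma>(2) reduces_to_in[OF P]] by blast
    then have "1 \<in> max_ideal R" using max_ideal_diff[OF P _ \<sigma>(1)] by force
    then show False using max_ideal_1[OF P] by simp
  qed
next
  note P = L.F R
  assume inf: "R \<in> L.places_inf"
  have "u / v \<in> max_ideal R" by (rule L.s_over_t_max_ideal[OF inf])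
  moreover have "inverse v \<in> max_ideal R"
    using max_ideal_mult[OF P calculation max_ideal_subset[OF P inverse_in_max_ideal[OF P L.s_F L.places_inf_s[OF inf]]]] u_nz
    by (simp add: field_simps)
  moreover have "inverse v \<in> L.F" by (intro L.F_intros)
  ultimately show "lies_over (legendre d) R (0, 1, 0)"
    unfolding lies_over_def gpL function_field_L
    using v_nz max_ideal_0[OF P] by (auto simp: field_simps intro!: bexI[of _ "inverse v"])
qed

lemma point_over_L: "point_over (legendre d) (0, 1, 0) \<in> L.places_inf"
proof -
  obtain Z where Z: "Z \<in> L.places_inf" using L.places_inf_exists .
  have "R \<in> places L.F \<and> lies_over (legendre d) R (0, 1, 0) \<longleftrightarrow> R \<in> L.places_inf" for R
    using lies_over_infinity L.places_inf_places by blast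
  then show ?thesis
    unfolding point_over_def points_L by (simp only:) (rule theI[of "\<lambda>R. R \<in> L.places_inf" Z], rule Z, rule L.places_inf_unique[OF _ Z])
qed

lemma origin_E_eq: "origin (edwards d) = point_over (edwards d) (0, 1, 1)"
  and origin_L_eq: "origin (legendre d) = point_over (legendre d) (0, 1, 0)"
  by (simp_all add: origin_def edwards_def legendre_def)

lemma origin_E: "origin (edwards d) \<in> E.places_inf" and origin_L: "origin (legendre d) \<in> L.places_inf"
  using point_over_E_one point_over_L by (simp_all add: origin_E_eq origin_L_eq)

lemma x_EF: "x \<in> E.F" and y_EF: "y \<in> E.F"
  using fst_in_fun_field[of "(x, y)"] snd_in_fun_field[of "(x, y)"] by (simp_all add: fun_field_E)

lemma psi_in_EF: "pu \<in> E.F" "pv \<in> E.F"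
  unfolding pu_def pv_def by (intro E.F_intros x_EF y_EF)+

lemma psi_hat_in_LF: "hx \<in> L.F" "hy \<in> L.F"
  unfolding hx_def hy_def by (intro L.F_intros)+

lemma psi_sub: "fun_field (pu, pv) \<subseteq> E.F"
  by (rule fun_field_least[OF E.F]) (use psi_in_EF E.const_F in auto)

lemma psi_hat_sub: "fun_field (hx, hy) \<subseteq> L.F"
  by (rule fun_field_least[OF L.F]) (use psi_hat_in_LF L.const_F in auto)

lemma image_psi_places:
  "P \<in> places E.F \<Longrightarrow> image_point (legendre d) (psi d) P \<in> places L.F"
  unfolding image_point_eq psi_eq gpL
  by (rule E.preimage_place_places'[OF relations_psi psi_sub]) (simp_all add: pu_nonconst)

lemma image_psi_hat_places:
  "P \<in> places L.F \<Longrightarrow> image_point (edwards d) (psi_hat d) P \<in> places E.F"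
  unfolding image_point_eq psi_hat_eq gpE fun_field_E[symmetric]
  by (rule L.preimage_place_places'[OF relations_psi_hat psi_hat_sub]) (simp_all add: hx_nonconst)

lemma image_psi_inf:
  assumes P: "P \<in> places E.F" and x0: "reduces_to P x 0"
  shows "image_point (legendre d) (psi d) P \<in> L.places_inf"
proof -
  have "pu \<notin> P"
  proof
    assume "pu \<in> P"
    moreover have "x * x \<in> max_ideal P"
      using x0 max_ideal_mult[OF E.F P] max_ideal_subset[OF E.F P] reduces_to_0[OF E.F P] by blast
    ultimately have "pu * (x * x) \<in> max_ideal P" by (rule max_ideal_mult'[OF E.F P])
    then show False using x_nz max_ideal_1[OF E.F P] by (simp add: pu_def power2_eq_square)
  qed
  then have "u \<notin> image_point (legendre d) (psi d) P"
    using specialize_fst[OF relations_psi]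
    by (simp add: image_point_eq psi_eq gpL preimage_place_def)
  then show ?thesis using image_psi_places[OF P] by (simp add: L.places_inf_def)
qed

lemma image_psi_origin: "image_point (legendre d) (psi d) (point_over (edwards d) (0, 1, 1)) = point_over (legendre d) (0, 1, 0)"
  using L.places_inf_unique[OF image_psi_inf point_over_L] point_over_E_one over_one_iff E.places_inf_places by blast

lemma image_psi_minus_one: "image_point (legendre d) (psi d) (point_over (edwards d) (0, - 1, 1)) = point_over (legendre d) (0, 1, 0)"
  using L.places_inf_unique[OF image_psi_inf point_over_L] point_over_E_minus_one over_minus_one_iff E.places_at_places by blast

text \<open>With a = v^2 and b = u^2 (1 - c), \<open>hy\<close> is (a - b) / (a + b), and the
  quotient that defines s collapses to a / b.\<close>

lemma hy_quotient: "(1 + hy) / (1 - hy) = v\<^sup>2 / (u\<^sup>2 * (1 - c))"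
proof -
  let ?a = "v\<^sup>2" and ?b = "u\<^sup>2 * (1 - c)"
  have "?a + ?b = u * (u\<^sup>2 - 2 * c * u + c)" unfolding v_sq by (simp add: power2_eq_square algebra_simps)
  then have nz: "?a + ?b \<noteq> 0" using u_nz hy_nz by simp
  have "1 + hy = 2 * ?a / (?a + ?b)" "1 - hy = 2 * ?b / (?a + ?b)"
    unfolding hy_def using nz by (simp_all add: field_simps)
  then show ?thesis using nz two' by simp
qed

lemma spec_hat_s: "specialize (x, y) (hx, hy) s = v\<^sup>2 / (u\<^sup>2 * (1 - c))"
  unfolding s_def hy_quotient[symmetric] using x_EF y_EF specialize_snd[OF relations_psi_hat]
  by (simp add: specialize_simps[OF relations_psi_hat] specialize_1[OF relations_psi_hat] fun_field_E E.F_intros)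

lemma image_psi_hat_origin: "image_point (edwards d) (psi_hat d) (origin (legendre d)) = origin (edwards d)"
proof -
  let ?Z = "origin (legendre d)" and ?h = "v\<^sup>2 / (u\<^sup>2 * (1 - c))"
  note Z = L.places_inf_places[OF origin_L]
  note P = L.F Z
  have "?h \<notin> ?Z"
  proof
    assume h: "?h \<in> ?Z"
    have iu: "inverse u \<in> ?Z"
      using place_valuation[OF P L.s_F L.places_inf_s[OF origin_L]] .
    \<comment> \<open>By the Legendre equation u = (1 - c) h + (1 + c) - c / u, so regularity of h
      would make u regular at infinity.\<close>
    have "const (1 - D) * ?h + const (1 + D) - const D * inverse u \<in> ?Z"
      by (intro place_diff[OF P] place_add[OF P] place_mult[OF P] place_const[OF P] h iu)
    also have "const (1 - D) * ?h + const (1 + D) - const D * inverse u = u"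
      unfolding v_sq using u_nz c1 by (simp add: field_simps power2_eq_square)
    finally show False using L.places_inf_s[OF origin_L] by simp
  qed
  then have "s \<notin> image_point (edwards d) (psi_hat d) ?Z"
    by (simp add: image_point_eq psi_hat_eq gpE preimage_place_def spec_hat_s)
  then have "image_point (edwards d) (psi_hat d) ?Z \<in> E.places_inf"
    using image_psi_hat_places[OF Z] by (simp add: E.places_inf_def)
  then show ?thesis using E.places_inf_unique origin_E by blast
qed

section \<open>Degrees of the two maps\<close>

lemma c_base: "base_const d = c" by (simp add: base_const_def D_def)

text \<open>The field k(x, y) arises from k(pu, pv) by adjoining x, a square root of 1 / pu.\<close>

lemma isogeny_psi: "isogeny_of_degree 2 (edwards d) (legendre d) (psi d)"
proof (rule isogeny_of_degree_twoI[where w = x and \<alpha> = 0 and \<beta> = "1 / pu"])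
  let ?K = "base_fun_field (psi d)"
  note K = is_subfield_base_fun_field
  have pK: "pu \<in> ?K" "pv \<in> ?K" "c \<in> ?K"
    using fst_in_base_fun_field[of "psi d"] snd_in_base_fun_field[of "psi d"] base_const_in_base_fun_field[of d "psi d"]
    by (simp_all add: psi_eq c_base)
  have xyB: "x \<in> base_function_field (edwards d)" "y \<in> base_function_field (edwards d)" "c \<in> base_function_field (edwards d)"
    unfolding base_function_field_eq gpE
    using fst_in_base_fun_field[of "(x, y)"] snd_in_base_fun_field[of "(x, y)"] base_const_in_base_fun_field[of d "(x, y)"]
    by (simp_all add: c_base)
  note B = is_subfield_base_fun_field[of "(x, y)", folded gpE base_function_field_eq]
  show "same_relations (generic_point (legendre d)) (psi d)"
    using relations_psi by (simp add: gpL psi_eq)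
  show "fst (psi d) \<in> base_function_field (edwards d)" "snd (psi d) \<in> base_function_field (edwards d)"
    unfolding psi_eq fst_conv snd_conv pu_def pv_def by (intro sf[OF B] xyB)+
  show "image_point (legendre d) (psi d) (origin (edwards d)) = origin (legendre d)"
    using image_psi_origin by (simp add: origin_E_eq origin_L_eq)
  show "x \<in> base_function_field (edwards d)" by (rule xyB)
  \<comment> \<open>The claim is shown over K, where \<open>specialize\<close> provides the
    translation as an automorphism; it negates x and y and so preserves \<open>pu\<close> and
    \<open>pv\<close>.\<close>
  show "x \<notin> ?K"
  proof
    assume "x \<in> ?K"
    then have x: "x \<in> fun_field (pu, pv)" using base_fun_field_subset by (auto simp: psi_eq)
    have "- x \<notin> range const"
    proof
      assume "- x \<in> range const"
      then obtain e where "- x = const e" by blast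
      then have "x = const (- e)" by (simp add: minus_equation_iff[of x])
      then show False using x_nonconst by blast
    qed
    \<comment> \<open>translation by the point \<open>(0, - 1)\<close> of order two\<close>
    then have sr: "same_relations (x, y) (- x, - y)"
      using edwards_rel by (intro relations_E) simp_all
    have mem: "x \<in> fun_field (x, y)" "y \<in> fun_field (x, y)" "c \<in> fun_field (x, y)"
      "pu \<in> fun_field (x, y)" "pv \<in> fun_field (x, y)"
      using x_EF y_EF psi_in_EF by (simp_all add: fun_field_E E.const_F)
    have sxy: "specialize (x, y) (- x, - y) x = - x" "specialize (x, y) (- x, - y) y = - y"
      using specialize_fst[OF sr] specialize_snd[OF sr] by simp_all
    have "specialize (x, y) (- x, - y) pu = pu" "specialize (x, y) (- x, - y) pv = pv"
      unfolding pu_def pv_def using mem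
      by (simp_all add: specialize_simps[OF sr] specialize_1[OF sr] specialize_const[OF sr] sxy sf[OF is_subfield_fun_field])
    then have "specialize (x, y) (- x, - y) x = x"
      using specialize_fixes[OF sr mem(4,5)] x by blast
    then have "- x = x" using sxy by simp
    then have "2 * x = 0" by (metis add.right_inverse mult_2)
    then show False using two' x_nz by simp
  qed
  show "x\<^sup>2 = 0 * x + 1 / pu" using x_nz by (simp add: pu_def)
  show "0 \<in> ?K" "1 / pu \<in> ?K" by (intro sf[OF K] pK)+
  fix S assume S: "is_subfield S" "?K \<subseteq> S" "x \<in> S"
  \<comment> \<open>Inserting 1 - c = (pu - c)(1 - y^2) cancels 1 - y^2 in \<open>pv\<close> and
    leaves pv x = - y (pu - c), which recovers y.\<close>
  have "pu - c \<noteq> 0" using pu_minus(2) c1 by auto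
  have "pv * x * (1 - y\<^sup>2) = y * (c - 1)"
    using x_nz y_sq_nz by (simp add: pv_def)
  also have "\<dots> = - y * (1 - c)" by (simp add: algebra_simps)
  also have "\<dots> = - y * (pu - c) * (1 - y\<^sup>2)" by (simp only: pu_minus(2)[symmetric] mult.assoc)
  finally have "pv * x = - y * (pu - c)" using mult_right_cancel[OF y_sq_nz] by blast
  then have "y = - (pv * x) / (pu - c)" using \<open>pu - c \<noteq> 0\<close> by simp
  moreover have "- (pv * x) / (pu - c) \<in> S"
    using S pK by (intro sf[OF S(1)]) auto
  ultimately show "fst (generic_point (edwards d)) \<in> S \<and> snd (generic_point (edwards d)) \<in> S"
    using S(3) by (simp add: gpE)
qed

text \<open>By \<open>hy_quotient\<close>, u + c / u equals (1 - c)(1 + hy) / (1 - hy) + (1 + c).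
  This trace and the norm c give the quadratic equation of u; v is then recovered from
  \<open>hx\<close>.\<close>

lemma isogeny_psi_hat: "isogeny_of_degree 2 (legendre d) (edwards d) (psi_hat d)"
proof (rule isogeny_of_degree_twoI[where w = u and \<alpha> = "(1 - c) * ((1 + hy) / (1 - hy)) + (1 + c)" and \<beta> = "- c"])
  let ?K = "base_fun_field (psi_hat d)"
  note K = is_subfield_base_fun_field
  have pK: "hx \<in> ?K" "hy \<in> ?K" "c \<in> ?K"
    using fst_in_base_fun_field[of "psi_hat d"] snd_in_base_fun_field[of "psi_hat d"] base_const_in_base_fun_field[of d "psi_hat d"]
    by (simp_all add: psi_hat_eq c_base)
  have uvB: "u \<in> base_function_field (legendre d)" "v \<in> base_function_field (legendre d)" "c \<in> base_function_field (legendre d)"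
    unfolding base_function_field_eq gpL
    using fst_in_base_fun_field[of "(u, v)"] snd_in_base_fun_field[of "(u, v)"] base_const_in_base_fun_field[of d "(u, v)"]
    by (simp_all add: c_base)
  note B = is_subfield_base_fun_field[of "(u, v)", folded gpL base_function_field_eq]
  show "same_relations (generic_point (edwards d)) (psi_hat d)"
    using relations_psi_hat by (simp add: gpE psi_hat_eq)
  show "fst (psi_hat d) \<in> base_function_field (legendre d)" "snd (psi_hat d) \<in> base_function_field (legendre d)"
    unfolding psi_hat_eq fst_conv snd_conv hx_def hy_def by (intro sf[OF B] uvB)+
  show "image_point (edwards d) (psi_hat d) (origin (legendre d)) = origin (edwards d)"
    by (rule image_psi_hat_origin)
  show "u \<in> base_function_field (legendre d)" by (rule uvB)
  show "u \<notin> ?K"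
  proof
    assume "u \<in> ?K"
    then have u: "u \<in> fun_field (hx, hy)" using base_fun_field_subset by (auto simp: psi_hat_eq)
    \<comment> \<open>translation by the point \<open>(0, 0)\<close> of order two\<close>
    let ?q = "(c / u, - (c * v / u\<^sup>2))"
    have nc: "c / u \<notin> range const"
    proof
      assume "c / u \<in> range const"
      then obtain e where "c / u = const e" by blast
      then have "u = const (D / e)" using u_nz c0 by (auto simp: field_simps)
      then show False using u_nonconst by blast
    qed
    have "(- (c * v / u\<^sup>2))\<^sup>2 = c\<^sup>2 * v\<^sup>2 / (u\<^sup>2)\<^sup>2" by (simp add: power_divide power_mult_distrib)
    also have "\<dots> = (c / u) * (c / u - 1) * (c / u - c)"
      unfolding v_sq using u_nz(1) by (simp add: field_simps power2_eq_square)
    finally have sr: "same_relations (u, v) ?q" by (rule relations_L[OF nc])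
    have mem: "hx \<in> L.F" "hy \<in> L.F" by (rule psi_hat_in_LF)+
    have suv: "specialize (u, v) ?q u = c / u" "specialize (u, v) ?q v = - (c * v / u\<^sup>2)"
      using specialize_fst[OF sr] specialize_snd[OF sr] by simp_all
    have ne: "c - (c / u)\<^sup>2 \<noteq> 0" "u\<^sup>2 - c \<noteq> 0"
    proof -
      show "u\<^sup>2 - c \<noteq> 0" using u_nz(4) by simp
      have "(c - (c / u)\<^sup>2) * u\<^sup>2 = c * (u\<^sup>2 - c)"
        using u_nz(1) by (simp add: power_divide algebra_simps) (simp add: power2_eq_square)
      then show "c - (c / u)\<^sup>2 \<noteq> 0" using \<open>u\<^sup>2 - c \<noteq> 0\<close> c0 by auto
    qed
    have "specialize (u, v) ?q hx = 2 * (- (c * v / u\<^sup>2)) / (c - (c / u)\<^sup>2)"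
      unfolding hx_def
      by (simp add: specialize_simps[OF sr] specialize_numeral[OF sr] specialize_const[OF sr] suv L.F_intros)
    also have "\<dots> = hx"
    proof -
      have "2 * (- (c * v / u\<^sup>2)) * (c - u\<^sup>2) = 2 * v * (c - (c / u)\<^sup>2)"
        using u_nz(1) by (simp add: power_divide field_simps) (simp add: power2_eq_square algebra_simps)
      then show ?thesis unfolding hx_def using frac_eq_eq[OF ne(1) u_nz(4)] by blast
    qed
    finally have 1: "specialize (u, v) ?q hx = hx" .
    have "specialize (u, v) ?q hy = ((c / u)\<^sup>2 - 2 * (c / u) + c) / ((c / u)\<^sup>2 - 2 * c * (c / u) + c)"
      unfolding hy_eq
      by (simp add: specialize_simps[OF sr] specialize_numeral[OF sr] specialize_const[OF sr] suv L.F_intros)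
    also have "\<dots> = hy"
    proof -
      have "(c / u)\<^sup>2 - 2 * (c / u) + c = (c / u\<^sup>2) * (u\<^sup>2 - 2 * u + c)"
        "(c / u)\<^sup>2 - 2 * c * (c / u) + c = (c / u\<^sup>2) * (u\<^sup>2 - 2 * c * u + c)"
        using u_nz(1) by (simp_all add: power_divide field_simps power2_eq_square)
      then show ?thesis unfolding hy_eq using u_nz(1) c0 by simp
    qed
    finally have 2: "specialize (u, v) ?q hy = hy" .
    have "specialize (u, v) ?q u = u" using specialize_fixes[OF sr mem 1 2 u] .
    then have "c = u\<^sup>2" using suv u_nz(1) by (simp add: field_simps power2_eq_square)
    then show False using u_nz(4) by simp
  qed
  have "(1 - c) * ((1 + hy) / (1 - hy)) * u = (u - 1) * (u - c)"
    unfolding hy_quotient v_sq using u_nz(1) c1 by (simp add: power2_eq_square)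
  moreover have "((1 - c) * h + (1 + c)) * u + - c = (1 - c) * h * u + ((1 + c) * u - c)" for h
    by (simp add: algebra_simps)
  moreover have "u\<^sup>2 = (u - 1) * (u - c) + ((1 + c) * u - c)"
    by (simp add: power2_eq_square algebra_simps)
  ultimately show "u\<^sup>2 = ((1 - c) * ((1 + hy) / (1 - hy)) + (1 + c)) * u + - c"
    by (simp only:)
  show "(1 - c) * ((1 + hy) / (1 - hy)) + (1 + c) \<in> ?K" "- c \<in> ?K" by (intro sf[OF K] pK)+
  fix S assume S: "is_subfield S" "?K \<subseteq> S" "u \<in> S"
  have "v = hx * (c - u\<^sup>2) / 2" using u_nz(4) two' by (simp add: hx_def)
  moreover have "hx * (c - u\<^sup>2) / 2 \<in> S"
    using S pK by (intro sf[OF S(1)]) auto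
  ultimately have "v \<in> S" by (simp only:)
  then show "fst (generic_point (legendre d)) \<in> S \<and> snd (generic_point (legendre d)) \<in> S"
    using S(3) by (simp add: gpL)
qed

section \<open>The composite of the two maps in the coordinates s and t\<close>

definition s2 where "s2 = (1 - c) * (s\<^sup>2 - 1)\<^sup>2 / (4 * t\<^sup>2)"
definition t2 where "t2 = - ((s\<^sup>2 - 1) * (16 * c * s ^ 4 - t ^ 4) / (8 * s\<^sup>2 * t ^ 3))"

lemma pu_st: "pu = t\<^sup>2 / (4 * s\<^sup>2)"
  by (simp add: pu_def x_st power_divide power_mult_distrib)

lemma pv_st: "pv = (c - 1) * (s\<^sup>2 - 1) * t / (8 * s\<^sup>2)"
proof -
  have "(1 - y\<^sup>2) * (s + 1)\<^sup>2 = (s + 1)\<^sup>2 - (s - 1)\<^sup>2"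
    unfolding y_s using s1_nz by (simp add: power_divide left_diff_distrib)
  also have "\<dots> = 4 * s" by (simp add: power2_eq_square algebra_simps)
  finally have "1 - y\<^sup>2 = 4 * s / (s + 1)\<^sup>2" using s1_nz by (simp add: eq_divide_eq)
  then have "pv = ((s - 1) / (s + 1)) * (c - 1) / ((2 * s / t) * (4 * s / (s + 1)\<^sup>2))"
    unfolding pv_def x_st[symmetric] y_s[symmetric] by simp
  also have "\<dots> = (c - 1) * ((s - 1) * (s + 1)) * t / (8 * s\<^sup>2)"
    using s1_nz by (simp add: power2_eq_square)
  also have "(s - 1) * (s + 1) = s\<^sup>2 - 1" by (simp add: power2_eq_square algebra_simps)
  finally show ?thesis .
qed

lemma spec_psi: "specialize (u, v) (pu, pv) u = pu" "specialize (u, v) (pu, pv) v = pv"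
  using specialize_fst[OF relations_psi] specialize_snd[OF relations_psi] by simp_all

text \<open>Pullback is contravariant, so the embedding along \<open>psi_hat\<close> is applied
  first. Because t^2 = fE(s), \<open>s2\<close> is the Montgomery doubling formula (s^2 - 1)^2 / (4
  s (s^2 + A s + 1)) with A = 2 (1 + D) / (1 - D).\<close>

lemma composite_s: "specialize (u, v) (pu, pv) (specialize (x, y) (hx, hy) s) = s2"
proof -
  have "specialize (u, v) (pu, pv) (v\<^sup>2 / (u\<^sup>2 * (1 - c))) = pv\<^sup>2 / (pu\<^sup>2 * (1 - c))"
    by (simp add: specialize_simps[OF relations_psi] specialize_1[OF relations_psi] specialize_const[OF relations_psi] spec_psi L.F_intros)
  also have "\<dots> = s2"
  proof -
    have 1: "pv\<^sup>2 = (1 - c)\<^sup>2 * (s\<^sup>2 - 1)\<^sup>2 * t\<^sup>2 / (64 * (s\<^sup>2)\<^sup>2)"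
      by (simp add: pv_st power_divide power_mult_distrib power2_commute[of c 1])
    have 2: "pu\<^sup>2 = (t\<^sup>2 * t\<^sup>2) / (16 * (s\<^sup>2)\<^sup>2)"
      unfolding pu_st power_divide power_mult_distrib by (simp add: power2_eq_square[of "t\<^sup>2"])
    have alg: "K\<^sup>2 * W * T / (64 * S) / (T * T / (16 * S) * K) = K * W / (4 * T)"
      if "K \<noteq> 0" "T \<noteq> 0" "S \<noteq> 0" for K W T S :: "'k ambient"
    proof -
      have nz: "(16::'k ambient) \<noteq> 0" "(64::'k ambient) \<noteq> 0"
        using two' by (metis mult_eq_0_iff numeral_Bit0 mult_2)+
      have "K\<^sup>2 * W * T / (64 * S) / (T * T / (16 * S) * K) = (K\<^sup>2 * W * T * (16 * S)) / ((64 * S) * (T * T * K))"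
        by (simp add: mult.assoc)
      also have "\<dots> = K * W / (4 * T)"
        using that nz four' by (subst frac_eq_eq) (simp_all add: power2_eq_square)
      finally show ?thesis .
    qed
    show ?thesis
      unfolding s2_def 1 2 by (rule alg) (use s_nz t_nz c1 in simp_all)
  qed
  finally show ?thesis by (simp add: spec_hat_s)
qed

text \<open>With \<open>spec_hat_s\<close> this shows that, in cubic coordinates,
  \<open>psi_hat\<close> is (v^2 / u^2, v (c - u^2) / u^2) divided by 1 - c: the usual quotient of
  v^2 = u (u^2 - (1 + c) u + c) by the point (0, 0).\<close>

lemma spec_hat_t: "specialize (x, y) (hx, hy) t = v * (c - u\<^sup>2) / (u\<^sup>2 * (1 - c))"
proof -
  have "specialize (x, y) (hx, hy) t = 2 * (v\<^sup>2 / (u\<^sup>2 * (1 - c))) / hx"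
    unfolding t_def using x_EF E.s_F specialize_fst[OF relations_psi_hat]
    by (simp add: specialize_simps[OF relations_psi_hat] specialize_numeral[OF relations_psi_hat] fun_field_E spec_hat_s E.F_intros)
  also have "\<dots> = v * (c - u\<^sup>2) / (u\<^sup>2 * (1 - c))"
    using u_nz v_nz two' by (simp add: hx_def power2_eq_square)
  finally show ?thesis .
qed

lemma composite_t: "specialize (u, v) (pu, pv) (specialize (x, y) (hx, hy) t) = t2"
proof -
  have "specialize (u, v) (pu, pv) (v * (c - u\<^sup>2) / (u\<^sup>2 * (1 - c))) = pv * (c - pu\<^sup>2) / (pu\<^sup>2 * (1 - c))"
    by (simp add: specialize_simps[OF relations_psi] specialize_1[OF relations_psi] specialize_const[OF relations_psi] spec_psi L.F_intros)
  also have "\<dots> = t2"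
  proof -
    have 2: "pu\<^sup>2 = t ^ 4 / (16 * s ^ 4)"
      by (simp add: pu_st power_divide power_mult_distrib flip: power_mult)
    have nz: "(16 :: 'k ambient) \<noteq> 0" "(8 :: 'k ambient) \<noteq> 0"
      using four' two' by (metis mult_eq_0_iff numeral_Bit0 mult_2)+
    have "c - t ^ 4 / (16 * s ^ 4) = (16 * c * s ^ 4 - t ^ 4) / (16 * s ^ 4)"
      using nz s_nz by (simp add: field_simps)
    then have "pv * (c - pu\<^sup>2) / (pu\<^sup>2 * (1 - c))
      = ((c - 1) * (s\<^sup>2 - 1) * t / (8 * s\<^sup>2)) * ((16 * c * s ^ 4 - t ^ 4) / (16 * s ^ 4)) / (t ^ 4 / (16 * s ^ 4) * (1 - c))"
      unfolding 2 pv_st by (simp only:)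
    also have "c - 1 = - (1 - c)" by simp
    also have "t ^ 4 / (16 * s ^ 4) = t ^ 3 * t / (16 * s ^ 4)" by (simp add: numeral_eq_Suc)
    also have "(- (1 - c) * (s\<^sup>2 - 1) * t / (8 * s\<^sup>2)) * ((16 * c * s ^ 4 - t ^ 4) / (16 * s ^ 4)) / (t ^ 3 * t / (16 * s ^ 4) * (1 - c)) = t2"
    proof -
      have alg: "(- K * W * T / B) * (M / G) / (T3 * T / G * K) = - (W * M / (B * T3))"
        if "K \<noteq> 0" "T \<noteq> 0" "G \<noteq> 0" for K W T B M G T3 :: "'k ambient"
        using that by simp
      show ?thesis unfolding t2_def by (rule alg) (use nz s_nz t_nz c1 in simp_all)
    qed
    finally show ?thesis .
  qed
  finally show ?thesis by (simp add: spec_hat_t)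
qed

abbreviation double where
  "double P \<equiv> image_point (edwards d) (psi_hat d) (image_point (legendre d) (psi d) P)"

lemma double_places: "P \<in> places E.F \<Longrightarrow> double P \<in> places E.F"
  by (intro image_psi_hat_places image_psi_places)

lemma double_composite:
  assumes P: "P \<in> places E.F" and z: "z \<in> E.F"
  shows "reduces_to (double P) z e \<longleftrightarrow> reduces_to P (specialize (u, v) (pu, pv) (specialize (x, y) (hx, hy) z)) e"
    and "z \<in> double P \<longleftrightarrow> specialize (u, v) (pu, pv) (specialize (x, y) (hx, hy) z) \<in> P"
proof -
  have zL: "specialize (x, y) (hx, hy) z \<in> L.F"
    using z specialize_image[OF relations_psi_hat] psi_hat_sub by (auto simp: fun_field_E)
  show "reduces_to (double P) z e \<longleftrightarrow> reduces_to P (specialize (u, v) (pu, pv) (specialize (x, y) (hx, hy) z)) e"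
    using preimage_place_reduces_to[OF relations_psi_hat L.F psi_hat_sub image_psi_places[OF P], of z e]
      preimage_place_reduces_to[OF relations_psi E.F psi_sub P zL, of e] z
    by (simp add: image_point_eq psi_eq psi_hat_eq gpE gpL fun_field_E)
  show "z \<in> double P \<longleftrightarrow> specialize (u, v) (pu, pv) (specialize (x, y) (hx, hy) z) \<in> P"
    using z zL by (simp add: image_point_eq psi_eq psi_hat_eq gpE gpL fun_field_E preimage_place_def)
qed

lemma s2_F: "s2 \<in> E.F" unfolding s2_def by (intro E.F_intros)

text \<open>A form free of fractions, with polynomials of degree 4 and 3 in s, from which the order
  of \<open>s2\<close> at infinity is read off.\<close>

lemma s2_poly: "s2 * pev (smult 4 fE) s = pev (smult (1 - D) ([:-1, 0, 1:] * [:-1, 0, 1:])) s"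
proof -
  have "pev (smult 4 fE) s = 4 * t\<^sup>2" by (simp add: t_sq)
  moreover have "pev (smult (1 - D) ([:-1, 0, 1:] * [:-1, 0, 1:])) s = (1 - c) * (s\<^sup>2 - 1)\<^sup>2"
    unfolding pev_smult pev_mult by (simp add: power2_eq_square)
  ultimately show ?thesis using t_nz four' by (simp add: s2_def)
qed

text \<open>At infinity the degrees 4 and 3 give \<open>s2\<close> the order -2. At a root of
  \<open>fE\<close> the denominator of \<open>s2\<close> vanishes, while the numerator could vanish
  only at 1 or -1, where \<open>fE\<close> has the nonzero values 4 and 4 D.\<close>

lemma double_inf:
  assumes "P \<in> E.places_inf \<or> (\<exists>a. poly fE a = 0 \<and> P \<in> E.places_at a 0)"
  shows "double P \<in> E.places_inf"
proof -
  let ?p = "smult (1 - D) ([:-1, 0, 1:] * [:-1, 0, 1:])" and ?r = "smult 4 fE"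
  have P: "P \<in> places E.F" using assms E.places_inf_places E.places_at_places by blast
  have p0: "?p \<noteq> 0" and r0: "?r \<noteq> 0" using D1 four E.f_nz by simp_all
  have "s2 \<notin> P"
    using assms
  proof
    assume inf: "P \<in> E.places_inf"
    have "pev ?p s \<noteq> 0" and rz: "pev ?r s \<noteq> 0"
      using E.pev_s[of ?p] E.pev_s[of ?r] p0 r0 by blast+
    then have nz: "s2 \<noteq> 0" unfolding s2_poly[symmetric] mult_eq_0_iff by blast
    have "ord_at P (s2 * pev ?r s) = ord_at P s2 + ord_at P (pev ?r s)"
      by (rule ord_at_mult[OF E.discrete[OF P] s2_F E.pev_F nz rz])
    moreover have "degree ?p = 4" using D1 by simp
    moreover have "degree ?r = 3" using four E.deg by simp
    ultimately have "ord_at P s2 = - 2"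
      unfolding s2_poly using E.ord_at_inf_poly[OF inf p0] E.ord_at_inf_poly[OF inf r0] by simp
    then show ?thesis using ord_at_nonneg_iff[OF E.discrete[OF P] s2_F nz] by simp
  next
    assume "\<exists>a. poly fE a = 0 \<and> P \<in> E.places_at a 0"
    then obtain a where a: "poly fE a = 0" "P \<in> E.places_at a 0" by blast
    note red = reduces_to_pev[OF E.F P E.places_at_s[OF a(2)]]
    show ?thesis
    proof
      assume "s2 \<in> P"
      moreover have "pev ?r s \<in> max_ideal P"
        using red[of ?r] a(1) reduces_to_in_max_ideal_iff[OF E.F P] by auto
      ultimately have "pev ?p s \<in> max_ideal P"
        unfolding s2_poly[symmetric] by (rule max_ideal_mult'[OF E.F P])
      then have "poly ?p a = 0" using red[of ?p] reduces_to_in_max_ideal_iff[OF E.F P] by blast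
      moreover have "poly ?p a = (1 - D) * ((a - 1) * (a + 1))\<^sup>2"
        by (simp add: power2_eq_square algebra_simps)
      ultimately have "(1 - D) * ((a - 1) * (a + 1))\<^sup>2 = 0" by (simp only:)
      then have "(a - 1) * (a + 1) = 0" using D1 by simp
      then consider "a = 1" | "a = - 1" by (auto simp: add_eq_0_iff2)
      then show False
      proof cases
        case 1
        then have "poly fE a = 4" by (simp add: poly_fE)
        then show ?thesis using a(1) four by simp
      next
        case 2
        then have "poly fE a = 4 * D" by (simp add: poly_fE algebra_simps)
        then show ?thesis using a(1) four D0 by simp
      qed
    qed
  qed
  then have "s \<notin> double P" using double_composite(2)[OF P E.s_F] composite_s by simp
  then show ?thesis using double_places[OF P] by (simp add: E.places_inf_def)
qed

section \<open>The tangent line of the cubic\<close>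

lemma eight: "(8::'k alg_closure) \<noteq> 0"
  using four by (metis mult_2_right mult_eq_0_iff numeral_Bit0)

text \<open>Here \<open>m\<close> is the derivative of \<open>fE\<close> at \<open>a\<close> divided
  by 2 b, the slope of the tangent at (a, b), and \<open>e\<close> is the value of \<open>s2\<close>
  at that point.\<close>

context
  fixes a b m e :: "'k alg_closure"
  assumes b: "b\<^sup>2 = poly fE a" "b \<noteq> 0"
    and slope: "m = (3 * (1 - D) * a\<^sup>2 + 4 * (1 + D) * a + (1 - D)) / (2 * b)"
    and e: "e = (1 - D) * (a\<^sup>2 - 1)\<^sup>2 / (4 * b\<^sup>2)"
begin

lemma slope_eq: "2 * b * m = 3 * (1 - D) * a\<^sup>2 + 4 * (1 + D) * a + (1 - D)"
  using b two by (simp add: slope)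

lemma e_eq: "4 * b\<^sup>2 * e = (1 - D) * (a\<^sup>2 - 1)\<^sup>2"
  using b(2) four by (simp add: e)

text \<open>The relation that Vieta's formula demands if a, a, e are to be the roots of
  \<open>fE\<close> minus the square of the line; the factor 4 b^2 clears all denominators.\<close>

lemma slope_sq: "m\<^sup>2 = 2 * (1 + D) + (1 - D) * (2 * a + e)"
proof -
  have "4 * b\<^sup>2 * m\<^sup>2 = (2 * b * m)\<^sup>2" by (simp add: power_mult_distrib)
  also have "\<dots> = 4 * b\<^sup>2 * (2 * (1 + D) + (1 - D) * (2 * a)) + (1 - D) * (4 * b\<^sup>2 * e)"
    unfolding slope_eq e_eq unfolding b(1) poly_fE by (simp add: power2_eq_square algebra_simps)
  also have "\<dots> = 4 * b\<^sup>2 * (2 * (1 + D) + (1 - D) * (2 * a + e))" by (simp add: algebra_simps)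
  finally show ?thesis using b(2) four by simp
qed

lemma tangent_line:
  "fE - [:b - m * a, m:] * [:b - m * a, m:] = smult (1 - D) ([:-a, 1:] * [:-a, 1:] * [:-e, 1:])"
proof -
  let ?\<beta> = "b - m * a"
  have 1: "2 * m * ?\<beta> = 2 * b * m - 2 * a * m\<^sup>2" by (simp add: power2_eq_square algebra_simps)
  have 0: "?\<beta>\<^sup>2 = b\<^sup>2 - a * (2 * b * m) + a\<^sup>2 * m\<^sup>2" by (simp add: power2_eq_square algebra_simps)
  have c0: "- (?\<beta> * ?\<beta>) = - ((1 - D) * (a * a * e))"
    using 0 unfolding slope_eq slope_sq b(1) poly_fE by (simp add: power2_eq_square algebra_simps)
  have c1: "1 - D - 2 * m * ?\<beta> = (1 - D) * (a * a + 2 * a * e)"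
    unfolding 1 slope_eq slope_sq by (simp add: power2_eq_square algebra_simps)
  have c2: "2 * (1 + D) - m * m = (1 - D) * (- 2 * a - e)"
    using slope_sq by (simp add: power2_eq_square algebra_simps)
  have "fE - [:?\<beta>, m:] * [:?\<beta>, m:] = [: - (?\<beta> * ?\<beta>), 1 - D - 2 * m * ?\<beta>, 2 * (1 + D) - m * m, 1 - D:]"
    by (simp add: fE_def algebra_simps)
  also have "\<dots> = smult (1 - D) ([:-a, 1:] * [:-a, 1:] * [:-e, 1:])"
    unfolding c0 c1 c2 by (simp add: algebra_simps)
  finally show ?thesis .
qed

text \<open>The ordinate of the tangent over \<open>e\<close>. Its value is the negative of that of
  \<open>t2\<close>, so the composite lands on the reflection of the third intersection
  point.\<close>

lemma tangent_third_point:
  assumes a: "a \<noteq> 0"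
  shows "b + m * (e - a) = (a\<^sup>2 - 1) * (16 * D * a ^ 4 - b ^ 4) / (8 * a\<^sup>2 * b ^ 3)"
proof -
  have b4: "b ^ 4 = (poly fE a)\<^sup>2" unfolding b(1)[symmetric] by (simp flip: power_mult)
  have "8 * b ^ 3 * (b + m * (e - a)) = 8 * b ^ 4 + (2 * b * m) * (4 * b\<^sup>2 * e - 4 * b\<^sup>2 * a)"
    by (simp add: power2_eq_square power3_eq_cube power4_eq_xxxx algebra_simps)
  then have "8 * a\<^sup>2 * b ^ 3 * (b + m * (e - a)) = a\<^sup>2 * (8 * b ^ 4 + (2 * b * m) * (4 * b\<^sup>2 * e - 4 * b\<^sup>2 * a))"
    by (simp add: mult.left_commute mult.assoc)
  also have "\<dots> = (a\<^sup>2 - 1) * (16 * D * a ^ 4 - b ^ 4)"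
    unfolding slope_eq e_eq b4 unfolding b(1) poly_fE
    by (simp add: power2_eq_square power4_eq_xxxx algebra_simps)
  finally show ?thesis using a b(2) eight by (simp add: eq_divide_eq mult.commute)
qed

end

section \<open>Doubling and the dual isogeny\<close>

lemma origin_E_places: "origin (edwards d) \<in> places E.F"
  using E.places_inf_places origin_E by blast

lemmas add_points_E = E.add_points_eqI[OF function_field_E points_E origin_E_places]

lemma add_points_origin:
  assumes P: "P \<in> places E.F"
  shows "add_points (edwards d) P (origin (edwards d)) = P"
proof (rule add_points_E[OF P, of 1])
  show "of_bool (S = P) + of_bool (S = origin (edwards d)) - (of_bool (S = P) + of_bool (S = origin (edwards d))) = ord_at S 1"
    if "S \<in> places E.F" for S
    using ord_at_unit[OF E.discrete[OF that], of 1] place_1[OF E.F that] max_ideal_1[OF E.F that] by simp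
qed (auto intro: E.F_intros)

lemma add_points_self:
  assumes P: "P \<in> places E.F"
  shows "add_points (edwards d) P P = double P"
  using P
proof (rule E.place_cases)
  let ?Z = "origin (edwards d)"
  note DP = double_places[OF P]
  show ?thesis if "P \<in> E.places_inf"
  proof -
    have "P = ?Z" "double P = ?Z" using that double_inf E.places_inf_unique origin_E by blast+
    then show ?thesis using add_points_origin[OF P] by simp
  qed
  fix a b assume b: "b\<^sup>2 = poly fE a" and Pab: "P \<in> E.places_at a b"
  show ?thesis
  proof (cases "b = 0")
    case True
    then have fa: "poly fE a = 0" and Pa: "P \<in> E.places_at a 0" using b Pab by simp_all
    then have Z: "double P = ?Z" using double_inf E.places_inf_unique origin_E by blast
    show ?thesis
    proof (rule add_points_E[OF DP, of "s - const a"])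
      show "s - const a \<in> E.F" by (intro E.F_intros)
      show "s - const a \<noteq> 0" using s_nonconst by auto
      show "of_bool (S = P) + of_bool (S = P) - (of_bool (S = double P) + of_bool (S = ?Z)) = ord_at S (s - const a)"
        if "S \<in> places E.F" for S
        using E.divisor_two_torsion[OF fa Pa origin_E that] Z by simp
    qed
  next
    case False
    note R = E.F P
    have "a \<noteq> 0" using b False by (auto simp: fE_0)
    define m where "m = (3 * (1 - D) * a\<^sup>2 + 4 * (1 + D) * a + (1 - D)) / (2 * b)"
    define e where "e = (1 - D) * (a\<^sup>2 - 1)\<^sup>2 / (4 * b\<^sup>2)"
    let ?l = "[:b - m * a, m:]"
    note tan = tangent_line[OF b False m_def e_def] tangent_third_point[OF b False m_def e_def \<open>a \<noteq> 0\<close>]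
    note st = E.places_at_s[OF Pab] E.places_at_t[OF Pab]
    \<comment> \<open>Both \<open>s2\<close> and \<open>t2\<close> are reduced at P with their
      integer constants written through \<open>const\<close>, so that the value at (a, b) follows
      factor by factor.\<close>
    have "reduces_to P ((const 1 - const D) * (s\<^sup>2 - const 1)\<^sup>2 / (const 4 * t\<^sup>2)) ((1 - D) * (a\<^sup>2 - 1)\<^sup>2 / (4 * b\<^sup>2))"
      using False four
      by (intro reduces_to_divide[OF R] reduces_to_mult[OF R] reduces_to_diff[OF R] reduces_to_power[OF R]
          reduces_to_const[OF R] st) simp
    then have "reduces_to P s2 e" by (simp add: s2_def e_def)
    then have se: "reduces_to (double P) s e"
      using double_composite(1)[OF P E.s_F] composite_s by simp
    have "reduces_to P (- ((s\<^sup>2 - const 1) * (const 16 * const D * s ^ 4 - t ^ 4) / (const 8 * s\<^sup>2 * t ^ 3)))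
      (- ((a\<^sup>2 - 1) * (16 * D * a ^ 4 - b ^ 4) / (8 * a\<^sup>2 * b ^ 3)))"
      using False \<open>a \<noteq> 0\<close> eight
      by (intro reduces_to_minus[OF R] reduces_to_divide[OF R] reduces_to_mult[OF R] reduces_to_diff[OF R] reduces_to_power[OF R]
          reduces_to_const[OF R] st) simp
    then have "reduces_to P t2 (- ((a\<^sup>2 - 1) * (16 * D * a ^ 4 - b ^ 4) / (8 * a\<^sup>2 * b ^ 3)))"
      by (simp add: t2_def)
    also have "(a\<^sup>2 - 1) * (16 * D * a ^ 4 - b ^ 4) / (8 * a\<^sup>2 * b ^ 3) = poly ?l e"
      unfolding tan(2)[symmetric] by (simp add: algebra_simps)
    finally have te: "reduces_to (double P) t (- poly ?l e)"
      using double_composite(1)[OF P E.t_F] composite_t by simp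
    have Re: "double P \<in> E.places_at e (- poly ?l e)"
      using DP se te by (simp add: E.places_at_def)
    have la: "poly ?l a = b" by (simp add: algebra_simps)
    show ?thesis
    proof (rule add_points_E[OF DP, of "(t - pev ?l s) / (s - const e)"])
      show "(t - pev ?l s) / (s - const e) \<in> E.F" by (intro E.F_intros)
      have "t - pev ?l s \<noteq> 0"
        using E.independent[of "- ?l" 1] by (simp only: pev_minus pev_1) (simp add: algebra_simps)
      then show "(t - pev ?l s) / (s - const e) \<noteq> 0" using s_nonconst by auto
      fix S assume S: "S \<in> places E.F"
      \<comment> \<open>The value of the line at \<open>a\<close> is \<open>b\<close>, which is
        nonzero in this case, and the leading coefficient 1 - D is nonzero, as
        \<open>divisor_tangent\<close> requires.\<close>
      have "ord_at S ((t - pev ?l s) / (s - const e)) = 2 * of_bool (S = P) - of_bool (S = double P) - of_bool (S = ?Z)"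
        by (rule E.divisor_tangent[OF _ _ tan(1) _ _ Re origin_E S])
          (use False D1 Pab la in \<open>auto simp del: poly_pCons\<close>)
      then show "of_bool (S = P) + of_bool (S = P) - (of_bool (S = double P) + of_bool (S = ?Z))
          = ord_at S ((t - pev ?l s) / (s - const e))" by simp
    qed
  qed
qed

lemma dual_psi: "dual_isogeny (edwards d) (legendre d) (psi d) (psi_hat d)"
  unfolding dual_isogeny_def
proof (intro exI conjI ballI)
  fix P assume "P \<in> points (edwards d)"
  then have P: "P \<in> places E.F" by (simp add: points_E)
  \<comment> \<open>\<open>mult_point\<close> unfolds to P + (P + O), so the inner sum is evaluated
    by \<open>add_points_origin\<close>.\<close>
  show "double P = mult_point (edwards d) 2 P"
    by (simp add: numeral_2_eq_2 add_points_origin[OF P] add_points_self[OF P])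
qed (rule isogeny_psi isogeny_psi_hat)+

end

theorem theorem3p1:
  fixes d :: "'k::field"
  assumes "CHAR('k) \<noteq> 2" and "d \<noteq> 0" and "d \<noteq> 1"
  shows "isogeny_of_degree 2 (edwards d) (legendre d) (psi d)
    \<and> image_point (legendre d) (psi d) (point_over (edwards d) (0, 1, 1))
        = point_over (legendre d) (0, 1, 0)
    \<and> image_point (legendre d) (psi d) (point_over (edwards d) (0, -1, 1))
        = point_over (legendre d) (0, 1, 0)
    \<and> dual_isogeny (edwards d) (legendre d) (psi d) (psi_hat d)"
proof -
  interpret edwards_legendre d using assms by unfold_locales
  show ?thesis
    using isogeny_psi image_psi_origin image_psi_minus_one dual_psi by blast
qed

end
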